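(* Let $X$ be a (smooth) toric Fano threefold whose Futaki invariant does not vanish. Then $X$ is relatively strongly $K$-stable in the toric sense in the anticanonical class if $X$ is one of the following: $\mathcal{B}_1$, $\mathcal{B}_2$, $\mathcal{B}_3$, $\mathcal{C}_1$, $\mathcal{C}_4$, $\mathcal{E}_3$, $\mathcal{E}_4$, $\mathcal{F}_2$.
   Context: The named toric Fano threefolds (Batyrev's notation) are those whose anticanonical moment polytopes $\Delta\subset\mathbb{R}^3$ are the convex hulls of the following points: $\mathcal{B}_1$: $(0,-1,1),(4,-1,-1),(-1,-1,-1),(-1,-1,1),(-1,4,-1),(-1,0,1)$. $\mathcal{B}_2$: $(1,-1,1),(3,-1,-1),(-1,-1,-1),(-1,-1,1),(-1,3,-1),(-1,1,1)$. $\mathcal{B}_3$: $(2,-1,0),(2,-1,-1),(-1,2,-1),(-1,-1,-1),(-1,2,0),(-1,-1,3)$. $\mathcal{C}_1$: $(0,-1,1),(2,-1,-1),(2,2,-1),(0,0,1),(-1,2,-1),(-1,0,1),(-1,-1,-1),(-1,-1,1)$. $\mathcal{C}_4$: $(2,-1,\pm1),(0,1,\pm1),(-1,1,\pm1),(-1,-1,\pm1)$. $\mathcal{E}_3$: $(1,-1,\pm1),(1,0,\pm1),(0,1,\pm1),(-1,1,\pm1),(-1,-1,\pm1)$. $\mathcal{E}_4$: $(1,-1,0),(1,-1,-1),(0,1,-1),(1,0,-1),(1,0,1),(0,1,2),(-1,1,-1),(-1,1,2),(-1,-1,-1),(-1,-1,0)$. $\mathcal{F}_2$: $(0,1,2),(0,1,-1),(1,1,2),(1,0,1),(1,0,-1),(1,1,-1),(0,-1,-1),(0,-1,0),(-1,-1,0),(-1,-1,-1),(-1,0,-1),(-1,0,1)$.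 (E.g. $\mathcal{B}_1=\mathbb{P}(\mathcal{O}_{\mathbb{CP}^2}\oplus\mathcal{O}_{\mathbb{CP}^2}(2))$ and $\mathcal{B}_2=\mathbb{P}(\mathcal{O}_{\mathbb{CP}^2}\oplus\mathcal{O}_{\mathbb{CP}^2}(1))$.) Each such $\Delta$ has the form $\{x:\langle l_j,x\rangle\le 1\}$ with $l_j\in\mathbb{Z}^3$ the primitive outer facet normals. $\mathrm{Vol}$, $dx$: Lebesgue measure; $d\sigma=|l_j|^{-1}d\sigma_0$ on the facet with normal $l_j$, with $d\sigma_0$ the standard surface measure on $\partial\Delta$; $\bar S=\int_{\partial\Delta}d\sigma/\mathrm{Vol}(\Delta)$ and $$\mathcal{L}_\Delta(u)=\int_{\partial\Delta}u\,d\sigma-\int_\Delta(\bar S+\theta_\Delta)u\,dx,$$ where $\theta_\Delta$ is the unique affine linear function such that $\mathcal{L}_\Delta(u)=0$ for all affine linear $u$. The Futaki invariant vanishes if and only if $\theta_\Delta\equiv 0$. Let $\Delta^*$ be the union of the interior of $\Delta$ and the interiors of its codimension-one faces, and let $\mathcal{C}_1$ be the set of functions $u$ convex on $\Delta^*$ with $\int_{\partial\Delta}u\,d\sigma<\infty$. $X$ (with its anticanonical polarization) is relatively strongly $K$-stable in the toric sense if $\mathcal{L}_\Delta(u)\ge0$ for all $u\in\mathcal{C}_1$, and $\mathcal{L}_\Delta(u)=0$ if and only if $u$ is affine linear. *)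

theory Defs
  imports "HOL-Analysis.Analysis"
begin

section \<open>Lattice polytopes in three-space\<close>

definition lattice_vec :: "real^3 \<Rightarrow> bool" where
  "lattice_vec v \<longleftrightarrow> (\<forall>i. v $ i \<in> \<int>)"

definition primitive_vec :: "real^3 \<Rightarrow> bool" where
  "primitive_vec v \<longleftrightarrow> (\<exists>m :: 3 \<Rightarrow> int. v = (\<chi> i. of_int (m i)) \<and> Gcd (range m) = 1)"

definition lattice_basis :: "(real^3) set \<Rightarrow> bool" where
  "lattice_basis B \<longleftrightarrow> finite B \<and> independent B \<and>
     {(\<Sum>b\<in>B. of_int (c b) *\<^sub>R b) | c :: real^3 \<Rightarrow> int. True} = {v. lattice_vec v}"

definition outer_normal :: "(real^3) set \<Rightarrow> (real^3) set \<Rightarrow> real^3" where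
  "outer_normal \<Delta> F = (THE l. primitive_vec l \<and>
     (\<exists>b. \<Delta> \<subseteq> {x. l \<bullet> x \<le> b} \<and> F = \<Delta> \<inter> {x. l \<bullet> x = b}))"

text \<open>
  A smooth toric Fano threefold with its anticanonical polarization is represented by its
  moment polytope: a full-dimensional lattice polytope of the form \<open>{x. \<forall>j. l\<^sub>j \<bullet> x \<le> 1}\<close>
  with primitive outer facet normals \<open>l\<^sub>j\<close>, such that the normals of the facets
  through any vertex form a basis of the lattice (which is smoothness of the variety).
\<close>

definition smooth_fano_polytope :: "(real^3) set \<Rightarrow> bool" where
  "smooth_fano_polytope \<Delta> \<longleftrightarrow>
     polytope \<Delta> \<and> interior \<Delta> \<noteq> {} \<and>
     (\<forall>v. v extreme_point_of \<Delta> \<longrightarrow> lattice_vec v) \<and>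
     \<Delta> = {x. \<forall>F. F facet_of \<Delta> \<longrightarrow> outer_normal \<Delta> F \<bullet> x \<le> 1} \<and>
     (\<forall>v. v extreme_point_of \<Delta> \<longrightarrow>
        lattice_basis (outer_normal \<Delta> ` {F. F facet_of \<Delta> \<and> v \<in> F}))"


section \<open>The boundary measure\<close>

text \<open>
  Area on a plane \<open>P\<close> in space: the image of Lebesgue measure under an isometry of the
  Euclidean plane onto \<open>P\<close>. Which isometry is chosen does not matter, because Lebesgue
  measure on the plane is invariant under isometries.
\<close>

definition plane_chart :: "(real^3) set \<Rightarrow> real^2 \<Rightarrow> real^3" where
  "plane_chart P = (SOME f. (\<forall>x y. dist (f x) (f y) = dist x y) \<and> range f = P)"

definition plane_area :: "(real^3) set \<Rightarrow> (real^3) measure" where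
  "plane_area P = completion (distr lborel borel (plane_chart P))"

text \<open>
  On the facet \<open>F\<close> with normal \<open>l\<close> the measure is \<open>d\<sigma> = \<bar>l\<bar>\<^sup>-\<^sup>1 d\<sigma>\<^sub>0\<close>. The functions integrated below
  matter only on \<open>polytope_star \<Delta>\<close>; the edges of \<open>\<Delta>\<close> are null sets for the (complete)
  area measures, and the boundary of \<open>\<Delta>\<close> is a null set for \<^term>\<open>lebesgue\<close>.
\<close>

definition boundary_integral :: "(real^3) set \<Rightarrow> (real^3 \<Rightarrow> real) \<Rightarrow> real" where
  "boundary_integral \<Delta> u =
     (\<Sum>F | F facet_of \<Delta>. inverse (norm (outer_normal \<Delta> F)) *
        (LINT x:F|plane_area (affine hull F). u x))"

definition average_curvature :: "(real^3) set \<Rightarrow> real" where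
  "average_curvature \<Delta> = boundary_integral \<Delta> (\<lambda>_. 1) / measure lebesgue \<Delta>"


section \<open>The functional and its affine potential\<close>

definition affine_linear_on :: "(real^3) set \<Rightarrow> (real^3 \<Rightarrow> real) \<Rightarrow> bool" where
  "affine_linear_on S u \<longleftrightarrow> (\<exists>a c. \<forall>x\<in>S. u x = a \<bullet> x + c)"

definition L_functional ::
  "(real^3) set \<Rightarrow> (real^3 \<Rightarrow> real) \<Rightarrow> (real^3 \<Rightarrow> real) \<Rightarrow> real" where
  "L_functional \<Delta> \<theta> u =
     boundary_integral \<Delta> u - (LINT x:\<Delta>|lebesgue. (average_curvature \<Delta> + \<theta> x) * u x)"

definition theta :: "(real^3) set \<Rightarrow> real^3 \<Rightarrow> real" where
  "theta \<Delta> = (THE \<theta>. affine_linear_on UNIV \<theta> \<and>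
     (\<forall>u. affine_linear_on UNIV u \<longrightarrow> L_functional \<Delta> \<theta> u = 0))"

definition futaki_vanishes :: "(real^3) set \<Rightarrow> bool" where
  "futaki_vanishes \<Delta> \<longleftrightarrow> theta \<Delta> = (\<lambda>_. 0)"


section \<open>Relative strong K-stability in the toric sense\<close>

definition polytope_star :: "(real^3) set \<Rightarrow> (real^3) set" where
  "polytope_star \<Delta> = interior \<Delta> \<union> (\<Union>F\<in>{F. F facet_of \<Delta>}. rel_interior F)"

text \<open>
  The condition \<open>\<integral>\<^bsub>\<partial>\<Delta>\<^esub> u d\<sigma> < \<infinity>\<close>. A convex function on \<open>polytope_star \<Delta>\<close> is bounded below there, so
  its boundary integral always exists in \<open>(-\<infinity>, \<infinity>]\<close>; it is finite iff that of the positive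
  part of \<open>u\<close> is, and \<^term>\<open>ennreal (u x)\<close> is this positive part.
\<close>

definition finite_boundary_integral :: "(real^3) set \<Rightarrow> (real^3 \<Rightarrow> real) \<Rightarrow> bool" where
  "finite_boundary_integral \<Delta> u \<longleftrightarrow>
     (\<Sum>F | F facet_of \<Delta>. ennreal (inverse (norm (outer_normal \<Delta> F))) *
        (\<integral>\<^sup>+x\<in>F. ennreal (u x) \<partial>plane_area (affine hull F))) < \<infinity>"

definition convex_class :: "(real^3) set \<Rightarrow> (real^3 \<Rightarrow> real) set" where
  "convex_class \<Delta> =
     {u. convex_on (polytope_star \<Delta>) u \<and> finite_boundary_integral \<Delta> u}"

text \<open>
  For \<open>u\<close> in \<open>convex_class \<Delta>\<close> and \<open>\<Delta>\<close> a smooth Fano polytope all integrals in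
  \<^term>\<open>L_functional\<close> converge absolutely.
\<close>

definition relatively_strongly_K_stable :: "(real^3) set \<Rightarrow> bool" where
  "relatively_strongly_K_stable \<Delta> \<longleftrightarrow>
     (\<forall>u \<in> convex_class \<Delta>. L_functional \<Delta> (theta \<Delta>) u \<ge> 0 \<and>
        (L_functional \<Delta> (theta \<Delta>) u = 0 \<longleftrightarrow> affine_linear_on (polytope_star \<Delta>) u))"


section \<open>The named polytopes\<close>

definition polytope_B1 :: "(real^3) set" where
  "polytope_B1 = convex hull {vector [0,-1,1], vector [4,-1,-1], vector [-1,-1,-1],
     vector [-1,-1,1], vector [-1,4,-1], vector [-1,0,1]}"

definition polytope_B2 :: "(real^3) set" where
  "polytope_B2 = convex hull {vector [1,-1,1], vector [3,-1,-1], vector [-1,-1,-1],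
     vector [-1,-1,1], vector [-1,3,-1], vector [-1,1,1]}"

definition polytope_B3 :: "(real^3) set" where
  "polytope_B3 = convex hull {vector [2,-1,0], vector [2,-1,-1], vector [-1,2,-1],
     vector [-1,-1,-1], vector [-1,2,0], vector [-1,-1,3]}"

definition polytope_C1 :: "(real^3) set" where
  "polytope_C1 = convex hull {vector [0,-1,1], vector [2,-1,-1], vector [2,2,-1],
     vector [0,0,1], vector [-1,2,-1], vector [-1,0,1], vector [-1,-1,-1], vector [-1,-1,1]}"

definition polytope_C4 :: "(real^3) set" where
  "polytope_C4 = convex hull {vector [2,-1,1], vector [2,-1,-1], vector [0,1,1],
     vector [0,1,-1], vector [-1,1,1], vector [-1,1,-1], vector [-1,-1,1], vector [-1,-1,-1]}"

definition polytope_E3 :: "(real^3) set" where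
  "polytope_E3 = convex hull {vector [1,-1,1], vector [1,-1,-1], vector [1,0,1],
     vector [1,0,-1], vector [0,1,1], vector [0,1,-1], vector [-1,1,1], vector [-1,1,-1],
     vector [-1,-1,1], vector [-1,-1,-1]}"

definition polytope_E4 :: "(real^3) set" where
  "polytope_E4 = convex hull {vector [1,-1,0], vector [1,-1,-1], vector [0,1,-1],
     vector [1,0,-1], vector [1,0,1], vector [0,1,2], vector [-1,1,-1], vector [-1,1,2],
     vector [-1,-1,-1], vector [-1,-1,0]}"

definition polytope_F2 :: "(real^3) set" where
  "polytope_F2 = convex hull {vector [0,1,2], vector [0,1,-1], vector [1,1,2],
     vector [1,0,1], vector [1,0,-1], vector [1,1,-1], vector [0,-1,-1], vector [0,-1,0],
     vector [-1,-1,0], vector [-1,-1,-1], vector [-1,0,-1], vector [-1,0,1]}"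

end

theory Submission
  imports Defs
begin

text \<open>
  Subtracting a supporting affine function at the interior point \<open>0\<close>, we may assume \<open>u \<ge> 0 = u 0\<close>.
  Since every facet lies on a plane \<open>l \<bullet> x = 1\<close>, at distance \<open>1 / \<bar>l\<bar>\<close> from the origin, integrating over the
  cones from \<open>0\<close> to the facets gives the polar formula
  \<open>\<integral>\<^sub>\<Delta> g dx = \<integral>\<^sub>\<partial>\<^sub>\<Delta> \<integral>\<^sub>0\<^sup>1 t\<^sup>2 g(t y) dt d\<sigma>(y)\<close>. It yields \<open>average_curvature \<Delta> = 3\<close>, and with the convexity
  bound \<open>u (t y) \<le> t u y\<close> and \<open>\<theta> = a \<bullet> x + c \<ge> -3\<close> it yields
  \<open>\<integral>\<^sub>\<Delta> (3 + \<theta>) u dx \<le> \<integral>\<^sub>\<partial>\<^sub>\<Delta> ((3 + c) / 4 + a \<bullet> y / 5) u d\<sigma>\<close>. So \<open>4 (a \<bullet> y) + 5 c < 5\<close> on \<open>\<Delta>\<close> suffices for strong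
  stability. This is weaker than the pointwise condition \<open>\<theta> \<le> 1\<close>, which fails for \<open>polytope_B1\<close>.
  For each polytope \<open>\<theta>\<close> is written down and confirmed by computing moments: \<open>\<theta>\<close> and \<open>(1 - \<theta>) x\<^sub>i\<close>
  must have integral \<open>0\<close>.
\<close>

section \<open>Lebesgue measure, isometries and polar coordinates\<close>

text \<open>Normalising \<open>u\<close> at the origin makes the radial bound linear in
  \<open>t\<close>. The additional factor \<open>t\<close> turns the radial weights 1/3 and 1/4 of
  constant and linear terms into 1/4 and 1/5, and asking for (3 + c)/4 + (a . y)/5 < 1 is the
  inequality of the criterion. On \<open>polytope_B1\<close> the potential is (-620 z - 240)/349: it
  reaches 380/349 > 1 at z = -1, while 4 (a . x) + 5 c reaches only 1280/349 < 5 there. Two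
  obstacles shape the rest. Charts are fixed by \<open>SOME\<close>, normals by \<open>THE\<close>,
  and \<open>u\<close> is uncontrolled on the edges, so measurability and null sets must be
  recovered from continuity on open sets. And the moments must be exact: the polytopes are cut into
  regions between affine graphs, on which nested Newton-Cotes rules reduce every integral to
  rational arithmetic.\<close>

lemma distr_lborel_basis_map:
  fixes f :: "'a::euclidean_space \<Rightarrow> 'b::euclidean_space"
  assumes lin: "linear f" and bij: "bij_betw f Basis Basis"
  shows "distr lborel borel f = lborel"
proof (rule lborel_eqI[symmetric])
  have [measurable]: "f \<in> borel_measurable borel"
    using lin by (intro borel_measurable_continuous_onI linear_continuous_on) (simp add: linear_conv_bounded_linear)
  \<comment> \<open>Coordinates are merely relabelled by \<open>f\<close>. Preimages of boxes are
    therefore boxes with permuted sides, and \<open>lborel\<close> is determined by its values on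
    boxes.\<close>
  have inner_f: "f x \<bullet> f b = x \<bullet> b" if b: "b \<in> Basis" for x b
  proof -
    have "f x = (\<Sum>c\<in>Basis. (x \<bullet> c) *\<^sub>R f c)"
      by (subst euclidean_representation[of x, symmetric])
        (simp only: linear_sum[OF lin] linear_cmul[OF lin])
    then have "f x \<bullet> f b = (\<Sum>c\<in>Basis. (x \<bullet> c) * (f c \<bullet> f b))"
      by (simp add: inner_sum_left)
    also have "\<dots> = (\<Sum>c\<in>Basis. (x \<bullet> c) * (if c = b then 1 else 0))"
    proof (rule sum.cong[OF refl])
      fix c :: 'a assume c: "c \<in> Basis"
      have "f c \<in> Basis" "f b \<in> Basis" "f c = f b \<longleftrightarrow> c = b"
        using bij b c by (auto simp: bij_betw_def inj_on_def)
      then show "(x \<bullet> c) * (f c \<bullet> f b) = (x \<bullet> c) * (if c = b then 1 else 0)"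
        by (simp add: inner_Basis)
    qed
    also have "\<dots> = x \<bullet> b" using b by (simp add: if_distrib cong: if_cong)
    finally show ?thesis .
  qed
  fix l u :: 'b assume lu: "\<And>b. b \<in> Basis \<Longrightarrow> l \<bullet> b \<le> u \<bullet> b"
  define l' u' :: 'a where "l' = (\<Sum>b\<in>Basis. (l \<bullet> f b) *\<^sub>R b)" and "u' = (\<Sum>b\<in>Basis. (u \<bullet> f b) *\<^sub>R b)"
  have l': "l' \<bullet> b = l \<bullet> f b" and u': "u' \<bullet> b = u \<bullet> f b" if "b \<in> Basis" for b
    using that by (simp_all add: l'_def u'_def)
  have fB: "Basis = f ` Basis" using bij by (simp add: bij_betw_def)
  have "f -` box l u = box l' u'"
  proof (intro set_eqI)
    fix x
    have "x \<in> f -` box l u \<longleftrightarrow> (\<forall>b\<in>f ` Basis. l \<bullet> b < f x \<bullet> b \<and> f x \<bullet> b < u \<bullet> b)"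
      using fB by (simp add: mem_box)
    also have "\<dots> \<longleftrightarrow> x \<in> box l' u'" by (simp add: mem_box inner_f l' u')
    finally show "x \<in> f -` box l u \<longleftrightarrow> x \<in> box l' u'" .
  qed
  then have "emeasure (distr lborel borel f) (box l u) = emeasure lborel (box l' u')"
    by (simp add: emeasure_distr)
  also have "\<dots> = ennreal (prod ((\<bullet>) (u' - l')) Basis)"
  proof -
    have "\<And>b. b \<in> Basis \<Longrightarrow> l' \<bullet> b \<le> u' \<bullet> b"
      using lu fB by (metis imageI l' u')
    then show ?thesis by (simp add: emeasure_lborel_box)
  qed
  also have "prod ((\<bullet>) (u' - l')) Basis = (\<Prod>b\<in>Basis. (u - l) \<bullet> f b)"
    by (rule prod.cong) (simp_all add: inner_diff_left l' u')
  also have "\<dots> = prod ((\<bullet>) (u - l)) Basis"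
    by (rule prod.reindex_bij_betw[OF bij])
  finally show "emeasure (distr lborel borel f) (box l u) = ennreal (prod ((\<bullet>) (u - l)) Basis)" .
qed simp

text \<open>The preimage of a box is its image under the inverse, which is again orthogonal and so
  preserves the measure of images.\<close>

lemma distr_lborel_orthogonal:
  fixes f :: "real^'n::{finite,wellorder} \<Rightarrow> real^'n::{finite,wellorder}"
  assumes f: "orthogonal_transformation f"
  shows "distr lborel borel f = lborel"
proof (rule lborel_eqI[symmetric])
  have [measurable]: "f \<in> borel_measurable borel"
    using orthogonal_transformation_linear[OF f]
    by (intro borel_measurable_continuous_onI linear_continuous_on) (simp add: linear_conv_bounded_linear)
  fix l u :: "real^'n::{finite,wellorder}" assume lu: "\<And>b. b \<in> Basis \<Longrightarrow> l \<bullet> b \<le> u \<bullet> b"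
  define g where "g = inv f"
  have g: "orthogonal_transformation g" using f by (simp add: g_def orthogonal_transformation_inv)
  have eq: "f -` box l u = g ` box l u"
    unfolding g_def using orthogonal_transformation_bij[OF f] by (simp add: bij_vimage_eq_inv_image)
  have "emeasure (distr lborel borel f) (box l u) = emeasure lborel (g ` box l u)"
    by (simp add: emeasure_distr eq)
  also have "\<dots> = emeasure lebesgue (g ` box l u)"
  proof -
    have "f -` box l u \<in> sets borel" using measurable_sets[of f borel borel "box l u"] by simp
    then show ?thesis by (simp add: eq)
  qed
  also have "\<dots> = ennreal (measure lebesgue (g ` box l u))"
    using measurable_orthogonal_image[OF g, of "box l u"] by (simp add: emeasure_eq_measure2 fmeasurableD2)
  also have "\<dots> = ennreal (measure lebesgue (box l u))"
    using measure_orthogonal_image[OF g, of "box l u"] by simp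
  also have "\<dots> = ennreal (prod ((\<bullet>) (u - l)) Basis)"
    using lu by (simp add: measure_lborel_box)
  finally show "emeasure (distr lborel borel f) (box l u) = ennreal (prod ((\<bullet>) (u - l)) Basis)" .
qed simp

text \<open>Covers isometries between different types, such as \<open>real \<times> real^2\<close>
  and \<open>real^3\<close>. Precomposing with a map \<open>g\<close> that matches the two standard
  bases gives an orthogonal endomorphism \<open>f \<circ> g\<close>, and \<open>g\<close> itself
  preserves \<open>lborel\<close>.\<close>

lemma distr_lborel_isometry:
  fixes f :: "'a::euclidean_space \<Rightarrow> real^'n::{finite,wellorder}"
  assumes lin: "linear f" and nrm: "\<And>x. norm (f x) = norm x" and dim: "DIM('a) = CARD('n)"
  shows "distr lborel borel f = lborel"
proof -
  obtain b :: "real^'n::{finite,wellorder} \<Rightarrow> 'a" where b: "bij_betw b Basis Basis"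
    using finite_same_card_bij[of "Basis :: (real^'n::{finite,wellorder}) set" "Basis :: 'a set"] dim by auto
  define g where "g = (\<lambda>x. \<Sum>c\<in>Basis. (x \<bullet> c) *\<^sub>R b c)"
  have g: "linear g"
    unfolding g_def
    by (rule linearI) (simp_all add: inner_add_left scaleR_add_left sum.distrib scaleR_sum_right)
  have gb: "g c = b c" if "c \<in> Basis" for c
  proof -
    have "g c = (\<Sum>d\<in>Basis. if d = c then b d else 0)"
      unfolding g_def by (rule sum.cong) (use that in \<open>auto simp: inner_Basis\<close>)
    then show ?thesis using that by simp
  qed
  have bij: "bij_betw g Basis Basis"
    using b gb by (simp cong: bij_betw_cong)
  have ng: "norm (g x) = norm x" for x
  proof -
    have "g x \<bullet> g x = (\<Sum>c\<in>Basis. \<Sum>d\<in>Basis. (x \<bullet> c) * (x \<bullet> d) * (b c \<bullet> b d))"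
      unfolding g_def inner_sum_left inner_sum_right
      by (subst sum.swap) (simp add: sum_distrib_left mult_ac)
    also have "\<dots> = (\<Sum>c\<in>Basis. \<Sum>d\<in>Basis. if d = c then (x \<bullet> c) * (x \<bullet> d) else 0)"
    proof (intro sum.cong refl)
      fix c d :: "real^'n::{finite,wellorder}" assume cd: "c \<in> Basis" "d \<in> Basis"
      have "b c \<in> Basis" "b d \<in> Basis" "b c = b d \<longleftrightarrow> c = d"
        using b cd by (auto simp: bij_betw_def inj_on_def)
      then show "(x \<bullet> c) * (x \<bullet> d) * (b c \<bullet> b d) = (if d = c then (x \<bullet> c) * (x \<bullet> d) else 0)"
        by (simp add: inner_Basis)
    qed
    also have "\<dots> = x \<bullet> x" by (simp add: euclidean_inner[of x x])
    finally show ?thesis by (simp add: norm_eq_sqrt_inner)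
  qed
  have [measurable]: "f \<in> borel_measurable borel" "g \<in> borel_measurable borel"
    using lin g
    by (intro borel_measurable_continuous_onI linear_continuous_on; simp add: linear_conv_bounded_linear)+
  have orth: "orthogonal_transformation (f \<circ> g)"
    unfolding orthogonal_transformation using linear_compose[OF g lin] nrm ng by simp
  have "distr lborel borel f = distr (distr lborel borel g) borel f"
    using distr_lborel_basis_map[OF g bij] by simp
  also have "\<dots> = distr lborel borel (f \<circ> g)" by (rule distr_distr) simp_all
  also have "\<dots> = lborel" by (rule distr_lborel_orthogonal[OF orth])
  finally show ?thesis .
qed

text \<open>Polarisation: after the shift by \<open>f 0\<close>, preserved distances give preserved
  inner products, and then the squared norm of each linearity defect expands to zero.\<close>

lemma isometry_diff_linear:
  fixes f :: "'a::real_inner \<Rightarrow> 'b::real_inner"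
  assumes dist: "\<And>x y. dist (f x) (f y) = dist x y"
  shows "linear (\<lambda>x. f x - f 0)" "norm (f x - f 0) = norm x"
proof -
  define A where "A = (\<lambda>x. f x - f 0)"
  have n: "norm (A x) = norm x" for x using dist[of x 0] by (simp add: A_def dist_norm)
  have nd: "norm (A x - A y) = norm (x - y)" for x y using dist[of x y] by (simp add: A_def dist_norm)
  have inn: "A x \<bullet> A y = x \<bullet> y" for x y
  proof -
    have "(A x - A y) \<bullet> (A x - A y) = (x - y) \<bullet> (x - y)" using nd[of x y] by (simp add: norm_eq)
    then show ?thesis
      using n[of x] n[of y] by (simp add: norm_eq inner_diff_left inner_diff_right inner_commute)
  qed
  have "A (x + y) = A x + A y" for x y
  proof -
    have "(A (x + y) - (A x + A y)) \<bullet> (A (x + y) - (A x + A y)) = 0"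
      by (simp add: inner_diff_left inner_diff_right inner_add_left inner_add_right inn)
    then show ?thesis by (metis eq_iff_diff_eq_0 inner_eq_zero_iff)
  qed
  moreover have "A (c *\<^sub>R x) = c *\<^sub>R A x" for c x
  proof -
    have "(A (c *\<^sub>R x) - c *\<^sub>R A x) \<bullet> (A (c *\<^sub>R x) - c *\<^sub>R A x) = 0"
      by (simp add: inner_diff_left inner_diff_right inn)
    then show ?thesis by (metis eq_iff_diff_eq_0 inner_eq_zero_iff)
  qed
  ultimately show "linear (\<lambda>x. f x - f 0)" unfolding A_def[symmetric] by (intro linearI) auto
  show "norm (f x - f 0) = norm x" using n by (simp add: A_def)
qed

lemma nn_integral_lborel_affine:
  fixes g :: "'a::euclidean_space \<Rightarrow> ennreal"
  assumes [measurable]: "g \<in> borel_measurable borel" and c: "c > 0"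
  shows "(\<integral>\<^sup>+x. g x \<partial>lborel) = (\<integral>\<^sup>+x. ennreal (c ^ DIM('a)) * g (t + c *\<^sub>R x) \<partial>lborel)"
  using c by (subst lborel_affine[of c t]) (simp_all add: nn_integral_density nn_integral_distr)

text \<open>In orthonormal coordinates \<open>(s, v)\<close>, with \<open>s\<close> along the unit
  normal, Lebesgue measure is a product. The planes \<open>l \<bullet> x = t\<close> are dilates of
  the given one: \<open>s = t / norm l\<close> contributes \<open>inverse (norm l)\<close>, and
  dilating the plane by \<open>t\<close> contributes \<open>t\<^sup>2\<close>.\<close>

lemma nn_integral_halfspace_polar:
  fixes l :: "real^3" and f :: "real^2 \<Rightarrow> real^3" and g :: "real^3 \<Rightarrow> ennreal"
  assumes l: "l \<noteq> 0" and dist: "\<And>x y. dist (f x) (f y) = dist x y" and range: "range f = {x. l \<bullet> x = 1}"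
    and g[measurable]: "g \<in> borel_measurable borel"
  shows "(\<integral>\<^sup>+x\<in>{x. 0 < l \<bullet> x}. g x \<partial>lborel) =
     ennreal (inverse (norm l)) * (\<integral>\<^sup>+t\<in>{0<..}. ennreal (t\<^sup>2) * (\<integral>\<^sup>+w. g (t *\<^sub>R f w) \<partial>lborel) \<partial>lborel)"
proof -
  define A where "A = (\<lambda>x. f x - f 0)"
  have linA: "linear A" and nA: "\<And>x. norm (A x) = norm x"
    unfolding A_def by (rule isometry_diff_linear[OF dist])+
  have lf: "l \<bullet> f w = 1" for w using range by blast
  have lA: "l \<bullet> A w = 0" for w by (simp add: A_def inner_diff_right lf)
  define n where "n = l /\<^sub>R norm l"
  define d where "d = inverse (norm l)"
  have d: "d > 0" using l by (simp add: d_def)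
  have nn: "n \<bullet> n = 1" using l by (simp add: n_def power2_norm_eq_inner[symmetric] power2_eq_square)
  have nA0: "n \<bullet> A w = 0" "A w \<bullet> n = 0" for w by (simp_all add: n_def lA inner_commute)
  have ln: "l \<bullet> n = norm l" using l by (simp add: n_def power2_norm_eq_inner[symmetric] power2_eq_square)
  define R where "R = (\<lambda>(s::real, v::real^2). s *\<^sub>R n + A v)"
  have linR: "linear R"
    unfolding R_def using linA
    by (intro linearI) (auto simp: linear_add linear_cmul scaleR_add_left scaleR_add_right)
  have nR: "norm (R x) = norm x" for x
  proof (cases x)
    case (Pair s v)
    have "A v \<bullet> A v = v \<bullet> v" using nA[of v] by (simp add: norm_eq_sqrt_inner)
    then have "R x \<bullet> R x = x \<bullet> x"
      by (simp add: Pair R_def inner_add_left inner_add_right nn nA0)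
    then show ?thesis by (simp add: norm_eq_sqrt_inner)
  qed
  have dR: "distr lborel borel R = lborel"
    by (rule distr_lborel_isometry[OF linR nR]) simp
  \<comment> \<open>The point \<open>2 *\<^sub>R f 0 - d *\<^sub>R n\<close> lies on the plane, and
    its chart parameter is the witness. So the origin of the chart differs from the foot
    \<open>d *\<^sub>R n\<close> of the perpendicular by a tangent vector.\<close>
  have "f 0 - d *\<^sub>R n \<in> range A"
  proof -
    have "l \<bullet> (2 *\<^sub>R f 0 - d *\<^sub>R n) = 1" using l by (simp add: inner_diff_right lf ln d_def)
    then obtain w where "f w = 2 *\<^sub>R f 0 - d *\<^sub>R n" using range by force
    then have "A w = f 0 - d *\<^sub>R n" by (simp add: A_def scaleR_2)
    then show ?thesis by (metis rangeI)
  qed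
  then obtain w0 where w0: "f 0 = d *\<^sub>R n + A w0" by (metis add.commute diff_add_cancel rangeE)
  have fw: "f w = d *\<^sub>R n + A (w0 + w)" for w
    using w0 linear_add[OF linA, of w0 w] by (simp add: A_def)
  have cA: "continuous_on UNIV A" using linA by (intro linear_continuous_on) (simp add: linear_conv_bounded_linear)
  have [measurable]: "A \<in> borel_measurable borel" using cA by (rule borel_measurable_continuous_onI)
  have [measurable]: "R \<in> borel_measurable borel"
    using linR by (intro borel_measurable_continuous_onI linear_continuous_on) (simp add: linear_conv_bounded_linear)
  have "f = (\<lambda>w. d *\<^sub>R n + A (w0 + w))" using fw by auto
  then have [measurable]: "f \<in> borel_measurable borel" by simp
  have "(\<integral>\<^sup>+x\<in>{x. 0 < l \<bullet> x}. g x \<partial>lborel) = (\<integral>\<^sup>+x. g x * indicator {x. 0 < l \<bullet> x} x \<partial>distr lborel borel R)"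
    by (simp add: dR)
  also have "\<dots> = (\<integral>\<^sup>+x. g (R x) * indicator {x. 0 < l \<bullet> x} (R x) \<partial>lborel)"
    by (rule nn_integral_distr) auto
  also have "\<dots> = (\<integral>\<^sup>+x. g (R x) * indicator {x. 0 < l \<bullet> x} (R x) \<partial>(lborel \<Otimes>\<^sub>M lborel))"
    by (simp add: lborel_prod)
  also have "\<dots> = (\<integral>\<^sup>+s. \<integral>\<^sup>+v. g (s *\<^sub>R n + A v) * indicator {0<..} s \<partial>lborel \<partial>lborel)"
  proof -
    have "l \<bullet> (s *\<^sub>R n + A v) > 0 \<longleftrightarrow> s > 0" for s v
      using l by (simp add: inner_add_right ln lA zero_less_mult_iff)
    then have "indicator {x. 0 < l \<bullet> x} (R (s, v)) = (indicator {0<..} s :: ennreal)" for s v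
      by (simp add: R_def indicator_def)
    moreover have "(\<lambda>x. g (R x) * indicator {x. 0 < l \<bullet> x} (R x)) \<in> borel_measurable (lborel \<Otimes>\<^sub>M lborel)"
      by (simp add: lborel_prod)
    ultimately show ?thesis
      by (subst lborel.nn_integral_fst[symmetric]) (simp_all add: R_def)
  qed
  also have "\<dots> = (\<integral>\<^sup>+s. (\<integral>\<^sup>+v. g (s *\<^sub>R n + A v) \<partial>lborel) * indicator {0<..} s \<partial>lborel)"
    by (simp add: nn_integral_multc)
  also have "\<dots> = (\<integral>\<^sup>+t. ennreal d * ((\<integral>\<^sup>+v. g ((d * t) *\<^sub>R n + A v) \<partial>lborel) * indicator {0<..} (d * t)) \<partial>lborel)"
    by (subst nn_integral_lborel_affine[where c = d and t = 0]) (use d in simp_all)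
  also have "\<dots> = (\<integral>\<^sup>+t. ennreal d * ((ennreal (t\<^sup>2) * (\<integral>\<^sup>+w. g (t *\<^sub>R f w) \<partial>lborel)) * indicator {0<..} t) \<partial>lborel)"
  proof (intro nn_integral_cong)
    fix t :: real
    show "ennreal d * ((\<integral>\<^sup>+v. g ((d * t) *\<^sub>R n + A v) \<partial>lborel) * indicator {0<..} (d * t)) =
      ennreal d * ((ennreal (t\<^sup>2) * (\<integral>\<^sup>+w. g (t *\<^sub>R f w) \<partial>lborel)) * indicator {0<..} t)"
    proof (cases "t > 0")
      case True
      \<comment> \<open>Substitution \<open>v = t *\<^sub>R (w0 + w)\<close>: the Jacobian in
        dimension two is \<open>t\<^sup>2\<close>, and the shift by \<open>w0\<close> turns the
        argument of \<open>g\<close> into \<open>t *\<^sub>R f w\<close>.\<close>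
      have "(\<integral>\<^sup>+v. g ((d * t) *\<^sub>R n + A v) \<partial>lborel) =
        (\<integral>\<^sup>+w. ennreal (t\<^sup>2) * g ((d * t) *\<^sub>R n + A (t *\<^sub>R w0 + t *\<^sub>R w)) \<partial>lborel)"
        by (subst nn_integral_lborel_affine[where c = t and t = "t *\<^sub>R w0"]) (use True in simp_all)
      also have "\<dots> = (\<integral>\<^sup>+w. ennreal (t\<^sup>2) * g (t *\<^sub>R f w) \<partial>lborel)"
        by (intro nn_integral_cong)
          (simp add: fw scaleR_add_right linear_add[OF linA] linear_cmul[OF linA] mult.commute)
      also have "\<dots> = ennreal (t\<^sup>2) * (\<integral>\<^sup>+w. g (t *\<^sub>R f w) \<partial>lborel)"
        by (rule nn_integral_cmult) simp
      finally show ?thesis using True d by simp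
    next
      case False
      then have "\<not> d * t > 0" using d by (simp add: zero_less_mult_iff)
      with False show ?thesis by simp
    qed
  qed
  also have "\<dots> = ennreal d * (\<integral>\<^sup>+t\<in>{0<..}. ennreal (t\<^sup>2) * (\<integral>\<^sup>+w. g (t *\<^sub>R f w) \<partial>lborel) \<partial>lborel)"
    by (rule nn_integral_cmult) simp
  finally show ?thesis by (simp add: d_def)
qed

text \<open>\<open>plane_chart\<close> is a \<open>SOME\<close> term, so an isometric
  parametrisation must be exhibited: an isometry onto the parallel plane through 0, shifted by the
  point \<open>p\<close> of the plane closest to 0.\<close>

lemma plane_chart_hyperplane:
  fixes l :: "real^3"
  assumes l: "l \<noteq> 0"
  defines "f \<equiv> plane_chart {x. l \<bullet> x = 1}"
  shows "dist (f x) (f y) = dist x y" "range f = {x. l \<bullet> x = 1}"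
proof -
  have "dim (UNIV :: (real^2) set) = dim {x. l \<bullet> x = 0}"
    using l by (simp add: dim_hyperplane)
  then obtain A :: "real^2 \<Rightarrow> real^3" where A: "linear A" "A ` UNIV = {x. l \<bullet> x = 0}" "\<And>x. norm (A x) = norm x"
    using isometry_subspaces[OF subspace_UNIV subspace_hyperplane] by (metis UNIV_I)
  define p where "p = l /\<^sub>R (l \<bullet> l)"
  have p: "l \<bullet> p = 1" using l by (simp add: p_def)
  have "\<exists>f :: real^2 \<Rightarrow> real^3. (\<forall>x y. dist (f x) (f y) = dist x y) \<and> range f = {x. l \<bullet> x = 1}"
  proof (intro exI conjI allI)
    show "dist (p + A x) (p + A y) = dist x y" for x y
      by (simp add: dist_norm linear_diff[OF A(1), symmetric] A(3))
    have "x \<in> range (\<lambda>x. p + A x)" if "l \<bullet> x = 1" for x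
    proof -
      have "x - p \<in> range A" using that p A(2) by (simp add: inner_diff_right)
      then obtain w where "A w = x - p" by (metis rangeE)
      then have "x = p + A w" by simp
      then show ?thesis by blast
    qed
    moreover have "l \<bullet> (p + A x) = 1" for x using A(2) p by (auto simp: inner_add_right)
    ultimately show "range (\<lambda>x. p + A x) = {x. l \<bullet> x = 1}" by blast
  qed
  from someI_ex[OF this] show "dist (f x) (f y) = dist x y" "range f = {x. l \<bullet> x = 1}"
    unfolding f_def plane_chart_def by blast+
qed

section \<open>Integrals of nonnegative and of continuous functions\<close>

text \<open>Measurability of \<open>h\<close> comes from completeness: off \<open>E\<close> it
  equals \<open>v\<close>, and every subset of \<open>E\<close> is measurable in the completion.
  This is how arbitrary values of \<open>u\<close> on the edges are absorbed.\<close>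

lemma integral_completion_null:
  fixes h v :: "'a \<Rightarrow> real"
  assumes v[measurable]: "v \<in> borel_measurable M" and E: "E \<in> null_sets M"
    and eq: "\<And>x. x \<in> space M - E \<Longrightarrow> h x = v x"
  shows "integral\<^sup>L (completion M) h = integral\<^sup>L M v"
proof -
  have Ec: "E \<in> null_sets (completion M)" using E by (rule null_sets_completionI)
  have "h \<in> borel_measurable (completion M)"
  proof (rule measurableI)
    fix S :: "real set" assume "S \<in> sets borel"
    then have "v -` S \<inter> space M \<in> sets (completion M)"
      using measurable_sets[OF v] by simp
    moreover have "E \<in> sets (completion M)" using Ec by auto
    moreover have "h -` S \<inter> E \<inter> space M \<in> sets (completion M)"
      by (rule completion.complete[OF _ Ec]) auto
    moreover have "h -` S \<inter> space (completion M) = (v -` S \<inter> space M - E) \<union> (h -` S \<inter> E \<inter> space M)"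
      using eq by auto
    ultimately show "h -` S \<inter> space (completion M) \<in> sets (completion M)" by auto
  qed simp
  moreover have "v \<in> borel_measurable (completion M)"
    using measurable_completion[OF v] by simp
  moreover have "AE x in completion M. h x = v x"
    by (rule AE_I'[OF Ec]) (use eq in auto)
  ultimately have "integral\<^sup>L (completion M) h = integral\<^sup>L (completion M) v"
    by (rule integral_cong_AE)
  then show ?thesis by (simp add: integral_completion)
qed

lemma nn_integral_completion_null:
  assumes E: "E \<in> null_sets M" and eq: "\<And>x. x \<in> space M - E \<Longrightarrow> h x = v x"
  shows "integral\<^sup>N (completion M) h = integral\<^sup>N M v"
  unfolding nn_integral_completion
  by (rule nn_integral_cong_AE, rule AE_I'[OF E]) (use eq in auto)

lemma null_sets_lborelI: "negligible S \<Longrightarrow> S \<in> sets borel \<Longrightarrow> S \<in> null_sets lborel"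
  by (simp add: negligible_iff_null_sets null_sets_def)

text \<open>Otherwise the set where \<open>h\<close> is positive would be a nonempty open null
  set.\<close>

lemma continuous_nonneg_integral_zero_open:
  fixes h :: "'a::euclidean_space \<Rightarrow> real"
  assumes S: "open S" and cont: "continuous_on S h" and nonneg: "\<And>x. x \<in> S \<Longrightarrow> 0 \<le> h x"
    and zero: "(\<integral>\<^sup>+x. ennreal (indicator S x * h x) \<partial>lborel) = 0" and x: "x \<in> S"
  shows "h x = 0"
proof (rule ccontr)
  assume "h x \<noteq> 0"
  then have hx: "h x > 0" using nonneg[OF x] by simp
  define U where "U = S \<inter> h -` {0<..}"
  have "open U" unfolding U_def by (rule continuous_open_preimage[OF cont S]) simp
  have "x \<in> U" using hx x by (simp add: U_def)
  have meas: "(\<lambda>x. indicator S x * h x) \<in> borel_measurable borel"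
    using borel_measurable_continuous_on_indicator[OF _ cont] S by simp
  have "AE x in lborel. ennreal (indicator S x * h x) = 0"
    using zero meas by (subst (asm) nn_integral_0_iff_AE) auto
  then have "AE x in lborel. x \<notin> U"
    by (rule eventually_mono) (auto simp: U_def)
  then have "U \<in> null_sets lborel"
    using \<open>open U\<close> by (simp add: AE_iff_null_sets)
  then have "negligible U" by (simp add: negligible_iff_null_sets null_sets_completionI)
  then show False using open_not_negligible[OF \<open>open U\<close>] \<open>x \<in> U\<close> by auto
qed

lemma set_nn_integral_eq_set_integral:
  fixes h :: "'a \<Rightarrow> real"
  assumes int: "set_integrable M S h" and nonneg: "\<And>x. x \<in> S \<Longrightarrow> 0 \<le> h x"
  shows "(\<integral>\<^sup>+x\<in>S. ennreal (h x) \<partial>M) = ennreal (LINT x:S|M. h x)"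
proof -
  have "(\<integral>\<^sup>+x\<in>S. ennreal (h x) \<partial>M) = (\<integral>\<^sup>+x. ennreal (indicator S x *\<^sub>R h x) \<partial>M)"
    by (rule nn_integral_cong) (simp add: indicator_def)
  also have "\<dots> = ennreal (LINT x:S|M. h x)"
    unfolding set_lebesgue_integral_def
    by (rule nn_integral_eq_integral) (use assms in \<open>auto simp: set_integrable_def indicator_def\<close>)
  finally show ?thesis .
qed

lemma set_integrable_nonneg_finite:
  fixes h :: "'a \<Rightarrow> real"
  assumes meas: "set_borel_measurable M S h" and nonneg: "\<And>x. x \<in> S \<Longrightarrow> 0 \<le> h x"
    and fin: "(\<integral>\<^sup>+x\<in>S. ennreal (h x) \<partial>M) < \<infinity>"
  shows "set_integrable M S h"
  unfolding set_integrable_def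
proof (rule integrableI_nonneg)
  show "(\<lambda>x. indicat_real S x *\<^sub>R h x) \<in> borel_measurable M"
    using meas by (simp add: set_borel_measurable_def)
  show "AE x in M. 0 \<le> indicat_real S x *\<^sub>R h x" using nonneg by (auto simp: indicator_def)
  have "(\<integral>\<^sup>+x. ennreal (indicator S x *\<^sub>R h x) \<partial>M) = (\<integral>\<^sup>+x\<in>S. ennreal (h x) \<partial>M)"
    by (rule nn_integral_cong) (simp add: indicator_def)
  then show "(\<integral>\<^sup>+x. ennreal (indicat_real S x *\<^sub>R h x) \<partial>M) < \<infinity>" using fin by simp
qed

lemma continuous_on_set_borel_measurable_lborel:
  fixes h :: "'a::euclidean_space \<Rightarrow> real"
  assumes "open S" "continuous_on S h"
  shows "set_borel_measurable lborel S h"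
  unfolding set_borel_measurable_def
  using borel_measurable_continuous_on_indicator[of S h] assms by simp

lemma set_integrable_compact_interior:
  fixes h :: "'a::euclidean_space \<Rightarrow> real"
  assumes "compact S" "continuous_on S h"
  shows "set_integrable lborel (interior S) h"
proof (rule set_integrable_subset)
  show "set_integrable lborel S h"
    unfolding set_integrable_def by (rule borel_integrable_compact[OF assms])
qed (use interior_subset in auto)

text \<open>\<open>t^2\<close> is the Jacobian of polar integration. The integrands that occur carry
  at most two further powers of \<open>t\<close>, one from an affine weight and one from the
  convexity bound.\<close>

lemma nn_integral_radial_polynomial:
  fixes a b c :: real
  assumes nonneg: "\<And>t. 0 \<le> t \<Longrightarrow> t \<le> 1 \<Longrightarrow> 0 \<le> a * t^2 + b * t^3 + c * t^4"
  shows "(\<integral>\<^sup>+t\<in>{0<..<1}. ennreal (a * t^2 + b * t^3 + c * t^4) \<partial>lborel) = ennreal (a / 3 + b / 4 + c / 5)"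
proof -
  have "(\<integral>\<^sup>+t\<in>{0<..<1}. ennreal (a * t^2 + b * t^3 + c * t^4) \<partial>lborel) =
    (\<integral>\<^sup>+t\<in>{0..1}. ennreal (a * t^2 + b * t^3 + c * t^4) \<partial>lborel)"
    by (rule nn_integral_cong_AE)
      (use AE_lborel_singleton[of "1::real"] AE_lborel_singleton[of "0::real"] in
        \<open>eventually_elim, auto simp: indicator_def\<close>)
  also have "\<dots> = ennreal ((a / 3 * 1 ^ 3 + b / 4 * 1 ^ 4 + c / 5 * 1 ^ 5) - (a / 3 * 0 ^ 3 + b / 4 * 0 ^ 4 + c / 5 * 0 ^ 5))"
    by (rule nn_integral_FTC_Icc[where F = "\<lambda>t. a / 3 * t ^ 3 + b / 4 * t ^ 4 + c / 5 * t ^ 5"])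
      (auto intro!: derivative_eq_intros nonneg)
  finally show ?thesis by simp
qed

section \<open>Supporting affine functions and primitive vectors\<close>

text \<open>Separate the point \<open>(z, u z)\<close> from the strict epigraph. The separating
  functional \<open>(m, r)\<close> has \<open>r > 0\<close>, since a vertical hyperplane would cut
  through a ball around \<open>z\<close>; dividing by \<open>r\<close> gives the slope.\<close>

lemma convex_on_subgradient:
  fixes u :: "'a::euclidean_space \<Rightarrow> real"
  assumes S: "open S" and conv: "convex_on S u" and z: "z \<in> S"
  obtains a where "\<And>x. x \<in> S \<Longrightarrow> u z + a \<bullet> (x - z) \<le> u x"
proof -
  define E where "E = {p :: 'a \<times> real. fst p \<in> S \<and> u (fst p) < snd p}"
  have cS: "convex S" using conv by (simp add: convex_on_def)
  have "convex E"
  proof (rule convexI)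
    fix p q :: "'a \<times> real" and s t :: real
    assume p: "p \<in> E" and q: "q \<in> E" and st: "0 \<le> s" "0 \<le> t" "s + t = 1"
    have "u (s *\<^sub>R fst p + t *\<^sub>R fst q) \<le> s * u (fst p) + t * u (fst q)"
      using conv p q st unfolding convex_on_def E_def by blast
    also have "\<dots> < s * snd p + t * snd q"
    proof (cases "s = 0")
      case True
      then show ?thesis using p q st by (auto simp: E_def)
    next
      case False
      then have "s * u (fst p) < s * snd p" "t * u (fst q) \<le> t * snd q"
        using p q st by (auto simp: E_def intro!: mult_left_mono)
      then show ?thesis by simp
    qed
    finally show "s *\<^sub>R p + t *\<^sub>R q \<in> E"
      using convexD[OF cS _ _ st] p q by (auto simp: E_def)
  qed
  moreover have "(z, u z + 1) \<in> E" using z by (simp add: E_def)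
  moreover have "{(z, u z)} \<inter> E = {}" by (simp add: E_def)
  ultimately obtain n b where n: "n \<noteq> 0" "\<And>p. p \<in> {(z, u z)} \<Longrightarrow> n \<bullet> p \<le> b" "\<And>p. p \<in> E \<Longrightarrow> b \<le> n \<bullet> p"
    using separating_hyperplane_sets[of "{(z, u z)}" E] by (metis convex_singleton empty_iff insert_not_empty)
  obtain m r where mr: "n = (m, r)" by (cases n)
  have sep: "m \<bullet> z + r * u z \<le> m \<bullet> x + r * s" if "x \<in> S" "u x < s" for x s
    using n(2)[of "(z, u z)"] n(3)[of "(x, s)"] that by (simp add: mr E_def)
  have r0: "r \<ge> 0" using sep[OF z, of "u z + 1"] by (simp add: algebra_simps)
  have "r \<noteq> 0"
  proof
    assume r: "r = 0"
    obtain e where e: "e > 0" "ball z e \<subseteq> S" using S z open_contains_ball by blast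
    have "m \<noteq> 0" using n(1) mr r by (auto simp: zero_prod_def)
    \<comment> \<open>A step from \<open>z\<close> against \<open>m\<close>, short enough to stay in
      the ball, strictly lowers \<open>m \<bullet> x\<close>.\<close>
    define x where "x = z - (e / 2 / norm m) *\<^sub>R m"
    have "dist z x < e" using e(1) \<open>m \<noteq> 0\<close> by (simp add: x_def dist_norm)
    then have "x \<in> S" using e(2) by auto
    then have "m \<bullet> z \<le> m \<bullet> x" using sep[of x "u x + 1"] r by simp
    then have "(e / 2 / norm m) * (m \<bullet> m) \<le> 0" by (simp add: x_def inner_diff_right)
    moreover have "(e / 2 / norm m) * (m \<bullet> m) > 0" using e(1) \<open>m \<noteq> 0\<close> by simp
    ultimately show False by simp
  qed
  with r0 have r: "r > 0" by simp
  show thesis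
  proof
    fix x assume x: "x \<in> S"
    have "m \<bullet> z + r * u z \<le> m \<bullet> x + r * u x"
    proof (rule field_le_epsilon)
      fix e :: real assume "e > 0"
      then show "m \<bullet> z + r * u z \<le> m \<bullet> x + r * u x + e"
        using sep[OF x, of "u x + e / r"] r by (simp add: algebra_simps)
    qed
    then show "u z + (- (1 / r) *\<^sub>R m) \<bullet> (x - z) \<le> u x"
      using r by (simp add: field_simps inner_diff_right)
  qed
qed

text \<open>The factor \<open>c\<close> is rational. In lowest terms \<open>p / q\<close>, the
  numerator divides every entry of \<open>c *\<^sub>R l\<close> and the denominator every entry of
  \<open>l\<close>, so primitivity makes both equal to 1. This fixes the length of an outer
  normal.\<close>

lemma primitive_vec_scale_pos_unique:
  assumes l: "primitive_vec l" and cl: "primitive_vec (c *\<^sub>R l)" and c: "c > 0"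
  shows "c = 1"
proof -
  obtain m where m: "l = (\<chi> i. of_int (m i))" "Gcd (range m) = 1"
    using l by (auto simp: primitive_vec_def)
  obtain m' where m': "c *\<^sub>R l = (\<chi> i. of_int (m' i))" "Gcd (range m') = 1"
    using cl by (auto simp: primitive_vec_def)
  have eq: "c * of_int (m i) = of_int (m' i)" for i
    using m(1) arg_cong[OF m'(1), of "\<lambda>v. v $ i"] by simp
  obtain i where i: "m i \<noteq> 0"
    using m(2) Gcd_0_iff[of "range m"] by auto
  have "c = of_int (m' i) / of_int (m i)" using eq[of i] i by (simp add: field_simps)
  then have "c \<in> \<rat>" by simp
  then obtain p q :: nat where pq: "q \<noteq> 0" "\<bar>c\<bar> = real p / real q" "coprime p q"
    by (rule Rats_abs_nat_div_natE)
  have pm: "int p * m i = int q * m' i" for i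
  proof -
    have "of_int (int p * m i) = (of_int (int q * m' i) :: real)"
    proof -
      have "real p = c * real q" using pq c by simp
      then have "real p * of_int (m i) = real q * (c * of_int (m i))" by (simp add: mult_ac)
      then show ?thesis by (simp add: eq)
    qed
    then show ?thesis by (simp only: of_int_eq_iff)
  qed
  have cop: "coprime (int p) (int q)" using pq(3) by simp
  have "int p dvd m' i" for i
    using pm[of i] cop by (metis coprime_dvd_mult_right_iff dvd_triv_left)
  then have "int p dvd Gcd (range m')" by (auto intro: Gcd_greatest)
  then have p: "p = 1" using m'(2) by simp
  have "int q dvd m i" for i
    using pm[of i] cop by (metis coprime_commute coprime_dvd_mult_right_iff dvd_triv_left)
  then have "int q dvd Gcd (range m)" by (auto intro: Gcd_greatest)
  then have q: "q = 1" using m(2) by simp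
  show ?thesis using pq(2) p q c by simp
qed

lemma primitive_vec_nonzero: "primitive_vec l \<Longrightarrow> l \<noteq> 0"
proof
  assume "primitive_vec l" "l = 0"
  then obtain m where m: "(\<chi> i. of_int (m i)) = (0 :: real^3)" "Gcd (range m) = (1::int)"
    by (auto simp: primitive_vec_def)
  have "m i = 0" for i using arg_cong[OF m(1), of "\<lambda>v. v $ i"] by simp
  then have "range m \<subseteq> {0}" by auto
  then show False using m(2) Gcd_0_iff[of "range m"] by simp
qed

section \<open>Polytopes cut out by primitive normals at height one\<close>

text \<open>\<open>N\<close> only has to cut out \<Delta> at height one. That every facet comes from
  a member of \<open>N\<close> is derived, so the facets of the concrete polytopes never have to be
  enumerated.\<close>

locale fano_body =
  fixes \<Delta> N :: "(real^3) set"
  assumes finite_N: "finite N" and primitive: "\<And>l. l \<in> N \<Longrightarrow> primitive_vec l"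
    and \<Delta>_eq: "\<Delta> = {x. \<forall>l\<in>N. l \<bullet> x \<le> 1}" and bounded: "bounded \<Delta>"
begin

section \<open>Convex geometry of the body, its facets and their normals\<close>

lemma polyhedron: "polyhedron \<Delta>"
proof -
  have "\<Delta> = \<Inter>((\<lambda>l. {x. l \<bullet> x \<le> 1}) ` N)" by (auto simp: \<Delta>_eq)
  then show ?thesis
    using finite_N polyhedron_Inter[of "(\<lambda>l. {x. l \<bullet> x \<le> 1}) ` N"] by (auto simp: polyhedron_halfspace_le)
qed

lemma convex: "convex \<Delta>" and closed: "closed \<Delta>" and compact: "compact \<Delta>"
  using polyhedron bounded polyhedron_imp_convex polyhedron_imp_closed compact_eq_bounded_closed by blast+

lemma open_core: "(\<And>l. l \<in> N \<Longrightarrow> l \<bullet> x < 1) \<Longrightarrow> x \<in> interior \<Delta>"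
proof (rule interiorI)
  have "{x. \<forall>l\<in>N. l \<bullet> x < 1} = \<Inter>((\<lambda>l. {x. l \<bullet> x < 1}) ` N)" by auto
  also have "open \<dots>" using finite_N by (intro open_INT) (auto simp: open_halfspace_lt)
  finally show "open {x. \<forall>l\<in>N. l \<bullet> x < 1}" .
qed (auto simp: \<Delta>_eq intro: less_imp_le)

lemma zero_interior: "0 \<in> interior \<Delta>"
  by (rule open_core) simp

lemma zero_in: "0 \<in> \<Delta>"
  using zero_interior interior_subset by blast

lemma aff_dim: "aff_dim \<Delta> = 3"
  using zero_interior aff_dim_nonempty_interior[of \<Delta>] by auto

lemma finite_facets: "finite {F. F facet_of \<Delta>}"
  by (rule finite_polyhedron_facets[OF polyhedron])

text \<open>A relative interior point of \<open>F\<close> is a boundary point of \<Delta>, so some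
  constraint \<open>l\<close> is tight there. The face exposed by \<open>l\<close> contains all of
  \<open>F\<close> and is proper, hence has the same dimension and equals \<open>F\<close>.\<close>

lemma facet_exposed:
  assumes F: "F facet_of \<Delta>"
  shows "\<exists>l\<in>N. F = \<Delta> \<inter> {x. l \<bullet> x = 1}"
proof -
  have Ff: "F face_of \<Delta>" and Fne: "F \<noteq> {}" and dF: "aff_dim F = 2"
    using F aff_dim by (auto simp: facet_of_def)
  have FneD: "F \<noteq> \<Delta>" using dF aff_dim by auto
  have cF: "convex F" using Ff by (rule face_of_imp_convex)
  obtain x where x: "x \<in> rel_interior F" using Fne cF rel_interior_eq_empty by blast
  have xF: "x \<in> F" using x rel_interior_subset by blast
  have "x \<notin> interior \<Delta>" using face_of_disjoint_interior[OF Ff FneD] xF by blast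
  then obtain l where l: "l \<in> N" "\<not> l \<bullet> x < 1" using open_core by blast
  have "x \<in> \<Delta>" using Ff xF face_of_imp_subset by blast
  then have lx: "l \<bullet> x = 1" using l by (force simp: \<Delta>_eq)
  define G where "G = \<Delta> \<inter> {x. l \<bullet> x = 1}"
  have Gf: "G face_of \<Delta>"
    unfolding G_def by (rule face_of_Int_supporting_hyperplane_le[OF convex]) (use l in \<open>auto simp: \<Delta>_eq\<close>)
  have FG: "F \<subseteq> G"
    by (rule subset_of_face_of[OF Gf face_of_imp_subset[OF Ff]]) (use x lx \<open>x \<in> \<Delta>\<close> in \<open>auto simp: G_def\<close>)
  have "0 \<notin> G" by (simp add: G_def)
  then have "G \<noteq> \<Delta>" using zero_in by blast
  then have dG: "aff_dim G < 3" using face_of_aff_dim_lt[OF convex Gf] aff_dim by simp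
  have "F = G"
  proof (rule ccontr)
    assume "F \<noteq> G"
    moreover have "F face_of G" by (rule face_of_subset[OF Ff FG face_of_imp_subset[OF Gf]])
    ultimately have "aff_dim F < aff_dim G"
      using face_of_aff_dim_lt[OF face_of_imp_convex[OF Gf]] by blast
    then show False using dF dG by simp
  qed
  then show ?thesis using l(1) by (auto simp: G_def)
qed

lemma facet_affine_hull:
  assumes F: "F facet_of \<Delta>" and eq: "F = \<Delta> \<inter> {x. l \<bullet> x = 1}" and l: "l \<noteq> 0"
  shows "affine hull F = {x. l \<bullet> x = 1}"
proof (rule affine_dim_equal)
  show "affine {x. l \<bullet> x = 1}" by (rule affine_hyperplane)
  then show "affine hull F \<subseteq> {x. l \<bullet> x = 1}" using eq by (intro hull_minimal) auto
  show "affine hull F \<noteq> {}" using F by (simp add: facet_of_def)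
  show "aff_dim (affine hull F) = aff_dim {x. l \<bullet> x = 1}"
    using F l aff_dim by (simp add: facet_of_def aff_dim_hyperplane)
qed simp

text \<open>Uniqueness for the \<open>THE\<close> term: a competing functional is constant on the
  plane spanned by \<open>F\<close>, hence a multiple \<open>c *\<^sub>R l\<close>. Evaluating its
  bound at 0 gives the sign of \<open>c\<close>, and primitivity gives \<open>c = 1\<close>.\<close>

lemma outer_normal_eq:
  assumes F: "F facet_of \<Delta>" and lN: "l \<in> N" and eq: "F = \<Delta> \<inter> {x. l \<bullet> x = 1}"
  shows "outer_normal \<Delta> F = l"
  unfolding outer_normal_def
proof (rule the_equality)
  show "primitive_vec l \<and> (\<exists>b. \<Delta> \<subseteq> {x. l \<bullet> x \<le> b} \<and> F = \<Delta> \<inter> {x. l \<bullet> x = b})"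
    using lN eq primitive by (auto simp: \<Delta>_eq intro!: exI[of _ 1])
  have l0: "l \<noteq> 0" using primitive[OF lN] by (rule primitive_vec_nonzero)
  fix l' assume "primitive_vec l' \<and> (\<exists>b. \<Delta> \<subseteq> {x. l' \<bullet> x \<le> b} \<and> F = \<Delta> \<inter> {x. l' \<bullet> x = b})"
  then obtain b where l': "primitive_vec l'" and b: "\<Delta> \<subseteq> {x. l' \<bullet> x \<le> b}" "F = \<Delta> \<inter> {x. l' \<bullet> x = b}" by blast
  have "affine hull F \<subseteq> {x. l' \<bullet> x = b}"
    using b(2) by (intro hull_minimal affine_hyperplane) auto
  then have H: "\<And>x. l \<bullet> x = 1 \<Longrightarrow> l' \<bullet> x = b"
    using facet_affine_hull[OF F eq l0] by auto
  define p where "p = l /\<^sub>R (l \<bullet> l)"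
  define c where "c = (l' \<bullet> l) / (l \<bullet> l)"
  have lp: "l \<bullet> p = 1" using l0 by (simp add: p_def)
  \<comment> \<open>The part of \<open>l'\<close> orthogonal to \<open>l\<close>. Adding it to
    \<open>p\<close> stays on the plane, where \<open>l'\<close> is constant, so it
    vanishes.\<close>
  define v where "v = l' - c *\<^sub>R l"
  have lv: "l \<bullet> v = 0" using l0 by (simp add: v_def c_def inner_diff_right inner_commute)
  have "l' \<bullet> v = 0"
    using H[OF lp] H[of "p + v"] lp lv by (simp add: inner_add_right)
  then have "v \<bullet> v = 0" using lv by (simp add: v_def inner_diff_left)
  then have l'c: "l' = c *\<^sub>R l" by (simp add: v_def)
  have "b = c" using H[OF lp] by (simp add: l'c lp)
  then have "c \<ge> 0" using b(1) zero_in by auto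
  moreover have "c \<noteq> 0" using primitive_vec_nonzero[OF l'] l'c by auto
  ultimately have "c = 1"
    using primitive_vec_scale_pos_unique[OF primitive[OF lN]] l' by (auto simp: l'c)
  then show "l' = l" by (simp add: l'c)
qed

abbreviation "normal \<equiv> outer_normal \<Delta>"

lemma normal:
  assumes F: "F facet_of \<Delta>"
  shows "normal F \<in> N" "F = \<Delta> \<inter> {x. normal F \<bullet> x = 1}" "normal F \<noteq> 0"
    "affine hull F = {x. normal F \<bullet> x = 1}"
proof -
  obtain l where l: "l \<in> N" "F = \<Delta> \<inter> {x. l \<bullet> x = 1}" using facet_exposed[OF F] by blast
  have "normal F = l" by (rule outer_normal_eq[OF F l])
  then show "normal F \<in> N" "F = \<Delta> \<inter> {x. normal F \<bullet> x = 1}" using l by auto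
  then show "normal F \<noteq> 0" using primitive primitive_vec_nonzero by blast
  with facet_affine_hull[OF F \<open>F = \<Delta> \<inter> {x. normal F \<bullet> x = 1}\<close>]
  show "affine hull F = {x. normal F \<bullet> x = 1}" .
qed

section \<open>Facets in planar coordinates and the boundary measure\<close>

definition chart :: "(real^3) set \<Rightarrow> real^2 \<Rightarrow> real^3" where
  "chart F = plane_chart (affine hull F)"

text \<open>Passing to \<open>real^2\<close> replaces the relative interior of a facet by an
  ordinary interior, on which convex functions are continuous and whose complement in the facet is a
  null set.\<close>

definition facet_dom :: "(real^3) set \<Rightarrow> (real^2) set" where
  "facet_dom F = chart F -` F"

lemma chart:
  assumes F: "F facet_of \<Delta>"
  shows "dist (chart F x) (chart F y) = dist x y" "range (chart F) = {x. normal F \<bullet> x = 1}"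
  using plane_chart_hyperplane[OF normal(3)[OF F]] by (simp_all add: chart_def normal(4)[OF F])

lemma normal_chart: "F facet_of \<Delta> \<Longrightarrow> normal F \<bullet> chart F w = 1"
  using chart(2) by blast

lemma chart_affine:
  assumes F: "F facet_of \<Delta>"
  shows "linear (\<lambda>w. chart F w - chart F 0)"
  using isometry_diff_linear(1)[OF chart(1)[OF F]] .

lemma chart_convex_comb:
  assumes F: "F facet_of \<Delta>" and uv: "u + v = 1"
  shows "chart F (u *\<^sub>R x + v *\<^sub>R y) = u *\<^sub>R chart F x + v *\<^sub>R chart F y"
proof -
  have "chart F (u *\<^sub>R x + v *\<^sub>R y) - chart F 0 = u *\<^sub>R (chart F x - chart F 0) + v *\<^sub>R (chart F y - chart F 0)"
    using linear_add[OF chart_affine[OF F], of "u *\<^sub>R x" "v *\<^sub>R y"]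
      linear_cmul[OF chart_affine[OF F], of u x] linear_cmul[OF chart_affine[OF F], of v y] by simp
  also have "\<dots> = u *\<^sub>R chart F x + v *\<^sub>R chart F y - (u + v) *\<^sub>R chart F 0"
    by (simp add: algebra_simps)
  finally show ?thesis using uv by simp
qed

lemma continuous_chart: "F facet_of \<Delta> \<Longrightarrow> continuous_on S (chart F)"
  unfolding continuous_on_iff by (auto simp: chart(1))

lemma measurable_chart [measurable]: "F facet_of \<Delta> \<Longrightarrow> chart F \<in> borel_measurable borel"
  using continuous_chart by (rule borel_measurable_continuous_onI)

lemma facet_dom_geometry:
  assumes F: "F facet_of \<Delta>"
  shows "convex (facet_dom F)" "closed (facet_dom F)" "bounded (facet_dom F)"
proof -
  have sub: "F \<subseteq> \<Delta>" using F facet_of_imp_subset by blast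
  have cF: "convex F" using F facet_of_imp_face_of face_of_imp_convex by blast
  show "convex (facet_dom F)"
    using cF by (auto simp: convex_def facet_dom_def chart_convex_comb[OF F])
  have "closed F" using normal(2)[OF F] closed closed_hyperplane by (metis closed_Int)
  then show "closed (facet_dom F)"
    unfolding facet_dom_def by (rule closed_vimage[OF _ continuous_chart[OF F]])
  obtain e where e: "\<And>x y. x \<in> F \<Longrightarrow> y \<in> F \<Longrightarrow> dist x y \<le> e"
    using bounded_subset[OF bounded sub] bounded_two_points by metis
  show "bounded (facet_dom F)"
    unfolding bounded_two_points using e by (auto simp: facet_dom_def chart(1)[OF F, symmetric] intro!: exI[of _ e])
qed

lemma facet_dom_frontier_null:
  assumes F: "F facet_of \<Delta>"
  shows "facet_dom F - interior (facet_dom F) \<in> null_sets lborel"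
proof -
  have "facet_dom F - interior (facet_dom F) = frontier (facet_dom F)"
    using facet_dom_geometry(2)[OF F] by (simp add: frontier_def)
  then show ?thesis
    using negligible_convex_frontier[OF facet_dom_geometry(1)[OF F]] by (intro null_sets_lborelI) auto
qed

lemma chart_rel_interior:
  assumes F: "F facet_of \<Delta>"
  shows "chart F ` interior (facet_dom F) = rel_interior F"
proof (intro equalityI subsetI)
  fix x assume "x \<in> chart F ` interior (facet_dom F)"
  then obtain w e where w: "x = chart F w" "w \<in> facet_dom F" "e > 0" "ball w e \<subseteq> facet_dom F"
    by (auto simp: mem_interior) (metis centre_in_ball subsetD)
  have "z \<in> F" if z: "z \<in> ball x e" "z \<in> affine hull F" for z
  proof -
    obtain v where v: "z = chart F v" using z(2) chart(2)[OF F] normal(4)[OF F] by blast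
    then have "v \<in> ball w e" using z(1) by (simp add: w(1) chart(1)[OF F])
    then show ?thesis using w(4) v by (auto simp: facet_dom_def)
  qed
  then show "x \<in> rel_interior F"
    using w(1-3) by (auto simp: mem_rel_interior_ball facet_dom_def)
next
  fix x assume "x \<in> rel_interior F"
  then obtain e where e: "x \<in> F" "e > 0" "ball x e \<inter> affine hull F \<subseteq> F"
    by (auto simp: mem_rel_interior_ball)
  then obtain w where w: "x = chart F w"
    using normal(2)[OF F] chart(2)[OF F] by blast
  have "ball w e \<subseteq> facet_dom F"
  proof
    fix v assume "v \<in> ball w e"
    then have "chart F v \<in> ball x e" by (simp add: w chart(1)[OF F])
    moreover have "chart F v \<in> affine hull F" using chart(2)[OF F] normal(4)[OF F] by blast
    ultimately show "v \<in> facet_dom F" using e(3) by (auto simp: facet_dom_def)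
  qed
  then have "w \<in> interior (facet_dom F)" using e(2) mem_interior by blast
  then show "x \<in> chart F ` interior (facet_dom F)" using w by simp
qed

lemma facet_dom_sets [measurable]: "F facet_of \<Delta> \<Longrightarrow> facet_dom F \<in> sets borel"
  using facet_dom_geometry(2) by simp

text \<open>\<open>integral_completion_null\<close> compares with a Borel function on all of
  \<open>real^3\<close>; composing with this inverse turns an integrand given in chart coordinates
  into one.\<close>

lemma chart_left_inverse:
  assumes F: "F facet_of \<Delta>"
  obtains g where "g \<in> borel_measurable borel" "\<And>w. g (chart F w) = w"
proof -
  define A where "A = (\<lambda>w. chart F w - chart F 0)"
  have A: "linear A" unfolding A_def by (rule chart_affine[OF F])
  have "inj A" by (rule injI) (metis A_def F chart(1) diff_add_cancel dist_eq_0_iff)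
  then obtain B where B: "linear B" "B \<circ> A = id" using linear_injective_left_inverse[OF A] by blast
  have "continuous_on UNIV B" using B(1) by (intro linear_continuous_on) (simp add: linear_conv_bounded_linear)
  then have [measurable]: "B \<in> borel_measurable borel" by (rule borel_measurable_continuous_onI)
  show thesis
  proof
    show "(\<lambda>x. B (x - chart F 0)) \<in> borel_measurable borel" by measurable
    show "B (chart F w - chart F 0) = w" for w using B(2) by (simp add: A_def fun_eq_iff)
  qed
qed

text \<open>Continuity over the interior of the chart domain supplies a Borel integrand although
  \<open>u\<close> is arbitrary on the edges; completeness of \<open>plane_area\<close> absorbs the
  difference.\<close>

lemma facet_integral_eq:
  fixes u :: "real^3 \<Rightarrow> real"
  assumes F: "F facet_of \<Delta>" and cont: "continuous_on (interior (facet_dom F)) (\<lambda>w. u (chart F w))"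
  shows "(LINT x:F|plane_area (affine hull F). u x) = (LINT w:interior (facet_dom F)|lborel. u (chart F w))"
    and "(\<integral>\<^sup>+x\<in>F. ennreal (u x) \<partial>plane_area (affine hull F)) =
      (\<integral>\<^sup>+w\<in>interior (facet_dom F). ennreal (u (chart F w)) \<partial>lborel)"
proof -
  define f where "f = chart F"
  define K where "K = facet_dom F"
  obtain g where [measurable]: "g \<in> borel_measurable borel" and gf: "\<And>w. g (f w) = w"
    using chart_left_inverse[OF F] unfolding f_def by blast
  have [measurable]: "f \<in> borel_measurable borel" "K \<in> sets borel"
    using F by (simp_all add: f_def K_def)
  define b where "b = (\<lambda>w. indicator (interior K) w *\<^sub>R u (f w))"
  have [measurable]: "b \<in> borel_measurable borel"
    unfolding b_def using cont by (intro borel_measurable_continuous_on_indicator) (simp_all add: f_def K_def)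
  define M where "M = distr lborel borel f"
  have area: "plane_area (affine hull F) = completion M"
    by (simp add: plane_area_def M_def f_def chart_def)
  have [measurable_cong]: "sets M = sets borel" by (simp add: M_def)
  \<comment> \<open>The exceptional set: points off the plane, which the image measure does not
    charge, and the images of the frontier of the chart domain.\<close>
  define E where "E = {x. normal F \<bullet> x \<noteq> 1 \<or> g x \<in> K - interior K}"
  have "K - interior K \<in> sets borel" by simp
  then have "g -` (K - interior K) \<in> sets borel"
    using measurable_sets[of g borel borel "K - interior K"] by simp
  moreover have "E = - {x. normal F \<bullet> x = 1} \<union> g -` (K - interior K)" by (auto simp: E_def)
  ultimately have Es: "E \<in> sets borel" using closed_hyperplane[of "normal F" 1] by auto
  have "f -` E = K - interior K"
    using normal_chart[OF F] by (auto simp: E_def f_def[symmetric] gf)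
  then have "emeasure M E = 0"
    using null_setsD1[OF facet_dom_frontier_null[OF F]] Es by (simp add: M_def emeasure_distr K_def)
  then have E: "E \<in> null_sets M" using Es by (simp add: null_sets_def M_def)
  have off: "indicator F x *\<^sub>R u x = b (g x)" if x: "x \<in> space M - E" for x
  proof -
    have "normal F \<bullet> x = 1" "g x \<notin> K - interior K" using x by (auto simp: E_def)
    then have "x \<in> range f" using chart(2)[OF F] by (simp add: f_def)
    then obtain w where w: "x = f w" by blast
    then have "w \<notin> K - interior K" using \<open>g x \<notin> K - interior K\<close> gf by simp
    moreover have "g x = w" using w gf by simp
    ultimately show ?thesis using w
interior_subset[of K] by (auto simp: b_def indicator_def K_def facet_dom_def f_def)
  qed
  have "(LINT x:F|plane_area (affine hull F). u x) = integral\<^sup>L M (\<lambda>x. b (g x))"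
    unfolding area set_lebesgue_integral_def by (rule integral_completion_null[OF _ E off]) auto
  also have "\<dots> = (LINT w|lborel. b w)"
    unfolding M_def by (subst integral_distr) (simp_all add: gf)
  finally show "(LINT x:F|plane_area (affine hull F). u x) = (LINT w:interior (facet_dom F)|lborel. u (chart F w))"
    by (simp add: b_def set_lebesgue_integral_def f_def K_def)
  have nn: "ennreal (c) * indicator A x = ennreal (indicator A x *\<^sub>R c)" for c :: real and A and x :: "'b"
    by (simp add: indicator_def)
  have "(\<integral>\<^sup>+x\<in>F. ennreal (u x) \<partial>plane_area (affine hull F)) = integral\<^sup>N M (\<lambda>x. ennreal (b (g x)))"
    unfolding area nn by (rule nn_integral_completion_null[OF E]) (simp only: off)
  also have "\<dots> = (\<integral>\<^sup>+w. ennreal (b w) \<partial>lborel)"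
    unfolding M_def by (subst nn_integral_distr) (simp_all add: gf)
  finally show "(\<integral>\<^sup>+x\<in>F. ennreal (u x) \<partial>plane_area (affine hull F)) =
      (\<integral>\<^sup>+w\<in>interior (facet_dom F). ennreal (u (chart F w)) \<partial>lborel)"
    unfolding nn by (simp add: b_def f_def K_def)
qed

lemma frontier_null: "\<Delta> - interior \<Delta> \<in> null_sets lborel"
proof -
  have "\<Delta> - interior \<Delta> = frontier \<Delta>" using closed by (simp add: frontier_def)
  then show ?thesis using negligible_convex_frontier[OF convex] by (intro null_sets_lborelI) auto
qed

lemma volume_integral_eq:
  fixes h :: "real^3 \<Rightarrow> real"
  assumes cont: "continuous_on (interior \<Delta>) h"
  shows "(LINT x:\<Delta>|lebesgue. h x) = (LINT x:interior \<Delta>|lborel. h x)"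
  unfolding set_lebesgue_integral_def
proof (rule integral_completion_null[OF _ frontier_null])
  show "(\<lambda>x. indicat_real (interior \<Delta>) x *\<^sub>R h x) \<in> borel_measurable lborel"
    using borel_measurable_continuous_on_indicator[OF _ cont] by simp
qed (use interior_subset[of \<Delta>] in \<open>auto simp: indicator_def\<close>)

section \<open>Cones over the facets and the polar formula\<close>

definition cone :: "(real^3) set \<Rightarrow> (real^3) set" where
  "cone F = {x. 0 < normal F \<bullet> x \<and> normal F \<bullet> x \<le> 1 \<and> x /\<^sub>R (normal F \<bullet> x) \<in> F}"

lemma facet_sets: "F facet_of \<Delta> \<Longrightarrow> F \<in> sets borel"
  using normal(2) closed by (metis borel_closed closed_Int closed_hyperplane)

lemma cone_sets: "F facet_of \<Delta> \<Longrightarrow> cone F \<in> sets borel"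
proof -
  assume "F facet_of \<Delta>"
  then have [measurable]: "F \<in> sets borel" by (rule facet_sets)
  show ?thesis unfolding cone_def by measurable
qed

lemma facet_subset: "F facet_of \<Delta> \<Longrightarrow> F \<subseteq> \<Delta>"
  by (rule facet_of_imp_subset)

text \<open>The ray through \<open>x\<close> leaves the bounded body at a frontier point
  \<open>d *\<^sub>R x\<close>, which lies on some facet; the radius of \<open>x\<close> over that
  facet is \<open>inverse d\<close>.\<close>

lemma cone_cover:
  assumes x: "x \<in> \<Delta>" "x \<noteq> 0"
  shows "\<exists>F. F facet_of \<Delta> \<and> x \<in> cone F"
proof -
  obtain d where d: "0 < d" "0 + d *\<^sub>R x \<in> frontier \<Delta>"
    using ray_to_frontier[OF bounded zero_interior x(2)] by metis
  have "rel_frontier \<Delta> = frontier \<Delta>"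
    using zero_interior by (intro rel_frontier_nonempty_interior) auto
  then obtain F where F: "F facet_of \<Delta>" "d *\<^sub>R x \<in> F"
    using d rel_frontier_of_polyhedron[OF polyhedron] by auto
  have "normal F \<bullet> (d *\<^sub>R x) = 1" using F normal(2) by blast
  then have nx: "normal F \<bullet> x = inverse d" using d(1) by (simp add: field_simps)
  moreover have "normal F \<bullet> x \<le> 1" using x(1) normal(1)[OF F(1)] by (auto simp: \<Delta>_eq)
  ultimately show ?thesis using F d(1) by (auto simp: cone_def)
qed

lemma cone_subset:
  assumes F: "F facet_of \<Delta>" and x: "x \<in> cone F"
  shows "x \<in> \<Delta>"
proof -
  have "x /\<^sub>R (normal F \<bullet> x) \<in> \<Delta>" using x facet_subset[OF F] by (auto simp: cone_def)
  then have "(normal F \<bullet> x) *\<^sub>R (x /\<^sub>R (normal F \<bullet> x)) + (1 - normal F \<bullet> x) *\<^sub>R 0 \<in> \<Delta>"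
    using x zero_in by (intro convexD[OF convex]) (auto simp: cone_def)
  then show ?thesis using x by (auto simp: cone_def)
qed

text \<open>On the cone over \<open>F\<close> the largest of all constraints is
  \<open>normal F \<bullet> x\<close>, which is therefore the gauge of \<Delta> there. Two cones can
  meet only where their normals agree on \<open>x\<close>, that is, on a plane.\<close>

lemma cone_le:
  assumes F: "F facet_of \<Delta>" and l: "l \<in> N" and x: "x \<in> cone F"
  shows "l \<bullet> x \<le> normal F \<bullet> x"
proof -
  have "x /\<^sub>R (normal F \<bullet> x) \<in> \<Delta>" using x facet_subset[OF F] by (auto simp: cone_def)
  then have "l \<bullet> (x /\<^sub>R (normal F \<bullet> x)) \<le> 1" using l by (auto simp: \<Delta>_eq)
  then show ?thesis using x by (auto simp: cone_def field_simps)
qed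

lemma cones_AE_partition:
  "AE x in lborel. indicator (interior \<Delta>) x = (\<Sum>F | F facet_of \<Delta>. indicator (cone F) x :: ennreal)"
proof -
  let ?FF = "{F. F facet_of \<Delta>}"
  \<comment> \<open>The exceptional set: the frontier, the common apex, and the planes on which two
    different normals agree.\<close>
  define E where "E = (\<Delta> - interior \<Delta>) \<union> {0} \<union> (\<Union>F\<in>?FF. \<Union>G\<in>?FF - {F}. {x. (normal F - normal G) \<bullet> x = 0})"
  have "{x. (normal F - normal G) \<bullet> x = 0} \<in> null_sets lborel" if "F \<in> ?FF" "G \<in> ?FF - {F}" for F G
  proof -
    have "normal F \<noteq> normal G" using that normal(2) by (metis DiffE mem_Collect_eq singletonI)
    then show ?thesis by (intro null_sets_lborelI negligible_hyperplane) (auto simp: closed_hyperplane)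
  qed
  then have "E \<in> null_sets lborel"
    unfolding E_def using frontier_null finite_facets
    by (intro null_sets.Un null_sets_UN' countable_finite) auto
  then show ?thesis
  proof (rule AE_I')
    show "{x \<in> space lborel. \<not> indicator (interior \<Delta>) x = (\<Sum>F | F facet_of \<Delta>. indicator (cone F) x :: ennreal)} \<subseteq> E"
    proof (rule ccontr)
      assume "\<not> ?thesis"
      then obtain x where ne: "indicator (interior \<Delta>) x \<noteq> (\<Sum>F | F facet_of \<Delta>. indicator (cone F) x :: ennreal)"
        and xE: "x \<notin> E" by blast
      show False
      proof (cases "x \<in> interior \<Delta>")
        case True
        then have "x \<in> \<Delta>" "x \<noteq> 0" using interior_subset xE by (auto simp: E_def)
        then obtain F where F: "F facet_of \<Delta>" "x \<in> cone F" using cone_cover by blast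
        have "x \<notin> cone G" if G: "G facet_of \<Delta>" "G \<noteq> F" for G
        proof
          assume xG: "x \<in> cone G"
          have "normal F \<bullet> x = normal G \<bullet> x"
            using cone_le[OF F(1) normal(1)[OF G(1)] F(2)] cone_le[OF G(1) normal(1)[OF F(1)] xG] by simp
          then have "x \<in> E" using F(1) G by (auto simp: E_def inner_diff_left)
          then show False using xE by simp
        qed
        then have "(\<Sum>G | G facet_of \<Delta>. indicator (cone G) x :: ennreal) = (\<Sum>G | G facet_of \<Delta>. if G = F then 1 else 0)"
          using F by (intro sum.cong) (auto simp: indicator_def)
        then show False using ne True F(1) finite_facets by simp
      next
        case False
        then have "x \<notin> \<Delta>" using xE by (auto simp: E_def)
        then have "(\<Sum>F | F facet_of \<Delta>. indicator (cone F) x :: ennreal) = 0"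
          using cone_subset finite_facets by (auto simp: indicator_def)
        then show False using ne False by simp
      qed
    qed
  qed
qed

text \<open>In polar coordinates the indicator of the cone splits into a factor in the facet
  parameter \<open>w\<close> and one in the radius \<open>t\<close>. Tonelli then moves the radial
  integral inside.\<close>

lemma nn_integral_cone:
  fixes g :: "real^3 \<Rightarrow> ennreal"
  assumes F: "F facet_of \<Delta>" and g[measurable]: "g \<in> borel_measurable borel"
  shows "(\<integral>\<^sup>+x\<in>cone F. g x \<partial>lborel) = ennreal (inverse (norm (normal F))) *
    (\<integral>\<^sup>+w\<in>interior (facet_dom F). (\<integral>\<^sup>+t\<in>{0<..<1}. ennreal (t\<^sup>2) * g (t *\<^sub>R chart F w) \<partial>lborel) \<partial>lborel)"
proof -
  define f where "f = chart F"
  define K where "K = facet_dom F"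
  define l where "l = normal F"
  have [measurable]: "f \<in> borel_measurable borel" "K \<in> sets borel" "cone F \<in> sets borel"
    using F by (simp_all add: f_def K_def cone_sets)
  have lf: "l \<bullet> f w = 1" for w using normal_chart[OF F] by (simp add: f_def l_def)
  have "(\<integral>\<^sup>+x\<in>cone F. g x \<partial>lborel) = (\<integral>\<^sup>+x\<in>{x. 0 < l \<bullet> x}. g x * indicator (cone F) x \<partial>lborel)"
    by (rule nn_integral_cong) (auto simp: indicator_def cone_def l_def)
  also have "\<dots> = ennreal (inverse (norm l)) *
     (\<integral>\<^sup>+t\<in>{0<..}. ennreal (t\<^sup>2) * (\<integral>\<^sup>+w. g (t *\<^sub>R f w) * indicator (cone F) (t *\<^sub>R f w) \<partial>lborel) \<partial>lborel)"
    by (rule nn_integral_halfspace_polar) (use normal(3)[OF F] chart[OF F] in \<open>auto simp: l_def f_def\<close>)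
  also have "(\<integral>\<^sup>+t\<in>{0<..}. ennreal (t\<^sup>2) * (\<integral>\<^sup>+w. g (t *\<^sub>R f w) * indicator (cone F) (t *\<^sub>R f w) \<partial>lborel) \<partial>lborel) =
      (\<integral>\<^sup>+t. \<integral>\<^sup>+w. ennreal (t\<^sup>2) * g (t *\<^sub>R f w) * indicator K w * indicator {0<..1} t \<partial>lborel \<partial>lborel)"
  proof (rule nn_integral_cong)
    fix t :: real
    show "ennreal (t\<^sup>2) * (\<integral>\<^sup>+w. g (t *\<^sub>R f w) * indicator (cone F) (t *\<^sub>R f w) \<partial>lborel) * indicator {0<..} t =
      (\<integral>\<^sup>+w. ennreal (t\<^sup>2) * g (t *\<^sub>R f w) * indicator K w * indicator {0<..1} t \<partial>lborel)"
    proof (cases "t > 0")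
      case True
      then have "indicator (cone F) (t *\<^sub>R f w) = (indicator K w * indicator {0<..1} t :: ennreal)" for w
        by (auto simp: indicator_def cone_def l_def[symmetric] lf K_def facet_dom_def f_def[symmetric])
      then show ?thesis using True by (simp add: nn_integral_cmult[symmetric] mult.assoc)
    qed simp
  qed
  also have "\<dots> = (\<integral>\<^sup>+w. \<integral>\<^sup>+t. ennreal (t\<^sup>2) * g (t *\<^sub>R f w) * indicator K w * indicator {0<..1} t \<partial>lborel \<partial>lborel)"
    by (rule lborel_pair.Fubini'[symmetric]) measurable
  also have "\<dots> = (\<integral>\<^sup>+w. \<integral>\<^sup>+t. ennreal (t\<^sup>2) * g (t *\<^sub>R f w) * indicator K w * indicator {0<..<1} t \<partial>lborel \<partial>lborel)"
  proof (rule nn_integral_cong, rule nn_integral_cong_AE)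
    fix w
    show "AE t in lborel. ennreal (t\<^sup>2) * g (t *\<^sub>R f w) * indicator K w * indicator {0<..1} t =
       ennreal (t\<^sup>2) * g (t *\<^sub>R f w) * indicator K w * indicator {0<..<1} t"
      using AE_lborel_singleton[of "1::real"] by eventually_elim (auto simp: indicator_def)
  qed
  also have "\<dots> = (\<integral>\<^sup>+w\<in>interior K. (\<integral>\<^sup>+t\<in>{0<..<1}. ennreal (t\<^sup>2) * g (t *\<^sub>R f w) \<partial>lborel) \<partial>lborel)"
  proof (rule nn_integral_cong_AE)
    have "AE w in lborel. w \<notin> K - interior K"
      using facet_dom_frontier_null[OF F] by (intro AE_not_in) (simp add: K_def)
    then show "AE w in lborel. (\<integral>\<^sup>+t. ennreal (t\<^sup>2) * g (t *\<^sub>R f w) * indicator K w * indicator {0<..<1} t \<partial>lborel) =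
      (\<integral>\<^sup>+t\<in>{0<..<1}. ennreal (t\<^sup>2) * g (t *\<^sub>R f w) \<partial>lborel) * indicator (interior K) w"
      by eventually_elim (use interior_subset[of K] in \<open>auto simp: indicator_def\<close>)
  qed
  finally show ?thesis by (simp add: f_def K_def l_def)
qed

text \<open>Boundary integrals in chart form over the open facets. The extended-valued version
  carries the inequalities; its real-valued companion \<open>bd_int\<close> matches
  \<open>boundary_integral\<close> on admissible functions.\<close>

definition bd_nn :: "(real^3 \<Rightarrow> ennreal) \<Rightarrow> ennreal" where
  "bd_nn h = (\<Sum>F | F facet_of \<Delta>. ennreal (inverse (norm (normal F))) *
     (\<integral>\<^sup>+w\<in>interior (facet_dom F). h (chart F w) \<partial>lborel))"

definition bd_int :: "(real^3 \<Rightarrow> real) \<Rightarrow> real" where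
  "bd_int h = (\<Sum>F | F facet_of \<Delta>. inverse (norm (normal F)) *
     (LINT w:interior (facet_dom F)|lborel. h (chart F w)))"

theorem nn_integral_polar:
  fixes g :: "real^3 \<Rightarrow> ennreal"
  assumes g[measurable]: "g \<in> borel_measurable borel"
  shows "(\<integral>\<^sup>+x\<in>interior \<Delta>. g x \<partial>lborel) =
    bd_nn (\<lambda>y. \<integral>\<^sup>+t\<in>{0<..<1}. ennreal (t\<^sup>2) * g (t *\<^sub>R y) \<partial>lborel)"
proof -
  have "(\<integral>\<^sup>+x\<in>interior \<Delta>. g x \<partial>lborel) = (\<integral>\<^sup>+x. (\<Sum>F | F facet_of \<Delta>. g x * indicator (cone F) x) \<partial>lborel)"
    by (rule nn_integral_cong_AE)
      (use cones_AE_partition in \<open>eventually_elim, simp add: sum_distrib_left\<close>)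
  also have "\<dots> = (\<Sum>F | F facet_of \<Delta>. \<integral>\<^sup>+x\<in>cone F. g x \<partial>lborel)"
    by (rule nn_integral_sum) (auto intro!: borel_measurable_times_ennreal borel_measurable_indicator cone_sets)
  also have "\<dots> = bd_nn (\<lambda>y. \<integral>\<^sup>+t\<in>{0<..<1}. ennreal (t\<^sup>2) * g (t *\<^sub>R y) \<partial>lborel)"
    unfolding bd_nn_def by (rule sum.cong) (simp_all add: nn_integral_cone)
  finally show ?thesis .
qed

section \<open>The stability criterion\<close>

definition vol_int :: "(real^3 \<Rightarrow> real) \<Rightarrow> real" where
  "vol_int h = (LINT x:interior \<Delta>|lborel. h x)"

text \<open>
  A function of \<^term>\<open>convex_class \<Delta>\<close> is arbitrary off \<^term>\<open>polytope_star \<Delta>\<close>; all integrals therefore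
  run over the interior of \<open>\<Delta>\<close> and over the relative interiors of the facets, where it is continuous.
\<close>

definition admissible :: "(real^3 \<Rightarrow> real) \<Rightarrow> bool" where
  "admissible h \<longleftrightarrow> continuous_on (interior \<Delta>) h \<and>
     (\<forall>F. F facet_of \<Delta> \<longrightarrow> continuous_on (interior (facet_dom F)) (\<lambda>w. h (chart F w)))"

definition bd_integrable :: "(real^3 \<Rightarrow> real) \<Rightarrow> bool" where
  "bd_integrable h \<longleftrightarrow> (\<forall>F. F facet_of \<Delta> \<longrightarrow> set_integrable lborel (interior (facet_dom F)) (\<lambda>w. h (chart F w)))"

lemma interior_star: "x \<in> interior \<Delta> \<Longrightarrow> x \<in> polytope_star \<Delta>"
  by (simp add: polytope_star_def)

lemma chart_star: "F facet_of \<Delta> \<Longrightarrow> w \<in> interior (facet_dom F) \<Longrightarrow> chart F w \<in> polytope_star \<Delta>"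
  using chart_rel_interior by (auto simp: polytope_star_def)

lemma star_cases:
  assumes "x \<in> polytope_star \<Delta>"
  obtains "x \<in> interior \<Delta>" | F w where "F facet_of \<Delta>" "w \<in> interior (facet_dom F)" "x = chart F w"
  using assms chart_rel_interior by (fastforce simp: polytope_star_def)

lemma star_subset: "polytope_star \<Delta> \<subseteq> \<Delta>"
  using interior_subset rel_interior_subset facet_subset by (fastforce simp: polytope_star_def)

section \<open>Comparison, finiteness and linearity of the integrals\<close>

lemma bd_nn_mono:
  assumes "\<And>F w. F facet_of \<Delta> \<Longrightarrow> w \<in> interior (facet_dom F) \<Longrightarrow> h (chart F w) \<le> k (chart F w)"
  shows "bd_nn h \<le> bd_nn k"
  unfolding bd_nn_def
  by (intro sum_mono mult_left_mono nn_integral_mono) (auto simp: indicator_def assms)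

lemma bd_nn_cong:
  assumes "\<And>F w. F facet_of \<Delta> \<Longrightarrow> w \<in> interior (facet_dom F) \<Longrightarrow> h (chart F w) = k (chart F w)"
  shows "bd_nn h = bd_nn k"
  by (intro antisym bd_nn_mono) (simp_all add: assms)

lemma bd_nn_finite_iff:
  "bd_nn h < \<infinity> \<longleftrightarrow> (\<forall>F. F facet_of \<Delta> \<longrightarrow> (\<integral>\<^sup>+w\<in>interior (facet_dom F). h (chart F w) \<partial>lborel) < \<infinity>)"
proof -
  have "ennreal (inverse (norm (normal F))) * c < \<infinity> \<longleftrightarrow> c < \<infinity>" if "F facet_of \<Delta>" for F and c :: ennreal
    using normal(3)[OF that] by (auto simp: ennreal_mult_less_top top.not_eq_extremum less_top)
  then show ?thesis by (auto simp: bd_nn_def finite_facets)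
qed

lemma admissible_meas:
  assumes "admissible h" "F facet_of \<Delta>"
  shows "set_borel_measurable lborel (interior (facet_dom F)) (\<lambda>w. h (chart F w))"
  using assms by (intro continuous_on_set_borel_measurable_lborel) (auto simp: admissible_def)

lemma bd_integrableI:
  assumes adm: "admissible h" and nonneg: "\<And>x. x \<in> polytope_star \<Delta> \<Longrightarrow> 0 \<le> h x"
    and fin: "bd_nn (\<lambda>y. ennreal (h y)) < \<infinity>"
  shows "bd_integrable h"
  unfolding bd_integrable_def
proof (intro allI impI)
  fix F assume F: "F facet_of \<Delta>"
  show "set_integrable lborel (interior (facet_dom F)) (\<lambda>w. h (chart F w))"
  proof (rule set_integrable_nonneg_finite)
    show "(\<integral>\<^sup>+w\<in>interior (facet_dom F). ennreal (h (chart F w)) \<partial>lborel) < \<infinity>"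
      using fin F unfolding bd_nn_finite_iff by blast
  qed (use admissible_meas[OF adm F] nonneg[OF chart_star[OF F]] in auto)
qed

lemma bd_nn_eq_bd_int:
  assumes int: "bd_integrable h" and nonneg: "\<And>x. x \<in> polytope_star \<Delta> \<Longrightarrow> 0 \<le> h x"
  shows "bd_nn (\<lambda>y. ennreal (h y)) = ennreal (bd_int h)" "0 \<le> bd_int h"
proof -
  have n: "0 \<le> (LINT w:interior (facet_dom F)|lborel. h (chart F w))" if F: "F facet_of \<Delta>" for F
    unfolding set_lebesgue_integral_def
    by (rule integral_nonneg_AE) (use nonneg[OF chart_star[OF F]] in \<open>auto simp: indicator_def\<close>)
  then show "0 \<le> bd_int h" by (auto simp: bd_int_def intro!: sum_nonneg)
  have "bd_nn (\<lambda>y. ennreal (h y)) =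
      (\<Sum>F | F facet_of \<Delta>. ennreal (inverse (norm (normal F)) * (LINT w:interior (facet_dom F)|lborel. h (chart F w))))"
    unfolding bd_nn_def
  proof (rule sum.cong[OF refl])
    fix F assume "F \<in> {F. F facet_of \<Delta>}"
    then have F: "F facet_of \<Delta>" by simp
    have "(\<integral>\<^sup>+w\<in>interior (facet_dom F). ennreal (h (chart F w)) \<partial>lborel) = ennreal (LINT w:interior (facet_dom F)|lborel. h (chart F w))"
      using int F nonneg[OF chart_star[OF F]] by (intro set_nn_integral_eq_set_integral) (auto simp: bd_integrable_def)
    then show "ennreal (inverse (norm (normal F))) * (\<integral>\<^sup>+w\<in>interior (facet_dom F). ennreal (h (chart F w)) \<partial>lborel) =
      ennreal (inverse (norm (normal F)) * (LINT w:interior (facet_dom F)|lborel. h (chart F w)))"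
      using n[OF F] by (simp add: ennreal_mult)
  qed
  also have "\<dots> = ennreal (bd_int h)"
    unfolding bd_int_def by (rule sum_ennreal) (use n in auto)
  finally show "bd_nn (\<lambda>y. ennreal (h y)) = ennreal (bd_int h)" .
qed

lemma bd_integrable_lincomb:
  assumes "bd_integrable h" "bd_integrable k"
  shows "bd_integrable (\<lambda>x. a * h x + b * k x)"
    and "bd_int (\<lambda>x. a * h x + b * k x) = a * bd_int h + b * bd_int k"
proof -
  have i: "set_integrable lborel (interior (facet_dom F)) (\<lambda>w. a * h (chart F w))"
    "set_integrable lborel (interior (facet_dom F)) (\<lambda>w. b * k (chart F w))" if "F facet_of \<Delta>" for F
    using assms that by (auto simp: bd_integrable_def)
  then show "bd_integrable (\<lambda>x. a * h x + b * k x)"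
    unfolding bd_integrable_def by (intro allI impI set_integral_add) auto
  show "bd_int (\<lambda>x. a * h x + b * k x) = a * bd_int h + b * bd_int k"
    unfolding bd_int_def sum_distrib_left sum.distrib[symmetric]
    by (rule sum.cong) (auto simp: set_integral_add[OF i] algebra_simps)
qed

lemma bd_integrable_continuous:
  assumes "continuous_on UNIV h"
  shows "bd_integrable h"
  unfolding bd_integrable_def
proof (intro allI impI set_integrable_compact_interior)
  fix F assume F: "F facet_of \<Delta>"
  show "compact (facet_dom F)" using facet_dom_geometry[OF F] by (simp add: compact_eq_bounded_closed)
  show "continuous_on (facet_dom F) (\<lambda>w. h (chart F w))"
    by (rule continuous_on_compose2[OF assms continuous_chart[OF F]]) simp
qed

lemma vol_integrable_continuous:
  "continuous_on UNIV h \<Longrightarrow> set_integrable lborel (interior \<Delta>) (h :: real^3 \<Rightarrow> real)"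
  by (intro set_integrable_compact_interior compact) (rule continuous_on_subset, auto)

lemma vol_int_lincomb:
  assumes "set_integrable lborel (interior \<Delta>) h" "set_integrable lborel (interior \<Delta>) k"
  shows "vol_int (\<lambda>x. a * h x + b * k x) = a * vol_int h + b * vol_int k"
proof -
  have "set_integrable lborel (interior \<Delta>) (\<lambda>x. a * h x)" "set_integrable lborel (interior \<Delta>) (\<lambda>x. b * k x)"
    using assms by auto
  then show ?thesis by (simp add: vol_int_def set_integral_add)
qed

lemma admissible_continuous:
  assumes "continuous_on UNIV h"
  shows "admissible h"
  unfolding admissible_def
proof (intro conjI allI impI)
  show "continuous_on (interior \<Delta>) h" using assms by (rule continuous_on_subset) simp
  fix F assume F: "F facet_of \<Delta>"
  show "continuous_on (interior (facet_dom F)) (\<lambda>w. h (chart F w))"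
    by (rule continuous_on_compose2[OF assms continuous_chart[OF F]]) simp
qed

lemma admissible_lincomb:
  "admissible h \<Longrightarrow> admissible k \<Longrightarrow> admissible (\<lambda>x. a * h x + b * k x)"
  unfolding admissible_def by (auto intro!: continuous_intros)

lemma admissible_mult:
  "admissible h \<Longrightarrow> admissible k \<Longrightarrow> admissible (\<lambda>x. h x * k x)"
  unfolding admissible_def by (auto intro!: continuous_intros)

lemma admissible_convex:
  assumes conv: "convex_on (polytope_star \<Delta>) u"
  shows "admissible u"
  unfolding admissible_def
proof (intro conjI allI impI)
  have "convex_on (interior \<Delta>) u"
    using conv interior_star convex_interior[OF convex] by (auto simp: convex_on_def)
  then show "continuous_on (interior \<Delta>) u" by (rule convex_on_continuous[OF open_interior])
  fix F assume F: "F facet_of \<Delta>"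
  have "convex_on (interior (facet_dom F)) (\<lambda>w. u (chart F w))"
    using conv chart_star[OF F] convex_interior[OF facet_dom_geometry(1)[OF F]]
    by (auto simp: convex_on_def chart_convex_comb[OF F])
  then show "continuous_on (interior (facet_dom F)) (\<lambda>w. u (chart F w))"
    by (rule convex_on_continuous[OF open_interior])
qed

section \<open>Affine functions: volume integrals against boundary integrals\<close>

lemma ray_in:
  assumes "x \<in> \<Delta>" "0 \<le> t" "t \<le> 1"
  shows "t *\<^sub>R x \<in> \<Delta>"
  using convexD[OF convex assms(1) zero_in, of t "1 - t"] assms by simp

lemma nn_integral_affine_polar:
  assumes nonneg: "\<And>x. x \<in> \<Delta> \<Longrightarrow> 0 \<le> b \<bullet> x + e"
  shows "(\<integral>\<^sup>+x\<in>interior \<Delta>. ennreal (b \<bullet> x + e) \<partial>lborel) = bd_nn (\<lambda>y. ennreal (b \<bullet> y / 4 + e / 3))"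
proof -
  have "(\<integral>\<^sup>+x\<in>interior \<Delta>. ennreal (b \<bullet> x + e) \<partial>lborel) =
    bd_nn (\<lambda>y. \<integral>\<^sup>+t\<in>{0<..<1}. ennreal (t\<^sup>2) * ennreal (b \<bullet> (t *\<^sub>R y) + e) \<partial>lborel)"
    by (rule nn_integral_polar) simp
  also have "\<dots> = bd_nn (\<lambda>y. ennreal (b \<bullet> y / 4 + e / 3))"
  proof (rule bd_nn_cong)
    fix F w assume "F facet_of \<Delta>" "w \<in> interior (facet_dom F)"
    then have y: "chart F w \<in> \<Delta>" using chart_star star_subset by blast
    define y where "y = chart F w"
    have "(\<integral>\<^sup>+t\<in>{0<..<1}. ennreal (t\<^sup>2) * ennreal (b \<bullet> (t *\<^sub>R y) + e) \<partial>lborel) =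
      (\<integral>\<^sup>+t\<in>{0<..<1}. ennreal (e * t^2 + (b \<bullet> y) * t^3 + 0 * t^4) \<partial>lborel)"
      by (rule nn_integral_cong)
        (simp add: ennreal_mult'[symmetric] algebra_simps power2_eq_square power3_eq_cube)
    also have "\<dots> = ennreal (e / 3 + (b \<bullet> y) / 4 + 0 / 5)"
    proof (rule nn_integral_radial_polynomial)
      fix t :: real assume "0 \<le> t" "t \<le> 1"
      then have "0 \<le> b \<bullet> (t *\<^sub>R y) + e" unfolding y_def by (intro nonneg ray_in y)
      then have "0 \<le> t\<^sup>2 * (b \<bullet> (t *\<^sub>R y) + e)" by (intro mult_nonneg_nonneg) auto
      then show "0 \<le> e * t^2 + (b \<bullet> y) * t^3 + 0 * t^4"
        by (simp add: algebra_simps power2_eq_square power3_eq_cube)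
    qed
    finally show "(\<integral>\<^sup>+t\<in>{0<..<1}. ennreal (t\<^sup>2) * ennreal (b \<bullet> (t *\<^sub>R chart F w) + e) \<partial>lborel) =
      ennreal (b \<bullet> chart F w / 4 + e / 3)" by (simp add: y_def add.commute)
  qed
  finally show ?thesis .
qed

text \<open>The extended-valued identity becomes one of real numbers because both integrands are
  nonnegative: the boundary density is \<open>(b \<bullet> y + e) / 4 + e / 12\<close>.\<close>

lemma vol_int_affine_polar:
  assumes nonneg: "\<And>x. x \<in> \<Delta> \<Longrightarrow> 0 \<le> b \<bullet> x + e" and e: "e \<ge> 0"
  shows "vol_int (\<lambda>x. b \<bullet> x + e) = bd_int (\<lambda>y. b \<bullet> y / 4 + e / 3)"
proof -
  have n: "0 \<le> b \<bullet> x / 4 + e / 3" if "x \<in> polytope_star \<Delta>" for x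
  proof -
    have "0 \<le> b \<bullet> x + e" using nonneg that star_subset by blast
    then show ?thesis using e by simp
  qed
  have i: "bd_integrable (\<lambda>y. b \<bullet> y / 4 + e / 3)" by (intro bd_integrable_continuous continuous_intros) auto
  have "ennreal (vol_int (\<lambda>x. b \<bullet> x + e)) = (\<integral>\<^sup>+x\<in>interior \<Delta>. ennreal (b \<bullet> x + e) \<partial>lborel)"
    unfolding vol_int_def
    by (rule set_nn_integral_eq_set_integral[symmetric])
      (use nonneg interior_subset in \<open>auto intro!: vol_integrable_continuous continuous_intros\<close>)
  also have "\<dots> = ennreal (bd_int (\<lambda>y. b \<bullet> y / 4 + e / 3))"
    using nn_integral_affine_polar[of b e] nonneg bd_nn_eq_bd_int(1)[OF i n] by simp
  finally have "ennreal (vol_int (\<lambda>x. b \<bullet> x + e)) = ennreal (bd_int (\<lambda>y. b \<bullet> y / 4 + e / 3))" .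
  moreover have "0 \<le> vol_int (\<lambda>x. b \<bullet> x + e)"
    unfolding vol_int_def set_lebesgue_integral_def
    by (rule integral_nonneg_AE) (use nonneg interior_subset in \<open>auto simp: indicator_def\<close>)
  ultimately show ?thesis using bd_nn_eq_bd_int(2)[OF i n] by simp
qed

text \<open>The divergence theorem for the radial field: a homogeneous function of degree k has
  boundary integral 3 + k times its volume integral. Signs are handled by a constant
  \<open>C\<close> that makes \<open>b \<bullet> x + C\<close> nonnegative on the bounded
  body.\<close>

lemma bd_int_affine: "bd_int (\<lambda>y. b \<bullet> y + e) = vol_int (\<lambda>x. 4 * (b \<bullet> x) + 3 * e)"
proof -
  obtain B where B: "\<And>x. x \<in> \<Delta> \<Longrightarrow> norm x \<le> B" using bounded by (auto simp: bounded_iff)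
  define C where "C = norm b * B"
  have "B \<ge> 0" using B[OF zero_in] by simp
  then have C: "C \<ge> 0" by (simp add: C_def)
  have nb: "0 \<le> b \<bullet> x + C" if "x \<in> \<Delta>" for x
  proof -
    have "\<bar>b \<bullet> x\<bar> \<le> norm b * norm x" by (rule Cauchy_Schwarz_ineq2)
    also have "\<dots> \<le> C" unfolding C_def by (rule mult_left_mono) (use B that in auto)
    finally show ?thesis by simp
  qed
  have v1: "vol_int (\<lambda>x. b \<bullet> x + C) = bd_int (\<lambda>y. b \<bullet> y / 4 + C / 3)"
    by (rule vol_int_affine_polar[OF nb C])
  have v2: "vol_int (\<lambda>x. 1) = bd_int (\<lambda>y. 1 / 3)"
    using vol_int_affine_polar[of 0 1] by simp
  have "bd_int (\<lambda>y. b \<bullet> y + e) = bd_int (\<lambda>y. 4 * (b \<bullet> y / 4 + C / 3) + (3 * e - 4 * C) * (1 / 3))"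
    by (rule arg_cong[of _ _ bd_int]) (simp add: fun_eq_iff algebra_simps)
  also have "\<dots> = 4 * bd_int (\<lambda>y. b \<bullet> y / 4 + C / 3) + (3 * e - 4 * C) * bd_int (\<lambda>y. 1 / 3)"
    by (intro bd_integrable_lincomb bd_integrable_continuous continuous_intros) auto
  also have "\<dots> = 4 * vol_int (\<lambda>x. b \<bullet> x + C) + (3 * e - 4 * C) * vol_int (\<lambda>x. 1)"
    by (simp add: v1 v2)
  also have "\<dots> = vol_int (\<lambda>x. 4 * (b \<bullet> x + C) + (3 * e - 4 * C) * 1)"
    by (intro vol_int_lincomb[symmetric] vol_integrable_continuous continuous_intros)
  also have "\<dots> = vol_int (\<lambda>x. 4 * (b \<bullet> x) + 3 * e)"
    by (rule arg_cong[of _ _ vol_int]) (simp add: fun_eq_iff algebra_simps)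
  finally show ?thesis .
qed

lemma vol_int_pos_zero:
  assumes cont: "continuous_on (interior \<Delta>) h" and nonneg: "\<And>x. x \<in> interior \<Delta> \<Longrightarrow> 0 \<le> h x"
    and int: "set_integrable lborel (interior \<Delta>) h" and zero: "vol_int h = 0" and x: "x \<in> interior \<Delta>"
  shows "h x = 0"
proof (rule continuous_nonneg_integral_zero_open[OF open_interior cont nonneg _ x])
  have "(\<integral>\<^sup>+x. ennreal (indicat_real (interior \<Delta>) x * h x) \<partial>lborel) = (\<integral>\<^sup>+x\<in>interior \<Delta>. ennreal (h x) \<partial>lborel)"
    by (rule nn_integral_cong) (simp add: indicator_def)
  also have "\<dots> = ennreal (vol_int h)"
    unfolding vol_int_def by (rule set_nn_integral_eq_set_integral[OF int nonneg])
  finally show "(\<integral>\<^sup>+x. ennreal (indicat_real (interior \<Delta>) x * h x) \<partial>lborel) = 0" using zero by simp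
qed

lemma boundary_integral_eq: "admissible u \<Longrightarrow> boundary_integral \<Delta> u = bd_int u"
  unfolding boundary_integral_def bd_int_def
  by (rule sum.cong) (auto simp: facet_integral_eq(1) admissible_def)

lemma finite_boundary_integral_iff:
  assumes "admissible u"
  shows "finite_boundary_integral \<Delta> u \<longleftrightarrow> bd_nn (\<lambda>y. ennreal (u y)) < \<infinity>"
proof -
  have "(\<Sum>F | F facet_of \<Delta>. ennreal (inverse (norm (normal F))) * (\<integral>\<^sup>+x\<in>F. ennreal (u x) \<partial>plane_area (affine hull F)))
    = bd_nn (\<lambda>y. ennreal (u y))"
    unfolding bd_nn_def using assms by (intro sum.cong) (auto simp: facet_integral_eq(2) admissible_def)
  then show ?thesis by (simp add: finite_boundary_integral_def)
qed

lemma average_curvature: "average_curvature \<Delta> = 3"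
proof -
  have v: "measure lebesgue \<Delta> = vol_int (\<lambda>_. 1)"
    using volume_integral_eq[of "\<lambda>_. 1"] closed by (simp add: vol_int_def set_lebesgue_integral_def)
  have "vol_int (\<lambda>_. 1) \<noteq> 0"
    using vol_int_pos_zero[of "\<lambda>_. 1", OF _ _ vol_integrable_continuous _ zero_interior] by auto
  moreover have "boundary_integral \<Delta> (\<lambda>_. 1) = 3 * vol_int (\<lambda>_. 1)"
  proof -
    have "boundary_integral \<Delta> (\<lambda>_. 1) = bd_int (\<lambda>_. 1)"
      by (intro boundary_integral_eq admissible_continuous) simp
    also have "\<dots> = vol_int (\<lambda>_. 3)" using bd_int_affine[of 0 1] by simp
    also have "\<dots> = 3 * vol_int (\<lambda>_. 1)" by (simp add: vol_int_def set_lebesgue_integral_def)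
    finally show ?thesis .
  qed
  ultimately show ?thesis by (simp add: average_curvature_def v)
qed

lemma L_functional_eq:
  assumes u: "admissible u" and th: "continuous_on UNIV \<theta>"
  shows "L_functional \<Delta> \<theta> u = bd_int u - vol_int (\<lambda>x. (3 + \<theta> x) * u x)"
proof -
  have "continuous_on (interior \<Delta>) (\<lambda>x. (3 + \<theta> x) * u x)"
    using u continuous_on_subset[OF th] by (auto simp: admissible_def intro!: continuous_intros)
  from volume_integral_eq[OF this] show ?thesis
    by (simp add: L_functional_def boundary_integral_eq[OF u] average_curvature vol_int_def)
qed

text \<open>Used with weight 3 + \<theta> for the inequality and with weight 1 for the equality
  case. Nonnegativity of the weight is what allows the convexity bound on \<open>v\<close> to be
  multiplied by it.\<close>

lemma radial_inequality:
  assumes conv: "convex_on (polytope_star \<Delta>) v" and nonneg: "\<And>x. x \<in> polytope_star \<Delta> \<Longrightarrow> 0 \<le> v x"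
    and v0: "v 0 = 0" and wt: "\<And>x. x \<in> \<Delta> \<Longrightarrow> 0 \<le> a \<bullet> x + c"
  shows "(\<integral>\<^sup>+x\<in>interior \<Delta>. ennreal ((a \<bullet> x + c) * v x) \<partial>lborel) \<le> bd_nn (\<lambda>y. ennreal ((a \<bullet> y / 5 + c / 4) * v y))"
proof -
  have adm: "admissible v" by (rule admissible_convex[OF conv])
  \<comment> \<open>Cutting off outside the interior, where nothing is known about \<open>v\<close>
    beyond the open facets, gives the Borel function that \<open>nn_integral_polar\<close> asks
    for.\<close>
  define g where "g = (\<lambda>x. ennreal (indicator (interior \<Delta>) x *\<^sub>R ((a \<bullet> x + c) * v x)))"
  have [measurable]: "g \<in> borel_measurable borel"
    unfolding g_def using adm
    by (intro measurable_compose[OF borel_measurable_continuous_on_indicator measurable_ennreal])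
      (auto simp: admissible_def intro!: continuous_intros)
  have "(\<integral>\<^sup>+x\<in>interior \<Delta>. ennreal ((a \<bullet> x + c) * v x) \<partial>lborel) = (\<integral>\<^sup>+x\<in>interior \<Delta>. g x \<partial>lborel)"
    by (rule nn_integral_cong) (simp add: g_def indicator_def)
  also have "\<dots> = bd_nn (\<lambda>y. \<integral>\<^sup>+t\<in>{0<..<1}. ennreal (t\<^sup>2) * g (t *\<^sub>R y) \<partial>lborel)"
    by (rule nn_integral_polar) simp
  also have "\<dots> \<le> bd_nn (\<lambda>y. ennreal ((a \<bullet> y / 5 + c / 4) * v y))"
  proof (rule bd_nn_mono)
    fix F w assume "F facet_of \<Delta>" "w \<in> interior (facet_dom F)"
    then have ys: "chart F w \<in> polytope_star \<Delta>" by (rule chart_star)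
    then have y\<Delta>: "chart F w \<in> \<Delta>" using star_subset by blast
    define y where "y = chart F w"
    have le: "ennreal (t\<^sup>2) * g (t *\<^sub>R y) \<le> ennreal (0 * t^2 + c * v y * t^3 + (a \<bullet> y) * v y * t^4)"
      if t: "t \<in> {0<..<1}" for t
    proof (cases "t *\<^sub>R y \<in> interior \<Delta>")
      case True
      have "v ((1 - t) *\<^sub>R 0 + t *\<^sub>R y) \<le> (1 - t) * v 0 + t * v y"
        unfolding y_def by (rule convex_onD[OF conv]) (use ys interior_star[OF zero_interior] t in auto)
      then have "v (t *\<^sub>R y) \<le> t * v y" by (simp add: v0)
      moreover have "0 \<le> a \<bullet> (t *\<^sub>R y) + c" unfolding y_def by (intro wt ray_in[OF y\<Delta>]) (use t in auto)
      ultimately have "t\<^sup>2 * ((a \<bullet> (t *\<^sub>R y) + c) * v (t *\<^sub>R y)) \<le> t\<^sup>2 * ((a \<bullet> (t *\<^sub>R y) + c) * (t * v y))"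
        by (intro mult_left_mono) auto
      also have "\<dots> = 0 * t^2 + c * v y * t^3 + (a \<bullet> y) * v y * t^4"
        by (simp add: algebra_simps power_numeral_reduce)
      finally have "ennreal (t\<^sup>2 * ((a \<bullet> (t *\<^sub>R y) + c) * v (t *\<^sub>R y))) \<le> ennreal (0 * t^2 + c * v y * t^3 + (a \<bullet> y) * v y * t^4)"
        by (rule ennreal_leI)
      moreover have "ennreal (t\<^sup>2) * g (t *\<^sub>R y) = ennreal (t\<^sup>2 * ((a \<bullet> (t *\<^sub>R y) + c) * v (t *\<^sub>R y)))"
        using True by (simp add: g_def ennreal_mult'[symmetric])
      ultimately show ?thesis by simp
    qed (simp add: g_def)
    have "(\<integral>\<^sup>+t\<in>{0<..<1}. ennreal (t\<^sup>2) * g (t *\<^sub>R y) \<partial>lborel) \<le>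
      (\<integral>\<^sup>+t\<in>{0<..<1}. ennreal (0 * t^2 + c * v y * t^3 + (a \<bullet> y) * v y * t^4) \<partial>lborel)"
      by (rule nn_integral_mono) (use le in \<open>auto simp: indicator_def\<close>)
    also have "\<dots> = ennreal (0 / 3 + c * v y / 4 + (a \<bullet> y) * v y / 5)"
    proof (rule nn_integral_radial_polynomial)
      fix t :: real assume t: "0 \<le> t" "t \<le> 1"
      then have "0 \<le> a \<bullet> (t *\<^sub>R y) + c" unfolding y_def by (intro wt ray_in[OF y\<Delta>])
      then have "0 \<le> t^3 * v y * (a \<bullet> (t *\<^sub>R y) + c)"
        using nonneg[OF ys] t by (intro mult_nonneg_nonneg) (auto simp: y_def)
      then show "0 \<le> 0 * t^2 + c * v y * t^3 + (a \<bullet> y) * v y * t^4"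
        by (simp add: algebra_simps power_numeral_reduce)
    qed
    also have "0 / 3 + c * v y / 4 + (a \<bullet> y) * v y / 5 = (a \<bullet> y / 5 + c / 4) * v y"
      by (simp add: algebra_simps)
    finally show "(\<integral>\<^sup>+t\<in>{0<..<1}. ennreal (t\<^sup>2) * g (t *\<^sub>R chart F w) \<partial>lborel) \<le>
      ennreal ((a \<bullet> chart F w / 5 + c / 4) * v (chart F w))" by (simp add: y_def)
  qed
  finally show ?thesis .
qed

section \<open>Congruence rules and identification of the affine potential\<close>

lemma bd_int_cong:
  assumes "\<And>x. x \<in> polytope_star \<Delta> \<Longrightarrow> h x = k x"
  shows "bd_int h = bd_int k"
  unfolding bd_int_def
proof (rule sum.cong[OF refl])
  fix F assume "F \<in> {F. F facet_of \<Delta>}"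
  then have F: "F facet_of \<Delta>" by simp
  have "(LINT w:interior (facet_dom F)|lborel. h (chart F w)) = (LINT w:interior (facet_dom F)|lborel. k (chart F w))"
    by (rule set_lebesgue_integral_cong) (auto simp: assms chart_star[OF F])
  then show "inverse (norm (normal F)) * (LINT w:interior (facet_dom F)|lborel. h (chart F w)) =
    inverse (norm (normal F)) * (LINT w:interior (facet_dom F)|lborel. k (chart F w))" by simp
qed

lemma vol_int_cong:
  assumes "\<And>x. x \<in> interior \<Delta> \<Longrightarrow> h x = k x"
  shows "vol_int h = vol_int k"
  unfolding vol_int_def by (rule set_lebesgue_integral_cong) (auto simp: assms)

text \<open>By \<open>bd_int_affine\<close> the functional at \<open>b \<bullet> x + e\<close> is
  the volume integral of \<open>(1 - \<theta>) * (b \<bullet> x) - \<theta> * e\<close>. This is the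
  origin of the two moment conditions.\<close>

lemma L_functional_affine:
  assumes zero: "vol_int (\<lambda>x. a \<bullet> x + c) = 0"
    and lin: "\<And>i. vol_int (\<lambda>x. (1 - (a \<bullet> x + c)) * x $ i) = 0"
  shows "L_functional \<Delta> (\<lambda>x. a \<bullet> x + c) (\<lambda>x. b \<bullet> x + e) = 0"
proof -
  note cont = vol_integrable_continuous continuous_intros
  have "vol_int (\<lambda>x. (1 - (a \<bullet> x + c)) * (b \<bullet> x)) =
    vol_int (\<lambda>x. b $ 1 * ((1 - (a \<bullet> x + c)) * x $ 1) +
       1 * (b $ 2 * ((1 - (a \<bullet> x + c)) * x $ 2) + b $ 3 * ((1 - (a \<bullet> x + c)) * x $ 3)))"
    by (rule vol_int_cong) (simp add: inner_vec_def sum_3 algebra_simps)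
  also have "\<dots> = b $ 1 * vol_int (\<lambda>x. (1 - (a \<bullet> x + c)) * x $ 1) +
       1 * vol_int (\<lambda>x. b $ 2 * ((1 - (a \<bullet> x + c)) * x $ 2) + b $ 3 * ((1 - (a \<bullet> x + c)) * x $ 3))"
    by (intro vol_int_lincomb cont)
  also have "vol_int (\<lambda>x. b $ 2 * ((1 - (a \<bullet> x + c)) * x $ 2) + b $ 3 * ((1 - (a \<bullet> x + c)) * x $ 3)) =
     b $ 2 * vol_int (\<lambda>x. (1 - (a \<bullet> x + c)) * x $ 2) + b $ 3 * vol_int (\<lambda>x. (1 - (a \<bullet> x + c)) * x $ 3)"
    by (intro vol_int_lincomb cont)
  finally have b: "vol_int (\<lambda>x. (1 - (a \<bullet> x + c)) * (b \<bullet> x)) = 0" by (simp add: lin)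
  have "L_functional \<Delta> (\<lambda>x. a \<bullet> x + c) (\<lambda>x. b \<bullet> x + e) =
    vol_int (\<lambda>x. 4 * (b \<bullet> x) + 3 * e) - vol_int (\<lambda>x. (3 + (a \<bullet> x + c)) * (b \<bullet> x + e))"
    unfolding bd_int_affine[symmetric] by (intro L_functional_eq admissible_continuous continuous_intros)
  also have "vol_int (\<lambda>x. 4 * (b \<bullet> x) + 3 * e) = vol_int (\<lambda>x. 1 * ((3 + (a \<bullet> x + c)) * (b \<bullet> x + e))
      + 1 * (1 * ((1 - (a \<bullet> x + c)) * (b \<bullet> x)) + (- e) * (a \<bullet> x + c)))"
    by (rule vol_int_cong) (simp add: algebra_simps)
  also have "\<dots> = 1 * vol_int (\<lambda>x. (3 + (a \<bullet> x + c)) * (b \<bullet> x + e)) +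
     1 * vol_int (\<lambda>x. 1 * ((1 - (a \<bullet> x + c)) * (b \<bullet> x)) + (- e) * (a \<bullet> x + c))"
    by (intro vol_int_lincomb cont)
  also have "vol_int (\<lambda>x. 1 * ((1 - (a \<bullet> x + c)) * (b \<bullet> x)) + (- e) * (a \<bullet> x + c)) =
     1 * vol_int (\<lambda>x. (1 - (a \<bullet> x + c)) * (b \<bullet> x)) + (- e) * vol_int (\<lambda>x. a \<bullet> x + c)"
    by (intro vol_int_lincomb cont)
  finally show ?thesis by (simp add: b zero)
qed

text \<open>Uniqueness: two candidates differ by an affine \<open>d\<close>. Testing both with
  \<open>d\<close> itself makes the integral of \<open>d * d\<close> vanish, so \<open>d\<close> is
  zero on the interior, in particular on a ball around 0, and its coefficients are zero.\<close>

lemma theta_eq: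
  assumes zero: "vol_int (\<lambda>x. a \<bullet> x + c) = 0"
    and lin: "\<And>i. vol_int (\<lambda>x. (1 - (a \<bullet> x + c)) * x $ i) = 0"
  shows "theta \<Delta> = (\<lambda>x. a \<bullet> x + c)"
  unfolding theta_def
proof (rule the_equality)
  have aff: "affine_linear_on UNIV (\<lambda>x. a' \<bullet> x + c')" for a' c' by (auto simp: affine_linear_on_def)
  have affD: "\<exists>b e. u = (\<lambda>x. b \<bullet> x + e)" if "affine_linear_on UNIV u" for u
    using that by (auto simp: affine_linear_on_def fun_eq_iff)
  show "affine_linear_on UNIV (\<lambda>x. a \<bullet> x + c) \<and>
    (\<forall>u. affine_linear_on UNIV u \<longrightarrow> L_functional \<Delta> (\<lambda>x. a \<bullet> x + c) u = 0)"
    using aff affD L_functional_affine[OF zero lin] by metis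
  fix \<theta> assume "affine_linear_on UNIV \<theta> \<and> (\<forall>u. affine_linear_on UNIV u \<longrightarrow> L_functional \<Delta> \<theta> u = 0)"
  then obtain a' c' where th: "\<theta> = (\<lambda>x. a' \<bullet> x + c')"
    and L: "\<And>b e. L_functional \<Delta> \<theta> (\<lambda>x. b \<bullet> x + e) = 0"
    using aff affD by metis
  define d where "d = (\<lambda>x. (a' - a) \<bullet> x + (c' - c))"
  have d: "d x = \<theta> x - (a \<bullet> x + c)" for x by (simp add: d_def th inner_diff_left)
  have cont: "continuous_on S d" for S unfolding d_def by (intro continuous_intros)
  have "vol_int (\<lambda>x. (3 + (a \<bullet> x + c)) * d x) = vol_int (\<lambda>x. (3 + \<theta> x) * d x)"
    using L[of "a' - a" "c' - c"] L_functional_affine[OF zero lin, of "a' - a" "c' - c"]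
    unfolding d_def[symmetric] th
    by (subst (asm) (1 2) L_functional_eq) (auto intro!: admissible_continuous cont continuous_intros)
  moreover have "vol_int (\<lambda>x. d x * d x) = vol_int (\<lambda>x. 1 * ((3 + \<theta> x) * d x) + (-1) * ((3 + (a \<bullet> x + c)) * d x))"
    by (rule vol_int_cong) (simp add: d algebra_simps)
  moreover have "vol_int (\<lambda>x. 1 * ((3 + \<theta> x) * d x) + (-1) * ((3 + (a \<bullet> x + c)) * d x)) =
    1 * vol_int (\<lambda>x. (3 + \<theta> x) * d x) + (-1) * vol_int (\<lambda>x. (3 + (a \<bullet> x + c)) * d x)"
    unfolding th by (intro vol_int_lincomb vol_integrable_continuous continuous_intros cont)
  ultimately have z: "vol_int (\<lambda>x. d x * d x) = 0" by simp
  have d0: "d x = 0" if x: "x \<in> interior \<Delta>" for x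
  proof -
    have "d x * d x = 0"
      by (rule vol_int_pos_zero[OF _ _ _ z x]) (auto intro!: continuous_intros cont vol_integrable_continuous)
    then show ?thesis by simp
  qed
  obtain r where r: "r > 0" "ball 0 r \<subseteq> interior \<Delta>"
    using zero_interior open_contains_ball open_interior by metis
  have c: "c' = c" using d0[OF zero_interior] by (simp add: d_def)
  have "a' - a = 0"
  proof (rule ccontr)
    assume n: "a' - a \<noteq> 0"
    define x where "x = (r / 2 / norm (a' - a)) *\<^sub>R (a' - a)"
    have "norm x < r" using r n by (simp add: x_def)
    then have "d x = 0" using d0 r(2) by auto
    then have "(r / 2 / norm (a' - a)) * ((a' - a) \<bullet> (a' - a)) = 0" by (simp add: d_def c x_def)
    then show False using r(1) n by simp
  qed
  then show "\<theta> = (\<lambda>x. a \<bullet> x + c)" using c th by simp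
qed

section \<open>Vanishing integrals, supporting functions and the criterion\<close>

lemma bd_int_nonneg_zero:
  assumes adm: "admissible h" and int: "bd_integrable h" and nonneg: "\<And>x. x \<in> polytope_star \<Delta> \<Longrightarrow> 0 \<le> h x"
    and zero: "bd_int h = 0" and F: "F facet_of \<Delta>" and w: "w \<in> interior (facet_dom F)"
  shows "h (chart F w) = 0"
proof (rule continuous_nonneg_integral_zero_open[OF open_interior _ _ _ w])
  show "continuous_on (interior (facet_dom F)) (\<lambda>w. h (chart F w))" using adm F by (simp add: admissible_def)
  show "0 \<le> h (chart F w)" if "w \<in> interior (facet_dom F)" for w by (rule nonneg[OF chart_star[OF F that]])
  have "bd_nn (\<lambda>y. ennreal (h y)) = 0" using bd_nn_eq_bd_int(1)[OF int nonneg] zero by simp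
  then have "ennreal (inverse (norm (normal F))) * (\<integral>\<^sup>+w\<in>interior (facet_dom F). ennreal (h (chart F w)) \<partial>lborel) = 0"
    using finite_facets F unfolding bd_nn_def by (subst (asm) sum_nonneg_eq_0_iff) auto
  then have "(\<integral>\<^sup>+w\<in>interior (facet_dom F). ennreal (h (chart F w)) \<partial>lborel) = 0"
    using normal(3)[OF F] by simp
  moreover have "(\<integral>\<^sup>+w. ennreal (indicat_real (interior (facet_dom F)) w * h (chart F w)) \<partial>lborel) =
    (\<integral>\<^sup>+w\<in>interior (facet_dom F). ennreal (h (chart F w)) \<partial>lborel)"
    by (rule nn_integral_cong) (simp add: indicator_def)
  ultimately show "(\<integral>\<^sup>+w. ennreal (indicat_real (interior (facet_dom F)) w * h (chart F w)) \<partial>lborel) = 0" by simp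
qed

text \<open>The subgradient at 0 is obtained over the open interior only. It extends to the open
  facets by convexity: \<open>(1/2) *\<^sub>R x\<close> is interior, and \<open>u\<close> there is
  at most the mean of \<open>u 0\<close> and \<open>u x\<close>.\<close>

lemma convex_on_star_supporting:
  assumes conv: "convex_on (polytope_star \<Delta>) u"
  obtains s where "\<And>x. x \<in> polytope_star \<Delta> \<Longrightarrow> s \<bullet> x + u 0 \<le> u x"
proof -
  have "convex_on (interior \<Delta>) u"
    using conv interior_star convex_interior[OF convex] by (auto simp: convex_on_def)
  then obtain s where s: "\<And>x. x \<in> interior \<Delta> \<Longrightarrow> u 0 + s \<bullet> (x - 0) \<le> u x"
    using convex_on_subgradient[OF open_interior _ zero_interior] by blast
  show thesis
  proof
    fix x assume x: "x \<in> polytope_star \<Delta>"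
    have half: "x - (1/2) *\<^sub>R (x - 0) = (1/2) *\<^sub>R x" by (simp add: vec_eq_iff)
    have "x - (1/2) *\<^sub>R (x - 0) \<in> interior \<Delta>"
      using x star_subset by (intro mem_interior_convex_shrink[OF convex zero_interior]) auto
    then have "(1/2) *\<^sub>R x \<in> interior \<Delta>" unfolding half .
    then have "u 0 + s \<bullet> ((1/2) *\<^sub>R x) \<le> u ((1/2) *\<^sub>R x)" using s[of "(1/2) *\<^sub>R x"] by simp
    also have "\<dots> \<le> (1/2) * u 0 + (1/2) * u x"
      using convex_onD[OF conv, of "1/2" 0 x] x interior_star[OF zero_interior] by simp
    finally show "s \<bullet> x + u 0 \<le> u x" by simp
  qed
qed

text \<open>With \<open>v\<close> denoting \<open>u\<close> minus its support at 0, the functional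
  is at least the boundary integral of \<open>(1 - W) * v\<close>. Strictness of
  \<open>upper\<close> makes \<open>1 - W\<close> positive, so equality forces \<open>v\<close> to
  vanish on the open facets and then, by the radial inequality with weight 1, in the
  interior.\<close>

theorem relatively_strongly_K_stableI:
  assumes zero: "vol_int (\<lambda>x. a \<bullet> x + c) = 0"
    and lin: "\<And>i. vol_int (\<lambda>x. (1 - (a \<bullet> x + c)) * x $ i) = 0"
    and lower: "\<And>x. x \<in> \<Delta> \<Longrightarrow> -3 \<le> a \<bullet> x + c"
    and upper: "\<And>x. x \<in> \<Delta> \<Longrightarrow> 4 * (a \<bullet> x) + 5 * c < 5"
  shows "relatively_strongly_K_stable \<Delta>"
  unfolding relatively_strongly_K_stable_def
proof
  let ?L = "L_functional \<Delta> (theta \<Delta>)"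
  have th: "theta \<Delta> = (\<lambda>x. a \<bullet> x + c)" by (rule theta_eq[OF zero lin])
  have thc: "continuous_on UNIV (\<lambda>x. a \<bullet> x + c)" by (intro continuous_intros)
  note L_eq = L_functional_eq[OF _ thc, folded th]
  fix u assume "u \<in> convex_class \<Delta>"
  then have conv: "convex_on (polytope_star \<Delta>) u" and finu: "finite_boundary_integral \<Delta> u"
    by (auto simp: convex_class_def)
  have admu: "admissible u" by (rule admissible_convex[OF conv])
  have fin: "bd_nn (\<lambda>y. ennreal (u y)) < \<infinity>" using finu finite_boundary_integral_iff[OF admu] by simp
  obtain s where s: "\<And>x. x \<in> polytope_star \<Delta> \<Longrightarrow> s \<bullet> x + u 0 \<le> u x"
    using convex_on_star_supporting[OF conv] by blast
  define f where "f = (\<lambda>x. s \<bullet> x + u 0)"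
  have contf: "continuous_on S f" for S unfolding f_def by (intro continuous_intros)
  have Lf: "?L f = 0" unfolding th f_def by (rule L_functional_affine[OF zero lin])
  \<comment> \<open>Explicit coefficients match the shape of the linear-combination lemmas.\<close>
  define v where "v = (\<lambda>x. 1 * u x + (-1) * f x)"
  have v_nonneg: "0 \<le> v x" if "x \<in> polytope_star \<Delta>" for x using s[OF that] by (simp add: v_def f_def)
  have v0: "v 0 = 0" by (simp add: v_def f_def)
  have convv: "convex_on (polytope_star \<Delta>) v"
    unfolding convex_on_def
  proof (intro conjI ballI allI impI)
    show "convex (polytope_star \<Delta>)" using conv by (simp add: convex_on_def)
    fix x y p q assume xy: "x \<in> polytope_star \<Delta>" "y \<in> polytope_star \<Delta>" and pq: "0 \<le> p" "0 \<le> q" "p + q = (1::real)"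
    have "u (p *\<^sub>R x + q *\<^sub>R y) \<le> p * u x + q * u y" using conv xy pq by (simp add: convex_on_def)
    moreover have "f (p *\<^sub>R x + q *\<^sub>R y) = p * f x + q * f y"
    proof -
      have "p * u 0 + q * u 0 = u 0" using pq by (metis distrib_right mult_1)
      then show ?thesis by (simp add: f_def inner_add_right distrib_left)
    qed
    ultimately show "v (p *\<^sub>R x + q *\<^sub>R y) \<le> p * v x + q * v y" by (simp add: v_def algebra_simps)
  qed
  have admv: "admissible v" by (rule admissible_convex[OF convv])
  \<comment> \<open>\<open>finite_boundary_integral\<close> controls only the positive part of
    \<open>u\<close>; this suffices because \<open>v\<close> is at most that part plus
    \<bar>f\<bar>.\<close>
  have finv: "bd_nn (\<lambda>y. ennreal (v y)) < \<infinity>"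
    unfolding bd_nn_finite_iff
  proof (intro allI impI)
    fix F assume F: "F facet_of \<Delta>"
    let ?I = "interior (facet_dom F)"
    have mu: "(\<lambda>w. ennreal (indicator ?I w *\<^sub>R u (chart F w))) \<in> borel_measurable lborel"
      using admissible_meas[OF admu F] by (intro measurable_compose[OF _ measurable_ennreal]) (simp add: set_borel_measurable_def)
    have fi: "set_integrable lborel ?I (\<lambda>w. \<bar>f (chart F w)\<bar>)"
      using bd_integrable_continuous[of "\<lambda>x. \<bar>f x\<bar>"] contf F
      by (auto simp: bd_integrable_def intro!: continuous_intros)
    have "(\<integral>\<^sup>+w\<in>?I. ennreal (v (chart F w)) \<partial>lborel) \<le>
      (\<integral>\<^sup>+w. ennreal (indicator ?I w *\<^sub>R u (chart F w)) + ennreal (\<bar>f (chart F w)\<bar>) * indicator ?I w \<partial>lborel)"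
    proof (rule nn_integral_mono)
      fix w
      have "ennreal (u x - f x) \<le> ennreal (u x) + ennreal \<bar>f x\<bar>" for x
      proof (cases "u x \<ge> 0")
        case True
        then have "ennreal (u x) + ennreal \<bar>f x\<bar> = ennreal (u x + \<bar>f x\<bar>)" by simp
        then show ?thesis by (simp add: ennreal_leI)
      next
        case False
        then show ?thesis by (simp add: ennreal_neg ennreal_leI)
      qed
      then show "ennreal (v (chart F w)) * indicator ?I w \<le>
        ennreal (indicator ?I w *\<^sub>R u (chart F w)) + ennreal (\<bar>f (chart F w)\<bar>) * indicator ?I w"
        by (simp add: v_def indicator_def)
    qed
    also have "\<dots> = (\<integral>\<^sup>+w. ennreal (indicator ?I w *\<^sub>R u (chart F w)) \<partial>lborel) + (\<integral>\<^sup>+w\<in>?I. ennreal (\<bar>f (chart F w)\<bar>) \<partial>lborel)"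
    proof (rule nn_integral_add[OF mu])
      show "(\<lambda>w. ennreal (\<bar>f (chart F w)\<bar>) * indicator ?I w) \<in> borel_measurable lborel"
        using contf F unfolding f_def by simp
    qed
    also have "(\<integral>\<^sup>+w. ennreal (indicator ?I w *\<^sub>R u (chart F w)) \<partial>lborel) = (\<integral>\<^sup>+w\<in>?I. ennreal (u (chart F w)) \<partial>lborel)"
      by (rule nn_integral_cong) (simp add: indicator_def)
    also have "(\<integral>\<^sup>+w\<in>?I. ennreal (\<bar>f (chart F w)\<bar>) \<partial>lborel) = ennreal (LINT w:?I|lborel. \<bar>f (chart F w)\<bar>)"
      by (rule set_nn_integral_eq_set_integral[OF fi]) simp
    also have "(\<integral>\<^sup>+w\<in>?I. ennreal (u (chart F w)) \<partial>lborel) + ennreal (LINT w:?I|lborel. \<bar>f (chart F w)\<bar>) < \<infinity>"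
      using fin F unfolding bd_nn_finite_iff by auto
    finally show "(\<integral>\<^sup>+w\<in>?I. ennreal (v (chart F w)) \<partial>lborel) < \<infinity>" .
  qed
  have intv: "bd_integrable v" by (rule bd_integrableI[OF admv v_nonneg finv])
  \<comment> \<open>The boundary weight that \<open>radial_inequality\<close> attaches to the volume
    weight 3 + \<theta>, whose constant term is \<open>3 + c\<close>.\<close>
  define W where "W = (\<lambda>y. a \<bullet> y / 5 + (3 + c) / 4)"
  have contW: "continuous_on S W" for S unfolding W_def by (intro continuous_intros) auto
  have W0: "0 \<le> W x" if "x \<in> \<Delta>" for x
  proof -
    \<comment> \<open>Since \<open>c\<close> is the value of \<theta> at 0, \<open>lower\<close>
      applies to both summands.\<close>
    have "W x = (a \<bullet> x + c + 3) / 5 + (c + 3) / 20" by (simp add: W_def field_simps)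
    then show ?thesis using lower[OF that] lower[OF zero_in] by simp
  qed
  have W1: "W x < 1" if "x \<in> \<Delta>" for x
  proof -
    \<comment> \<open>The bound 5 in \<open>upper\<close> is the one for which 5/20 + 3/4 equals
      1.\<close>
    have "W x = (4 * (a \<bullet> x) + 5 * c) / 20 + 3 / 4" by (simp add: W_def field_simps)
    also have "\<dots> < 5 / 20 + 3 / 4"
      by (intro add_strict_right_mono divide_strict_right_mono upper[OF that]) simp
    finally show ?thesis by simp
  qed
  have Wv_nonneg: "0 \<le> W x * v x" and Wv_le: "W x * v x \<le> v x" if "x \<in> polytope_star \<Delta>" for x
  proof -
    have "x \<in> \<Delta>" using that star_subset by blast
    then show "0 \<le> W x * v x" using W0 v_nonneg[OF that] by simp
    show "W x * v x \<le> v x" using W1[OF \<open>x \<in> \<Delta>\<close>] v_nonneg[OF that] by (simp add: mult_left_le_one_le W0[OF \<open>x \<in> \<Delta>\<close>])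
  qed
  have admW: "admissible (\<lambda>x. W x * v x)"
    by (intro admissible_mult admv admissible_continuous contW)
  have finW: "bd_nn (\<lambda>y. ennreal (W y * v y)) < \<infinity>"
  proof (rule le_less_trans[OF bd_nn_mono finv])
    fix F w assume "F facet_of \<Delta>" "w \<in> interior (facet_dom F)"
    then show "ennreal (W (chart F w) * v (chart F w)) \<le> ennreal (v (chart F w))"
      by (intro ennreal_leI Wv_le chart_star)
  qed
  have intW: "bd_integrable (\<lambda>y. W y * v y)"
    by (rule bd_integrableI[OF admW Wv_nonneg finW])
  define g where "g = (\<lambda>x. (a \<bullet> x + (3 + c)) * v x)"
  have g_nonneg: "0 \<le> g x" if "x \<in> interior \<Delta>" for x
    using lower[of x] v_nonneg[OF interior_star[OF that]] that interior_subset[of \<Delta>] by (auto simp: g_def)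
  have g_le: "(\<integral>\<^sup>+x\<in>interior \<Delta>. ennreal (g x) \<partial>lborel) \<le> bd_nn (\<lambda>y. ennreal (W y * v y))"
    unfolding g_def W_def
    by (rule radial_inequality[OF convv v_nonneg v0]) (use lower in fastforce)+
  have contg: "continuous_on (interior \<Delta>) g"
    unfolding g_def using admv by (auto simp: admissible_def intro!: continuous_intros)
  have intg: "set_integrable lborel (interior \<Delta>) g"
    by (intro set_integrable_nonneg_finite continuous_on_set_borel_measurable_lborel open_interior contg g_nonneg)
      (use le_less_trans[OF g_le finW] in auto)
  have "ennreal (vol_int g) = (\<integral>\<^sup>+x\<in>interior \<Delta>. ennreal (g x) \<partial>lborel)"
    unfolding vol_int_def by (rule set_nn_integral_eq_set_integral[OF intg g_nonneg, symmetric])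
  also have "\<dots> \<le> ennreal (bd_int (\<lambda>y. W y * v y))"
    using g_le bd_nn_eq_bd_int(1)[OF intW Wv_nonneg] by simp
  finally have vol_le: "vol_int g \<le> bd_int (\<lambda>y. W y * v y)"
    using bd_nn_eq_bd_int(2)[OF intW Wv_nonneg] by simp
  have Lv: "?L v = bd_int v - vol_int g"
    unfolding L_eq[OF admv] by (simp add: g_def algebra_simps)
  have Luv: "?L u = ?L v"
  proof -
    have "bd_int u = bd_int (\<lambda>x. 1 * v x + 1 * f x)" by (simp add: v_def)
    also have "\<dots> = 1 * bd_int v + 1 * bd_int f"
      by (intro bd_integrable_lincomb intv bd_integrable_continuous contf)
    finally have b: "bd_int u = bd_int v + bd_int f" by simp
    have fi: "set_integrable lborel (interior \<Delta>) (\<lambda>x. (3 + (a \<bullet> x + c)) * f x)"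
      by (intro vol_integrable_continuous continuous_intros contf)
    have "vol_int (\<lambda>x. (3 + (a \<bullet> x + c)) * u x) = vol_int (\<lambda>x. 1 * g x + 1 * ((3 + (a \<bullet> x + c)) * f x))"
      by (simp add: v_def g_def algebra_simps)
    also have "\<dots> = 1 * vol_int g + 1 * vol_int (\<lambda>x. (3 + (a \<bullet> x + c)) * f x)"
      by (rule vol_int_lincomb[OF intg fi])
    finally have "?L u = ?L v + ?L f"
      by (simp add: L_eq[OF admu] Lv L_eq[OF admissible_continuous[OF contf]] b)
    then show ?thesis using Lf by simp
  qed
  define k where "k = (\<lambda>y. 1 * v y + (-1) * (W y * v y))"
  have k_nonneg: "0 \<le> k x" if "x \<in> polytope_star \<Delta>" for x using Wv_le[OF that] by (simp add: k_def)
  have intk: "bd_integrable k" and bdk: "bd_int k = bd_int v - bd_int (\<lambda>y. W y * v y)"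
    unfolding k_def using bd_integrable_lincomb[OF intv intW, of 1 "-1"] by simp_all
  have k0: "0 \<le> bd_int k" by (rule bd_nn_eq_bd_int(2)[OF intk k_nonneg])
  have L_ge: "bd_int k \<le> ?L u" using vol_le by (simp add: Luv Lv bdk)
  show "0 \<le> ?L u \<and> (?L u = 0 \<longleftrightarrow> affine_linear_on (polytope_star \<Delta>) u)"
  proof (intro conjI iffI)
    show "0 \<le> ?L u" using k0 L_ge by simp
  next
    assume "?L u = 0"
    then have "bd_int k = 0" using k0 L_ge by simp
    moreover have "admissible k" unfolding k_def by (intro admissible_lincomb admv admW)
    ultimately have kF: "k (chart F w) = 0" if "F facet_of \<Delta>" "w \<in> interior (facet_dom F)" for F w
      using bd_int_nonneg_zero[OF _ intk k_nonneg] that by blast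
    have vF: "v (chart F w) = 0" if "F facet_of \<Delta>" "w \<in> interior (facet_dom F)" for F w
    proof -
      have "chart F w \<in> \<Delta>" using chart_star[OF that] star_subset by blast
      then have "W (chart F w) < 1" by (rule W1)
      moreover have "(1 - W (chart F w)) * v (chart F w) = 0" using kF[OF that] by (simp add: k_def algebra_simps)
      ultimately show ?thesis by simp
    qed
    have "(\<integral>\<^sup>+x\<in>interior \<Delta>. ennreal ((0 \<bullet> x + 1) * v x) \<partial>lborel) \<le> bd_nn (\<lambda>y. ennreal ((0 \<bullet> y / 5 + 1 / 4) * v y))"
      by (rule radial_inequality[OF convv v_nonneg v0]) simp_all
    also have "\<dots> = bd_nn (\<lambda>y. 0)" by (rule bd_nn_cong) (simp add: vF)
    also have "\<dots> = 0" by (simp add: bd_nn_def)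
    finally have "(\<integral>\<^sup>+x\<in>interior \<Delta>. ennreal (v x) \<partial>lborel) = 0" by simp
    moreover have "(\<integral>\<^sup>+x. ennreal (indicat_real (interior \<Delta>) x * v x) \<partial>lborel) = (\<integral>\<^sup>+x\<in>interior \<Delta>. ennreal (v x) \<partial>lborel)"
      by (rule nn_integral_cong) (simp add: indicator_def)
    ultimately have vi: "v x = 0" if "x \<in> interior \<Delta>" for x
      using admv v_nonneg[OF interior_star] that
      by (intro continuous_nonneg_integral_zero_open[OF open_interior _ _ _ that]) (auto simp: admissible_def)
    have "u x = s \<bullet> x + u 0" if "x \<in> polytope_star \<Delta>" for x
    proof -
      have "v x = 0" using that by (rule star_cases) (auto simp: vi vF)
      then show ?thesis by (simp add: v_def f_def)
    qed
    then show "affine_linear_on (polytope_star \<Delta>) u" unfolding affine_linear_on_def by blast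
  next
    assume "affine_linear_on (polytope_star \<Delta>) u"
    then obtain b e where u: "\<And>x. x \<in> polytope_star \<Delta> \<Longrightarrow> u x = b \<bullet> x + e" by (auto simp: affine_linear_on_def)
    \<comment> \<open>\<open>u\<close> is affine only on \<open>polytope_star\<close>, which is all
      that the integrals see.\<close>
    have "?L u = ?L (\<lambda>x. b \<bullet> x + e)"
    proof -
      have adm: "admissible (\<lambda>x. b \<bullet> x + e)" by (intro admissible_continuous continuous_intros)
      have "bd_int u = bd_int (\<lambda>x. b \<bullet> x + e)" by (rule bd_int_cong[OF u])
      moreover have "vol_int (\<lambda>x. (3 + (a \<bullet> x + c)) * u x) = vol_int (\<lambda>x. (3 + (a \<bullet> x + c)) * (b \<bullet> x + e))"
        by (rule vol_int_cong) (simp add: u interior_star)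
      ultimately show ?thesis unfolding L_eq[OF admu] L_eq[OF adm] by simp
    qed
    then show "?L u = 0" using L_functional_affine[OF zero lin] by (simp add: th)
  qed
qed

lemma vol_int_eq:
  assumes h: "continuous_on UNIV h"
  shows "vol_int h = (LINT x:\<Delta>|lborel. h x)"
proof -
  have m: "set_borel_measurable lborel S h" if "S \<in> sets borel" for S
    using that borel_measurable_continuous_onI[OF h] by (simp add: set_borel_measurable_def)
  have "AE x in lborel. x \<notin> \<Delta> - interior \<Delta>" by (rule AE_not_in[OF frontier_null])
  then have ae: "AE x\<in>\<Delta> in lborel. x \<in> interior \<Delta>" by eventually_elim auto
  show ?thesis
    unfolding vol_int_def set_lebesgue_integral_def
  proof (rule integral_cong_AE)
    show "AE x in lborel. indicat_real (interior \<Delta>) x *\<^sub>R h x = indicat_real \<Delta> x *\<^sub>R h x"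
      using ae interior_subset[of \<Delta>] by (auto simp: indicator_def)
  qed (use m[of \<Delta>] m[of "interior \<Delta>"] closed in \<open>auto simp: set_borel_measurable_def\<close>)
qed

end

section \<open>Exact quadrature on iterated regions\<close>

text \<open>Extensional on purpose: nested quadrature produces ordinary functions, and closure rules
  bound their degree without computing a polynomial.\<close>

definition poly_le :: "nat \<Rightarrow> (real \<Rightarrow> real) \<Rightarrow> bool" where
  "poly_le n f \<longleftrightarrow> (\<exists>p. degree p \<le> n \<and> (\<forall>x. f x = poly p x))"

lemma poly_le_mono: "poly_le m f \<Longrightarrow> m \<le> n \<Longrightarrow> poly_le n f"
  unfolding poly_le_def by (metis order_trans)

lemma poly_le_const: "poly_le n (\<lambda>x. c)"
  unfolding poly_le_def by (rule exI[of _ "[:c:]"]) simp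

lemma poly_le_id: "poly_le 1 (\<lambda>x. x)"
  unfolding poly_le_def by (rule exI[of _ "[:0, 1:]"]) simp

lemma poly_le_add: "poly_le n f \<Longrightarrow> poly_le n g \<Longrightarrow> poly_le n (\<lambda>x. f x + g x)"
  unfolding poly_le_def by (metis degree_add_le poly_add)

lemma poly_le_diff: "poly_le n f \<Longrightarrow> poly_le n g \<Longrightarrow> poly_le n (\<lambda>x. f x - g x)"
  unfolding poly_le_def by (metis degree_diff_le poly_diff)

lemma poly_le_mult:
  assumes "poly_le m f" "poly_le n g"
  shows "poly_le (m + n) (\<lambda>x. f x * g x)"
proof -
  obtain p q where "degree p \<le> m" "degree q \<le> n" "\<And>x. f x = poly p x" "\<And>x. g x = poly q x"
    using assms by (auto simp: poly_le_def)
  then show ?thesis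
    unfolding poly_le_def
    by (intro exI[of _ "p * q"]) (auto intro: order_trans[OF degree_mult_le] add_mono)
qed

lemma poly_le_cmult: "poly_le n f \<Longrightarrow> poly_le n (\<lambda>x. c * f x)"
  using poly_le_mult[OF poly_le_const[of 0 c]] by simp

lemma poly_le_divide: "poly_le n f \<Longrightarrow> poly_le n (\<lambda>x. f x / c)"
  using poly_le_cmult[of n f "inverse c"] by (simp add: field_simps)

lemma poly_le_affine: "poly_le 1 X \<Longrightarrow> poly_le 1 (\<lambda>t. a + b * X t)"
  by (intro poly_le_add poly_le_const poly_le_cmult)

lemma poly_le_4E:
  assumes "poly_le 4 f"
  obtains a b c d e where "\<And>x. f x = a + b * x + c * x^2 + d * x^3 + e * x^4"
proof -
  obtain p where p: "degree p \<le> 4" "\<And>x. f x = poly p x" using assms by (auto simp: poly_le_def)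
  have "f x = (\<Sum>i\<le>4. coeff p i * x ^ i)" for x
    unfolding p(2) poly_altdef
    by (rule sum.mono_neutral_left) (use p(1) in \<open>auto intro: coeff_eq_0\<close>)
  then have "f x = coeff p 0 + coeff p 1 * x + coeff p 2 * x^2 + coeff p 3 * x^3 + coeff p 4 * x^4" for x
    by (simp add: eval_nat_numeral)
  then show thesis by (rule that)
qed

lemma poly_le_3E:
  assumes "poly_le 3 f"
  obtains a b c d where "\<And>x. f x = a + b * x + c * x^2 + d * x^3"
proof -
  obtain p where p: "degree p \<le> 3" "\<And>x. f x = poly p x" using assms by (auto simp: poly_le_def)
  have "f x = (\<Sum>i\<le>3. coeff p i * x ^ i)" for x
    unfolding p(2) poly_altdef
    by (rule sum.mono_neutral_left) (use p(1) in \<open>auto intro: coeff_eq_0\<close>)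
  then have "f x = coeff p 0 + coeff p 1 * x + coeff p 2 * x^2 + coeff p 3 * x^3" for x
    by (simp add: eval_nat_numeral)
  then show thesis by (rule that)
qed

section \<open>Newton-Cotes rules and their exactness\<close>

definition simpson :: "(real \<Rightarrow> real) \<Rightarrow> real \<Rightarrow> real \<Rightarrow> real" where
  "simpson f a b = (b - a) * (f a + 4 * f ((a + b) / 2) + f b) / 6"

text \<open>The closed five-point Newton-Cotes rule, for the outermost integration, where the degree
  can reach 4 and Simpson's rule is no longer exact.\<close>

definition boole :: "(real \<Rightarrow> real) \<Rightarrow> real \<Rightarrow> real \<Rightarrow> real" where
  "boole f a b = (b - a) * (7 * f a + 32 * f ((3 * a + b) / 4) + 12 * f ((a + b) / 2) + 32 * f ((a + 3 * b) / 4) + 7 * f b) / 90"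

lemma set_integral_quartic:
  fixes a b :: real
  assumes ab: "a \<le> b"
  shows "(LINT x:{a..b}|lborel. c0 + c1 * x + c2 * x^2 + c3 * x^3 + c4 * x^4) =
    c0 * (b - a) + c1 * (b^2 - a^2) / 2 + c2 * (b^3 - a^3) / 3 + c3 * (b^4 - a^4) / 4 + c4 * (b^5 - a^5) / 5"
proof -
  let ?f = "\<lambda>x. c0 + c1 * x + c2 * x^2 + c3 * x^3 + c4 * x^4"
  let ?F = "\<lambda>x. c0 * x + c1 / 2 * x^2 + c2 / 3 * x^3 + c3 / 4 * x^4 + c4 / 5 * x^5"
  have "(\<integral>x. ?f x * indicator {a..b} x \<partial>lborel) = ?F b - ?F a"
    by (rule integral_FTC_Icc_real[OF ab]) (auto intro!: derivative_eq_intros simp: field_simps)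
  then show ?thesis by (simp add: set_lebesgue_integral_def mult.commute field_simps)
qed

lemma simpson_exact:
  assumes "poly_le 3 f" and ab: "a \<le> b"
  shows "(LINT x:{a..b}|lborel. f x) = simpson f a b"
proof -
  obtain c0 c1 c2 c3 where f: "\<And>x. f x = c0 + c1 * x + c2 * x^2 + c3 * x^3" using poly_le_3E[OF assms(1)] by blast
  have "(LINT x:{a..b}|lborel. f x) = (LINT x:{a..b}|lborel. c0 + c1 * x + c2 * x^2 + c3 * x^3 + 0 * x^4)"
    by (simp add: f)
  also have "\<dots> = simpson f a b"
    unfolding set_integral_quartic[OF ab] simpson_def f by (simp add: field_simps power_numeral_reduce)
  finally show ?thesis .
qed

lemma boole_exact:
  assumes "poly_le 4 f" and ab: "a \<le> b"
  shows "(LINT x:{a..b}|lborel. f x) = boole f a b"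
proof -
  obtain c0 c1 c2 c3 c4 where f: "\<And>x. f x = c0 + c1 * x + c2 * x^2 + c3 * x^3 + c4 * x^4"
    using poly_le_4E[OF assms(1)] by blast
  show ?thesis
    unfolding f set_integral_quartic[OF ab] boole_def by (simp add: field_simps power_numeral_reduce)
qed

section \<open>Iterated integration over regions between graphs\<close>

definition pt :: "3 \<Rightarrow> 3 \<Rightarrow> 3 \<Rightarrow> real \<Rightarrow> real \<Rightarrow> real \<Rightarrow> real^3" where
  "pt i j k x y z = x *\<^sub>R axis i 1 + y *\<^sub>R axis j 1 + z *\<^sub>R axis k 1"

lemma pt_123: "pt 1 2 3 x y z = vector [x, y, z]"
  by (simp add: pt_def vec_eq_iff forall_3 axis_def)

lemma pt_321: "pt 3 2 1 x y z = vector [z, y, x]"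
  by (simp add: pt_def vec_eq_iff forall_3 axis_def)

lemma UNIV_3_distinct:
  fixes i j k :: 3
  assumes "distinct [i, j, k]"
  shows "UNIV = {i, j, k}"
proof (rule card_seteq[symmetric])
  show "card (UNIV :: 3 set) \<le> card {i, j, k}" using assms by simp
qed simp_all

lemma set_integral_fibre:
  fixes S :: "(real \<times> 'b::euclidean_space) set" and f :: "real \<times> 'b \<Rightarrow> real"
  assumes S: "compact S" and f: "continuous_on UNIV f"
  shows "(LINT v:S|lborel. f v) = (LINT x|lborel. (LINT y:{y. (x, y) \<in> S}|lborel. f (x, y)))"
proof -
  have "integrable lborel (\<lambda>v. indicat_real S v *\<^sub>R f v)"
    by (rule borel_integrable_compact[OF S continuous_on_subset[OF f]]) simp
  then have "integrable (lborel \<Otimes>\<^sub>M lborel) (\<lambda>v. indicat_real S v *\<^sub>R f v)" by (simp add: lborel_prod)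
  from lborel_pair.integral_fst'[OF this]
  have "(LINT v:S|lborel. f v) = (LINT x|lborel. (LINT y|lborel. indicat_real S (x, y) *\<^sub>R f (x, y)))"
    by (simp add: lborel_prod set_lebesgue_integral_def)
  also have "\<dots> = (LINT x|lborel. (LINT y:{y. (x, y) \<in> S}|lborel. f (x, y)))"
    by (simp add: set_lebesgue_integral_def indicator_def)
  finally show ?thesis .
qed

text \<open>Coordinate \<open>i\<close> is integrated last and \<open>k\<close> first. Leaving the
  order open lets each polytope be described by affine bounds with at most one cut.\<close>

definition piece :: "3 \<Rightarrow> 3 \<Rightarrow> 3 \<Rightarrow> real \<Rightarrow> real \<Rightarrow> (real \<Rightarrow> real) \<Rightarrow> (real \<Rightarrow> real) \<Rightarrow>
    (real \<Rightarrow> real \<Rightarrow> real) \<Rightarrow> (real \<Rightarrow> real \<Rightarrow> real) \<Rightarrow> (real^3) set" where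
  "piece i j k a b p q r s = {v. a \<le> v $ i \<and> v $ i \<le> b \<and> p (v $ i) \<le> v $ j \<and> v $ j \<le> q (v $ i) \<and>
     r (v $ i) (v $ j) \<le> v $ k \<and> v $ k \<le> s (v $ i) (v $ j)}"

lemma closed_piece:
  assumes p: "continuous_on UNIV p" and q: "continuous_on UNIV q"
    and r: "continuous_on UNIV (\<lambda>(x, y). r x y)" and s: "continuous_on UNIV (\<lambda>(x, y). s x y)"
  shows "closed (piece i j k a b p q r s)"
proof -
  have "piece i j k a b p q r s = {v. a \<le> v $ i} \<inter> {v. v $ i \<le> b} \<inter> {v. p (v $ i) \<le> v $ j} \<inter> {v. v $ j \<le> q (v $ i)} \<inter>
      {v. (\<lambda>(x, y). r x y) (v $ i, v $ j) \<le> v $ k} \<inter> {v. v $ k \<le> (\<lambda>(x, y). s x y) (v $ i, v $ j)}"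
    by (auto simp: piece_def)
  also have "closed \<dots>"
    by (intro closed_Int closed_Collect_le continuous_intros continuous_on_compose2[OF p] continuous_on_compose2[OF q]
        continuous_on_compose2[OF r] continuous_on_compose2[OF s]) auto
  finally show ?thesis .
qed

text \<open>The relabelling \<open>T\<close> is a linear isometry from
  \<open>real \<times> real \<times> real\<close>, so it preserves Lebesgue measure. Fubini is then
  applied twice, with compactness supplying integrability.\<close>

lemma set_integral_piece:
  fixes f :: "real^3 \<Rightarrow> real"
  assumes ijk: "distinct [i, j, k]" and bdd: "bounded (piece i j k a b p q r s)"
    and f: "continuous_on UNIV f" and p: "continuous_on UNIV p" and q: "continuous_on UNIV q"
    and r: "continuous_on UNIV (\<lambda>(x, y). r x y)" and s: "continuous_on UNIV (\<lambda>(x, y). s x y)"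
  shows "(LINT v:piece i j k a b p q r s|lborel. f v) =
    (LINT x:{a..b}|lborel. (LINT y:{p x..q x}|lborel. (LINT z:{r x y..s x y}|lborel. f (pt i j k x y z))))"
proof -
  let ?P = "piece i j k a b p q r s"
  define T where "T = (\<lambda>(x, y, z). pt i j k x y z)"
  have co: "T (x, y, z) $ i = x" "T (x, y, z) $ j = y" "T (x, y, z) $ k = z" for x y z
    using ijk by (auto simp: T_def pt_def axis_def)
  have linT: "linear T"
    unfolding T_def pt_def by (rule linearI) (auto simp: algebra_simps)
  have nT: "norm (T v) = norm v" for v
  proof -
    have "T v \<bullet> T v = (\<Sum>l\<in>{i, j, k}. T v $ l * T v $ l)"
      using UNIV_3_distinct[OF ijk] by (simp add: inner_vec_def)
    also have "\<dots> = v \<bullet> v" using ijk by (cases v) (simp add: co)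
    finally show ?thesis by (simp add: norm_eq_sqrt_inner)
  qed
  have dT: "distr lborel borel T = lborel" by (rule distr_lborel_isometry[OF linT nT]) simp
  have cT: "continuous_on A T" for A
    using linT by (intro linear_continuous_on) (simp add: linear_conv_bounded_linear)
  have [measurable]: "T \<in> borel_measurable borel" using cT by (rule borel_measurable_continuous_onI)
  have clP: "closed ?P" by (rule closed_piece[OF p q r s])
  define S where "S = T -` ?P"
  have "closed S" unfolding S_def by (rule closed_vimage[OF clP cT])
  moreover obtain B where B: "\<And>x. x \<in> ?P \<Longrightarrow> norm x \<le> B" using bdd by (auto simp: bounded_iff)
  have "bounded S"
    unfolding bounded_iff by (rule exI[of _ B]) (use B nT in \<open>force simp: S_def\<close>)
  ultimately have S: "compact S" by (simp add: compact_eq_bounded_closed)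
  have S_iff: "(x, y, z) \<in> S \<longleftrightarrow> x \<in> {a..b} \<and> y \<in> {p x..q x} \<and> z \<in> {r x y..s x y}" for x y z
    by (auto simp: S_def piece_def co)
  have fT: "continuous_on UNIV (\<lambda>v. f (T v))" by (rule continuous_on_compose2[OF f cT]) simp
  have "(LINT v:?P|lborel. f v) = (LINT v|distr lborel borel T. indicat_real ?P v *\<^sub>R f v)"
    by (simp add: dT set_lebesgue_integral_def)
  also have "\<dots> = (LINT v|lborel. indicat_real ?P (T v) *\<^sub>R f (T v))"
    using clP borel_measurable_continuous_onI[OF f] by (intro integral_distr) auto
  also have "\<dots> = (LINT v:S|lborel. f (T v))"
    by (simp add: set_lebesgue_integral_def S_def indicator_def)
  also have "\<dots> = (LINT x|lborel. (LINT w:{w. (x, w) \<in> S}|lborel. f (T (x, w))))"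
    by (rule set_integral_fibre[OF S fT])
  also have "\<dots> = (LINT x|lborel. (LINT y|lborel. (LINT z:{z. (x, y, z) \<in> S}|lborel. f (T (x, y, z)))))"
  proof (rule Bochner_Integration.integral_cong[OF refl])
    fix x
    \<comment> \<open>A slice is a projection of a compact set, so the second application of Fubini
      is again over a compact set.\<close>
    have "compact {w. (x, w) \<in> S}"
    proof -
      have "{w. (x, w) \<in> S} = snd ` (S \<inter> {x} \<times> UNIV)"
        by (intro equalityI subsetI, rule_tac x = "(x, xa)" in image_eqI) auto
      moreover have "compact (S \<inter> {x} \<times> UNIV)" by (rule compact_Int_closed[OF S]) (simp add: closed_Times)
      moreover have "continuous_on (S \<inter> {x} \<times> UNIV) snd" by (intro continuous_intros)
      ultimately show ?thesis using compact_continuous_image by metis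
    qed
    moreover have "continuous_on UNIV (\<lambda>w. f (T (x, w)))"
      by (rule continuous_on_compose2[OF fT]) (auto intro!: continuous_intros)
    ultimately show "(LINT w:{w. (x, w) \<in> S}|lborel. f (T (x, w))) =
       (LINT y|lborel. (LINT z:{z. (x, y, z) \<in> S}|lborel. f (T (x, y, z))))"
      by (subst set_integral_fibre) simp_all
  qed
  also have "\<dots> = (LINT x:{a..b}|lborel. (LINT y:{p x..q x}|lborel. (LINT z:{r x y..s x y}|lborel. f (T (x, y, z)))))"
  proof -
    have ind: "indicat_real {z. (x, y, z) \<in> S} z *\<^sub>R f (T (x, y, z)) = indicat_real {a..b} x *\<^sub>R
        (indicat_real {p x..q x} y *\<^sub>R (indicat_real {r x y..s x y} z *\<^sub>R f (T (x, y, z))))" for x y z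
      by (auto simp: indicator_def S_iff)
    show ?thesis unfolding set_lebesgue_integral_def ind by simp
  qed
  finally show ?thesis by (simp add: T_def)
qed

text \<open>
  Every integration between affine bounds raises the total degree by one: a quadratic integrand
  has degree 2, 3 and 4 in the three successive variables of integration.
\<close>

lemma set_integral_piece_quadrature:
  fixes f :: "real^3 \<Rightarrow> real"
  assumes f: "f = (\<lambda>v. (m \<bullet> v + m0) * (n \<bullet> v + n0))"
    and p: "p = (\<lambda>x. p0 + p1 * x)" and q: "q = (\<lambda>x. q0 + q1 * x)"
    and r: "r = (\<lambda>x y. r0 + r1 * x + r2 * y)" and s: "s = (\<lambda>x y. s0 + s1 * x + s2 * y)"
    and ijk: "distinct [i, j, k]" and bdd: "bounded (piece i j k a b p q r s)" and ab: "a \<le> b"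
    and pq: "\<And>x. a \<le> x \<Longrightarrow> x \<le> b \<Longrightarrow> p x \<le> q x"
    and rs: "\<And>x y. a \<le> x \<Longrightarrow> x \<le> b \<Longrightarrow> p x \<le> y \<Longrightarrow> y \<le> q x \<Longrightarrow> r x y \<le> s x y"
  shows "(LINT v:piece i j k a b p q r s|lborel. f v) =
    boole (\<lambda>x. simpson (\<lambda>y. simpson (\<lambda>z. f (pt i j k x y z)) (r x y) (s x y)) (p x) (q x)) a b"
proof -
  let ?G = "\<lambda>x y. simpson (\<lambda>z. f (pt i j k x y z)) (r x y) (s x y)"
  have aff: "poly_le 1 (\<lambda>t. m \<bullet> pt i j k (X t) (Y t) (Z t) + m0)"
    if "poly_le 1 X" "poly_le 1 Y" "poly_le 1 Z" for X Y Z m m0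
    unfolding pt_def inner_add_right inner_scaleR_right
    by (intro poly_le_add poly_le_const; subst mult.commute; rule poly_le_cmult; rule that)
  have p2: "poly_le 2 (\<lambda>t. f (pt i j k (X t) (Y t) (Z t)))"
    if "poly_le 1 X" "poly_le 1 Y" "poly_le 1 Z" for X Y Z
    using poly_le_mult[OF aff[OF that] aff[OF that]] unfolding f by (simp add: numeral_2_eq_2)
  have rp: "poly_le 1 (\<lambda>t. r (X t) (Y t))" "poly_le 1 (\<lambda>t. s (X t) (Y t))" if "poly_le 1 X" "poly_le 1 Y" for X Y
    unfolding r s by (intro poly_le_add poly_le_const poly_le_cmult that)+
  \<comment> \<open>\<open>X\<close> and \<open>Y\<close> are arbitrary affine functions because the
    inner rule is used along \<open>y = t\<close> with \<open>x\<close> fixed, and later along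
    \<open>y = p x\<close>, \<open>y = q x\<close> and their mean with \<open>x\<close>
    varying.\<close>
  have p3: "poly_le 3 (\<lambda>t. ?G (X t) (Y t))" if XY: "poly_le 1 X" "poly_le 1 Y" for X Y
  proof -
    have "poly_le (1 + 2) (\<lambda>t. (s (X t) (Y t) - r (X t) (Y t)) * (f (pt i j k (X t) (Y t) (r (X t) (Y t))) +
        4 * f (pt i j k (X t) (Y t) ((r (X t) (Y t) + s (X t) (Y t)) / 2)) + f (pt i j k (X t) (Y t) (s (X t) (Y t)))))"
      by (intro poly_le_mult poly_le_add poly_le_diff poly_le_cmult poly_le_divide p2 rp XY)
    from poly_le_mono[OF this, of 3] show ?thesis unfolding simpson_def by (intro poly_le_divide) simp
  qed
  have pp: "poly_le 1 p" "poly_le 1 q" unfolding p q by (intro poly_le_affine poly_le_id)+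
  have p4: "poly_le 4 (\<lambda>x. simpson (?G x) (p x) (q x))"
  proof -
    have "poly_le (1 + 3) (\<lambda>x. (q x - p x) * (?G x (p x) + 4 * ?G x ((p x + q x) / 2) + ?G x (q x)))"
      by (intro poly_le_mult poly_le_add poly_le_diff poly_le_cmult poly_le_divide p3 pp poly_le_id)
    from poly_le_mono[OF this, of 4] show ?thesis unfolding simpson_def[of "?G _"] by (intro poly_le_divide) simp
  qed
  have "(LINT v:piece i j k a b p q r s|lborel. f v) =
    (LINT x:{a..b}|lborel. (LINT y:{p x..q x}|lborel. (LINT z:{r x y..s x y}|lborel. f (pt i j k x y z))))"
    by (rule set_integral_piece[OF ijk bdd])
      (auto simp: f p q r s case_prod_unfold intro!: continuous_intros)
  also have "\<dots> = (LINT x:{a..b}|lborel. (LINT y:{p x..q x}|lborel. ?G x y))"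
  proof (intro set_lebesgue_integral_cong allI impI)
    fix x y assume "x \<in> {a..b}" "y \<in> {p x..q x}"
    then have "r x y \<le> s x y" using rs by auto
    then show "(LINT z:{r x y..s x y}|lborel. f (pt i j k x y z)) = ?G x y"
      by (rule simpson_exact[rotated]) (rule poly_le_mono[OF p2[of "\<lambda>_. x" "\<lambda>_. y" "\<lambda>t. t", OF poly_le_const poly_le_const poly_le_id]], simp)
  qed auto
  also have "\<dots> = (LINT x:{a..b}|lborel. simpson (?G x) (p x) (q x))"
  proof (intro set_lebesgue_integral_cong allI impI)
    fix x assume "x \<in> {a..b}"
    then show "(LINT y:{p x..q x}|lborel. ?G x y) = simpson (?G x) (p x) (q x)"
      by (intro simpson_exact p3[of "\<lambda>_. x" "\<lambda>t. t", OF poly_le_const poly_le_id] pq) auto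
  qed auto
  also have "\<dots> = boole (\<lambda>x. simpson (?G x) (p x) (q x)) a b" by (rule boole_exact[OF p4 ab])
  finally show ?thesis .
qed

section \<open>Inclusion of a region in a convex set\<close>

lemma convex_affine_between:
  fixes u v :: "'a::real_vector"
  assumes C: "convex C" and ends: "u + c *\<^sub>R v \<in> C" "u + d *\<^sub>R v \<in> C" and w: "c \<le> w" "w \<le> d"
  shows "u + w *\<^sub>R v \<in> C"
proof (cases "c = d")
  case False
  then have cd: "c < d" using w by simp
  define t where "t = (w - c) / (d - c)"
  have t: "0 \<le> t" "t \<le> 1" using w cd by (simp_all add: t_def)
  have "t * (d - c) = w - c" using cd by (simp add: t_def)
  then have wt: "w = (1 - t) * c + t * d" by (simp add: algebra_simps)
  have "(1 - t) *\<^sub>R (u + c *\<^sub>R v) + t *\<^sub>R (u + d *\<^sub>R v) \<in> C"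
    using t by (intro convexD[OF C ends]) auto
  also have "(1 - t) *\<^sub>R (u + c *\<^sub>R v) + t *\<^sub>R (u + d *\<^sub>R v) = u + ((1 - t) * c + t * d) *\<^sub>R v"
    by (simp add: algebra_simps)
  finally show ?thesis by (simp add: wt[symmetric])
qed (use ends w in auto)

text \<open>All bounds are affine, so edges, faces and finally the whole region are swept out by
  segments in the directions of \<open>x\<close>, \<open>y\<close> and \<open>z\<close>, and the
  eight corners decide. Corners may coincide where two bounds meet.\<close>

lemma piece_subset_convex:
  assumes C: "convex C" and ijk: "distinct [i, j, k]"
    and p: "p = (\<lambda>x. p0 + p1 * x)" and q: "q = (\<lambda>x. q0 + q1 * x)"
    and r: "r = (\<lambda>x y. r0 + r1 * x + r2 * y)" and s: "s = (\<lambda>x y. s0 + s1 * x + s2 * y)"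
    and corners: "\<forall>x\<in>{a, b}. \<forall>y\<in>{p x, q x}. \<forall>z\<in>{r x y, s x y}. pt i j k x y z \<in> C"
  shows "piece i j k a b p q r s \<subseteq> C"
proof
  let ?e = "\<lambda>l. axis l (1::real) :: real^3"
  have x_step: "pt i j k x (y0 + y1 * x) (z0 + z1 * x) \<in> C"
    if "pt i j k a (y0 + y1 * a) (z0 + z1 * a) \<in> C" "pt i j k b (y0 + y1 * b) (z0 + z1 * b) \<in> C" "a \<le> x" "x \<le> b"
    for x y0 y1 z0 z1
  proof -
    have e: "pt i j k x (y0 + y1 * x) (z0 + z1 * x) = pt i j k 0 y0 z0 + x *\<^sub>R pt i j k 1 y1 z1" for x
      by (simp add: pt_def algebra_simps)
    show ?thesis using convex_affine_between[OF C, of "pt i j k 0 y0 z0" a "pt i j k 1 y1 z1" b x] that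
      by (simp add: e)
  qed
  have y_step: "pt i j k x y (z0 + z2 * y) \<in> C"
    if "pt i j k x c (z0 + z2 * c) \<in> C" "pt i j k x d (z0 + z2 * d) \<in> C" "c \<le> y" "y \<le> d" for x y c d z0 z2
  proof -
    have e: "pt i j k x y (z0 + z2 * y) = pt i j k x 0 z0 + y *\<^sub>R pt i j k 0 1 z2" for y
      by (simp add: pt_def algebra_simps)
    show ?thesis using convex_affine_between[OF C, of "pt i j k x 0 z0" c "pt i j k 0 1 z2" d y] that
      by (simp add: e)
  qed
  have z_step: "pt i j k x y z \<in> C" if "pt i j k x y c \<in> C" "pt i j k x y d \<in> C" "c \<le> z" "z \<le> d" for x y z c d
  proof -
    have e: "pt i j k x y z = pt i j k x y 0 + z *\<^sub>R ?e k" for z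
      by (simp add: pt_def algebra_simps)
    show ?thesis using convex_affine_between[OF C, of "pt i j k x y 0" c "?e k" d z] that
      unfolding e[of c] e[of d] e[of z] by blast
  qed
  have edge: "pt i j k x (y0 + y1 * x) (z0 + z1 * x + z2 * (y0 + y1 * x)) \<in> C"
    if "pt i j k a (y0 + y1 * a) (z0 + z1 * a + z2 * (y0 + y1 * a)) \<in> C"
      "pt i j k b (y0 + y1 * b) (z0 + z1 * b + z2 * (y0 + y1 * b)) \<in> C" "a \<le> x" "x \<le> b" for x y0 y1 z0 z1 z2
    using x_step[of y0 y1 "z0 + z2 * y0" "z1 + z2 * y1" x] that by (simp add: algebra_simps)
  have face: "pt i j k x y (z0 + z1 * x + z2 * y) \<in> C"
    if "pt i j k x (p x) (z0 + z1 * x + z2 * p x) \<in> C" "pt i j k x (q x) (z0 + z1 * x + z2 * q x) \<in> C"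
      "p x \<le> y" "y \<le> q x" for x y z0 z1 z2
    using y_step[of x "p x" "z0 + z1 * x" z2 "q x" y] that by simp
  fix v assume v: "v \<in> piece i j k a b p q r s"
  define x y z where "x = v $ i" and "y = v $ j" and "z = v $ k"
  have vp: "v = pt i j k x y z"
  proof -
    have "v $ l = pt i j k x y z $ l" for l
    proof -
      have "l \<in> {i, j, k}" using UNIV_3_distinct[OF ijk] by blast
      then show ?thesis using ijk by (auto simp: pt_def axis_def x_def y_def z_def)
    qed
    then show ?thesis by (simp add: vec_eq_iff)
  qed
  have b: "a \<le> x" "x \<le> b" "p x \<le> y" "y \<le> q x" "r x y \<le> z" "z \<le> s x y"
    using v by (auto simp: piece_def x_def y_def z_def)
  have "pt i j k x y (r x y) \<in> C"
    unfolding r by (rule face; (rule b)?; unfold p q; rule edge) (use corners b in \<open>simp_all add: p q r s\<close>)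
  moreover have "pt i j k x y (s x y) \<in> C"
    unfolding s by (rule face; (rule b)?; unfold p q; rule edge) (use corners b in \<open>simp_all add: p q r s\<close>)
  ultimately show "v \<in> C" unfolding vp using b(5,6) by (rule z_step)
qed

section \<open>Numerical description of the polytopes\<close>

lemma primitive_vector:
  assumes "gcd a (gcd b c) = 1"
  shows "primitive_vec (vector [of_int a, of_int b, of_int c])"
proof -
  define m where "m = (\<lambda>i::3. if i = 1 then a else if i = 2 then b else c)"
  have "range m = {a, b, c}" unfolding UNIV_3 by (simp add: m_def insert_commute)
  then have "Gcd (range m) = 1" using assms by simp
  moreover have "(vector [of_int a, of_int b, of_int c] :: real^3) = (\<chi> i. of_int (m i))"
    by (simp add: vec_eq_iff forall_3 m_def)
  ultimately show ?thesis unfolding primitive_vec_def by blast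
qed

text \<open>The region is encoded by the coefficients of its affine bounds, so that side conditions
  become statements about numerals.\<close>

definition affine_piece where
  "affine_piece i j k a b p0 p1 q0 q1 r0 r1 r2 s0 s1 s2 =
     piece i j k a b (\<lambda>x. p0 + p1 * x) (\<lambda>x. q0 + q1 * x)
       (\<lambda>x y. r0 + r1 * x + r2 * y) (\<lambda>x y. s0 + s1 * x + s2 * y)"

lemma affine_piece_iff:
  "v \<in> affine_piece i j k a b p0 p1 q0 q1 r0 r1 r2 s0 s1 s2 \<longleftrightarrow>
     a \<le> v $ i \<and> v $ i \<le> b \<and> p0 + p1 * v $ i \<le> v $ j \<and> v $ j \<le> q0 + q1 * v $ i \<and>
     r0 + r1 * v $ i + r2 * v $ j \<le> v $ k \<and> v $ k \<le> s0 + s1 * v $ i + s2 * v $ j"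
  by (simp add: affine_piece_def piece_def)

text \<open>Where bounds cross, a quadrature rule would return a signed value while the integral
  over the empty interval is 0; ordered bounds exclude this.\<close>

definition affine_piece_wf :: "real \<Rightarrow> real \<Rightarrow> real \<Rightarrow> real \<Rightarrow> real \<Rightarrow> real \<Rightarrow> real \<Rightarrow> real \<Rightarrow> real \<Rightarrow>
    real \<Rightarrow> real \<Rightarrow> real \<Rightarrow> bool" where
  "affine_piece_wf a b p0 p1 q0 q1 r0 r1 r2 s0 s1 s2 \<longleftrightarrow> a \<le> b \<and>
     (\<forall>x. a \<le> x \<longrightarrow> x \<le> b \<longrightarrow> p0 + p1 * x \<le> q0 + q1 * x \<and>
       (\<forall>y. p0 + p1 * x \<le> y \<longrightarrow> y \<le> q0 + q1 * x \<longrightarrow> r0 + r1 * x + r2 * y \<le> s0 + s1 * x + s2 * y))"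

lemma affine_piece_subset_convex:
  assumes "convex C" "distinct [i, j, k]"
    and "\<forall>x\<in>{a, b}. \<forall>y\<in>{p0 + p1 * x, q0 + q1 * x}. \<forall>z\<in>{r0 + r1 * x + r2 * y, s0 + s1 * x + s2 * y}. pt i j k x y z \<in> C"
  shows "affine_piece i j k a b p0 p1 q0 q1 r0 r1 r2 s0 s1 s2 \<subseteq> C"
  unfolding affine_piece_def
  by (rule piece_subset_convex[OF assms(1,2) refl refl refl refl]) (rule assms(3))

lemma affine_piece_quadrature:
  assumes ijk: "distinct [i, j, k]"
    and bdd: "bounded (affine_piece i j k a b p0 p1 q0 q1 r0 r1 r2 s0 s1 s2)"
    and wf: "affine_piece_wf a b p0 p1 q0 q1 r0 r1 r2 s0 s1 s2"
  shows "(LINT v:affine_piece i j k a b p0 p1 q0 q1 r0 r1 r2 s0 s1 s2|lborel. (m \<bullet> v + m0) * (n \<bullet> v + n0)) =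
    boole (\<lambda>x. simpson (\<lambda>y. simpson (\<lambda>z. (m \<bullet> pt i j k x y z + m0) * (n \<bullet> pt i j k x y z + n0))
      (r0 + r1 * x + r2 * y) (s0 + s1 * x + s2 * y)) (p0 + p1 * x) (q0 + q1 * x)) a b"
  unfolding affine_piece_def
  by (rule set_integral_piece_quadrature[OF refl refl refl refl refl ijk bdd[unfolded affine_piece_def]])
    (use wf in \<open>auto simp: affine_piece_wf_def\<close>)

lemma inner_vector_3: "vector [a, b, c] \<bullet> (x :: real^3) = a * x $ 1 + b * x $ 2 + c * x $ 3"
  by (simp add: inner_vec_def sum_3)

text \<open>Serves corners that are not vertices: cutting a polytope by a plane can create new
  corners at midpoints of edges.\<close>

lemma convex_midpoint_vector_3:
  assumes "convex C" "vector [a, b, c] \<in> C" "vector [a', b', c'] \<in> (C :: (real^3) set)"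
  shows "vector [(a + a') / 2, (b + b') / 2, (c + c') / 2] \<in> C"
proof -
  have "(1/2) *\<^sub>R vector [a, b, c] + (1/2) *\<^sub>R vector [a', b', c'] \<in> C"
    by (rule convexD[OF assms]) simp_all
  moreover have "(1/2) *\<^sub>R vector [a, b, c] + (1/2) *\<^sub>R vector [a', b', c'] =
      (vector [(a + a') / 2, (b + b') / 2, (c + c') / 2] :: real^3)"
    by (simp add: vec_eq_iff forall_3 add_divide_distrib)
  ultimately show ?thesis by simp
qed

text \<open>
  Used as congruence rules, these make the simplifier evaluate the bounds before it expands the
  rule, so that a nested quadrature is computed on numerals only.
\<close>

lemma simpson_weak_cong: "a = a' \<Longrightarrow> b = b' \<Longrightarrow> simpson f a b = simpson f a' b'"
  and boole_weak_cong: "a = a' \<Longrightarrow> b = b' \<Longrightarrow> boole f a b = boole f a' b'"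
  by simp_all

lemma distinct_123: "distinct [1, 2, 3 :: 3]" and distinct_321: "distinct [3, 2, 1 :: 3]"
  by simp_all

lemma closed_affine_piece: "closed (affine_piece i j k a b p0 p1 q0 q1 r0 r1 r2 s0 s1 s2)"
  unfolding affine_piece_def by (rule closed_piece) (auto simp: case_prod_unfold intro!: continuous_intros)

text \<open>The two regions meet only where coordinate \<open>i\<close> equals \<open>c\<close>,
  which is a plane and hence a null set.\<close>

lemma set_integral_affine_piece_Un:
  assumes "bounded (affine_piece i j k a c p0 p1 q0 q1 r0 r1 r2 s0 s1 s2)"
    and "bounded (affine_piece i j k c b p0' p1' q0' q1' r0' r1' r2' s0' s1' s2')"
  shows "(LINT v:affine_piece i j k a c p0 p1 q0 q1 r0 r1 r2 s0 s1 s2 \<union> affine_piece i j k c b p0' p1' q0' q1' r0' r1' r2' s0' s1' s2'|lborel. (m \<bullet> v + m0) * (n \<bullet> v + n0)) =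
    (LINT v:affine_piece i j k a c p0 p1 q0 q1 r0 r1 r2 s0 s1 s2|lborel. (m \<bullet> v + m0) * (n \<bullet> v + n0)) + (LINT v:affine_piece i j k c b p0' p1' q0' q1' r0' r1' r2' s0' s1' s2'|lborel. (m \<bullet> v + m0) * (n \<bullet> v + n0))"
proof (rule set_integral_Un_AE)
  let ?P = "affine_piece i j k a c p0 p1 q0 q1 r0 r1 r2 s0 s1 s2"
  let ?P' = "affine_piece i j k c b p0' p1' q0' q1' r0' r1' r2' s0' s1' s2'"
  have "{v :: real^3. axis i 1 \<bullet> v = c} \<in> null_sets lborel"
    by (intro null_sets_lborelI negligible_hyperplane) (auto simp: closed_hyperplane axis_eq_0_iff)
  then have "AE v in lborel. v \<notin> {v :: real^3. axis i 1 \<bullet> v = c}" by (rule AE_not_in)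
  then show "AE v in lborel. \<not> (v \<in> ?P \<and> v \<in> ?P')"
    by eventually_elim (auto simp: affine_piece_iff inner_axis' )
  have int: "set_integrable lborel S (\<lambda>v. (m \<bullet> v + m0) * (n \<bullet> v + n0))" if "bounded S" "closed S" for S :: "(real^3) set"
    unfolding set_integrable_def using that
    by (intro borel_integrable_compact) (auto simp: compact_eq_bounded_closed intro!: continuous_intros)
  show "set_integrable lborel ?P (\<lambda>v. (m \<bullet> v + m0) * (n \<bullet> v + n0))"
    "set_integrable lborel ?P' (\<lambda>v. (m \<bullet> v + m0) * (n \<bullet> v + n0))"
    using assms closed_affine_piece by (auto intro!: int)
qed (auto intro: borel_closed closed_affine_piece)

text \<open>The inclusions run in a cycle from the hull to the halfspaces, to \<open>P\<close>, and
  back to the hull. All three sets are thus identified by checks at vertices and corners and by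
  linear arithmetic.\<close>

lemma convex_hull_eq_halfspaces:
  fixes V N :: "(real^3) set"
  assumes VN: "\<forall>v\<in>V. \<forall>l\<in>N. l \<bullet> v \<le> 1" and cover: "\<And>x. (\<forall>l\<in>N. l \<bullet> x \<le> 1) \<Longrightarrow> x \<in> P"
    and P: "P \<subseteq> convex hull V"
  shows "convex hull V = {x. \<forall>l\<in>N. l \<bullet> x \<le> 1}" "convex hull V = P"
proof -
  have "convex {x. \<forall>l\<in>N. l \<bullet> x \<le> 1}"
    by (auto simp: convex_def inner_add_right intro!: convex_bound_le)
  then have "convex hull V \<subseteq> {x. \<forall>l\<in>N. l \<bullet> x \<le> 1}" using VN by (intro hull_minimal) auto
  then show "convex hull V = {x. \<forall>l\<in>N. l \<bullet> x \<le> 1}" "convex hull V = P" using cover P by blast+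
qed

text \<open>
  Here \<open>\<theta> x = (\<alpha> \<bullet> x + \<gamma>) / \<delta>\<close>. The integral data \<open>\<alpha>\<close>, \<open>\<gamma>\<close>, \<open>\<delta>\<close> supplied for each polytope below solve
  the linear system \<open>m0\<close>--\<open>m3\<close>, whose coefficients are the moments of order at most two. The dummy
  factor \<open>vector [0, 0, 0] \<bullet> v + 1\<close> brings all four integrands into the shape of the quadrature lemma.
\<close>

lemma stable_by_moments:
  fixes V N P :: "(real^3) set" and \<alpha> :: "real^3"
  assumes fin: "finite V" "finite N" and prim: "\<forall>l\<in>N. primitive_vec l"
    and VN: "\<forall>v\<in>V. \<forall>l\<in>N. l \<bullet> v \<le> 1" and cover: "\<And>x. \<forall>l\<in>N. l \<bullet> x \<le> 1 \<Longrightarrow> x \<in> P"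
    and P: "P \<subseteq> convex hull V" and \<delta>: "\<delta> > 0"
    and m0: "(LINT v:P|lborel. (\<alpha> \<bullet> v + \<gamma>) * (vector [0, 0, 0] \<bullet> v + 1)) = 0"
    and m1: "(LINT v:P|lborel. (\<alpha> \<bullet> v + (\<gamma> - \<delta>)) * (vector [1, 0, 0] \<bullet> v + 0)) = 0"
    and m2: "(LINT v:P|lborel. (\<alpha> \<bullet> v + (\<gamma> - \<delta>)) * (vector [0, 1, 0] \<bullet> v + 0)) = 0"
    and m3: "(LINT v:P|lborel. (\<alpha> \<bullet> v + (\<gamma> - \<delta>)) * (vector [0, 0, 1] \<bullet> v + 0)) = 0"
    and lower: "\<forall>v\<in>V. - 3 * \<delta> \<le> \<alpha> \<bullet> v + \<gamma>" and upper: "\<forall>v\<in>V. 4 * (\<alpha> \<bullet> v) + 5 * \<gamma> < 5 * \<delta>"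
  shows "relatively_strongly_K_stable (convex hull V)"
proof -
  have hull: "convex hull V = {x. \<forall>l\<in>N. l \<bullet> x \<le> 1}"
    using convex_hull_eq_halfspaces(1)[OF VN _ P] cover by blast
  have hull_P: "convex hull V = P"
    using convex_hull_eq_halfspaces(2)[OF VN _ P] cover by blast
  have "bounded (convex hull V)" using fin(1) by (rule finite_imp_bounded_convex_hull)
  with fin(2) prim hull interpret fano_body "convex hull V" N
    by unfold_locales blast+
  define a where "a = \<alpha> /\<^sub>R \<delta>"
  define c where "c = \<gamma> / \<delta>"
  have \<theta>: "a \<bullet> x + c = (1 / \<delta>) * (\<alpha> \<bullet> x + \<gamma>)" for x
    using \<delta> by (simp add: a_def c_def field_simps)
  show ?thesis
  proof (rule relatively_strongly_K_stableI)
    have "vol_int (\<lambda>v. a \<bullet> v + c) = (LINT v:convex hull V|lborel. a \<bullet> v + c)"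
      by (intro vol_int_eq continuous_intros)
    also have "\<dots> = (1 / \<delta>) * (LINT v:P|lborel. (\<alpha> \<bullet> v + \<gamma>) * (vector [0, 0, 0] \<bullet> v + 1))"
      unfolding hull_P \<theta> by (subst set_integral_mult_right) (simp add: inner_vector_3)
    finally show "vol_int (\<lambda>v. a \<bullet> v + c) = 0" by (simp only: m0)
    fix i :: 3
    have "vol_int (\<lambda>v. (1 - (a \<bullet> v + c)) * v $ i) = (LINT v:convex hull V|lborel. (1 - (a \<bullet> v + c)) * v $ i)"
      by (intro vol_int_eq continuous_intros)
    \<comment> \<open>The conditions \<open>m1\<close> to \<open>m3\<close> are stated for \<delta>
      times \<theta> - 1, which explains the sign and the denominator.\<close>
    also have "\<dots> = (LINT v:P|lborel. (- 1 / \<delta>) * ((\<alpha> \<bullet> v + (\<gamma> - \<delta>)) * v $ i))"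
    proof -
      have "(1 - (a \<bullet> v + c)) * v $ i = (- 1 / \<delta>) * ((\<alpha> \<bullet> v + (\<gamma> - \<delta>)) * v $ i)" for v
        unfolding \<theta> using \<delta> by (simp add: field_simps)
      then show ?thesis unfolding hull_P by simp
    qed
    also have "\<dots> = (- 1 / \<delta>) * (LINT v:P|lborel. (\<alpha> \<bullet> v + (\<gamma> - \<delta>)) * v $ i)"
      by (rule set_integral_mult_right)
    also have "(LINT v:P|lborel. (\<alpha> \<bullet> v + (\<gamma> - \<delta>)) * v $ i) = 0"
      using m1 m2 m3 exhaust_3[of i] by (auto simp: inner_vector_3)
    finally show "vol_int (\<lambda>v. (1 - (a \<bullet> v + c)) * v $ i) = 0" by simp
  next
    \<comment> \<open>Both remaining conditions are affine, so the vertices decide: halfspaces,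
      closed or open, are convex.\<close>
    have "convex {x. \<alpha> \<bullet> x \<ge> - 3 * \<delta> - \<gamma>}" by (rule convex_halfspace_ge)
    then have "convex hull V \<subseteq> {x. \<alpha> \<bullet> x \<ge> - 3 * \<delta> - \<gamma>}" using lower by (intro hull_minimal) force+
    then show "-3 \<le> a \<bullet> x + c" if "x \<in> convex hull V" for x
      using that \<delta> unfolding \<theta> by (fastforce simp: field_simps)
    have "convex {x. \<alpha> \<bullet> x < (5 * \<delta> - 5 * \<gamma>) / 4}" by (rule convex_halfspace_lt)
    then have sub: "convex hull V \<subseteq> {x. \<alpha> \<bullet> x < (5 * \<delta> - 5 * \<gamma>) / 4}" using upper by (intro hull_minimal) force+
    show "4 * (a \<bullet> x) + 5 * c < 5" if "x \<in> convex hull V" for x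
    proof -
      have "4 * (\<alpha> \<bullet> x) + 5 * \<gamma> < 5 * \<delta>" using sub that by force
      moreover have "4 * (a \<bullet> x) + 5 * c = (4 * (\<alpha> \<bullet> x) + 5 * \<gamma>) / \<delta>"
        using \<delta> by (simp add: a_def c_def field_simps)
      ultimately show ?thesis using \<delta> by (simp add: pos_divide_less_eq)
    qed
  qed
qed

section \<open>The eight polytopes\<close>

abbreviation "piece_B1 \<equiv>
  affine_piece 3 2 1 (-1) 1 (-1) 0 2 (-2) (-1) 0 0 1 (-2) (-1)"

text \<open>Slices at constant third coordinate are triangles whose side normals are permuted by
  linear symmetries of the polytope. The sum of these normals points along the third axis, so
  \<theta> depends on the third coordinate only. At height z the legs of the triangle have length 3
  - 2 z.\<close>

lemma stable_B1: "relatively_strongly_K_stable polytope_B1"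
  unfolding polytope_B1_def
proof -
  let ?N = "{vector [0, -1, 0], vector [1, 1, 2], vector [0, 0, 1], vector [0, 0, -1],
       vector [-1, 0, 0]} :: (real^3) set"
  let ?V = "{vector [0, -1, 1], vector [4, -1, -1], vector [-1, -1, -1], vector [-1, -1, 1],
       vector [-1, 4, -1], vector [-1, 0, 1]} :: (real^3) set"
  let ?P = "piece_B1"
  have sub0: "piece_B1 \<subseteq> convex hull ?V"
    by (rule affine_piece_subset_convex) (simp_all add: hull_inc pt_321)
  have bdd0: "bounded piece_B1"
    by (rule bounded_subset[OF _ sub0]) (simp add: finite_imp_bounded_convex_hull)
  have wf0: "affine_piece_wf (-1) 1 (-1) 0 2 (-2) (-1) 0 0 1 (-2) (-1)"
    by (auto simp: affine_piece_wf_def)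
  note quad0 = affine_piece_quadrature[OF distinct_321 bdd0 wf0]
  show "relatively_strongly_K_stable (convex hull ?V)"
  proof (rule stable_by_moments[where N = ?N and P = ?P
        and \<alpha> = "vector [0, 0, -620]" and \<gamma> = "-240" and \<delta> = 349])
    show "?P \<subseteq> convex hull ?V" using sub0 by blast
    show "\<forall>l\<in>?N. primitive_vec l"
      using primitive_vector[of "0" "-1" "0"]
        primitive_vector[of "1" "1" "2"]
        primitive_vector[of "0" "0" "1"]
        primitive_vector[of "0" "0" "-1"]
        primitive_vector[of "-1" "0" "0"] by simp
    show "(LINT v:?P|lborel.
        (vector [0, 0, -620] \<bullet> v + (-240)) * (vector [0, 0, 0] \<bullet> v + 1)) = 0"
      unfolding quad0
      unfolding pt_321 inner_vector_3 vector_3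
      by (simp add: boole_def simpson_def cong: boole_weak_cong simpson_weak_cong)
    show "(LINT v:?P|lborel.
        (vector [0, 0, -620] \<bullet> v + (-240 - 349)) * (vector [1, 0, 0] \<bullet> v + 0)) = 0"
      unfolding quad0
      unfolding pt_321 inner_vector_3 vector_3
      by (simp add: boole_def simpson_def cong: boole_weak_cong simpson_weak_cong)
    show "(LINT v:?P|lborel.
        (vector [0, 0, -620] \<bullet> v + (-240 - 349)) * (vector [0, 1, 0] \<bullet> v + 0)) = 0"
      unfolding quad0
      unfolding pt_321 inner_vector_3 vector_3
      by (simp add: boole_def simpson_def cong: boole_weak_cong simpson_weak_cong)
    show "(LINT v:?P|lborel.
        (vector [0, 0, -620] \<bullet> v + (-240 - 349)) * (vector [0, 0, 1] \<bullet> v + 0)) = 0"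
      unfolding quad0
      unfolding pt_321 inner_vector_3 vector_3
      by (simp add: boole_def simpson_def cong: boole_weak_cong simpson_weak_cong)
    \<comment> \<open>The upper bound 2 - 2 z of the second coordinate is not a facet inequality; it
      combines the normals \<open>[1, 1, 2]\<close> and \<open>[-1, 0, 0]\<close>.\<close>
    show "x \<in> ?P" if "\<forall>l\<in>?N. l \<bullet> x \<le> 1" for x
      using that by (simp add: affine_piece_iff inner_vector_3)
  qed (simp_all add: inner_vector_3)
qed

abbreviation "piece_B2 \<equiv>
  affine_piece 3 2 1 (-1) 1 (-1) 0 2 (-1) (-1) 0 0 1 (-1) (-1)"

text \<open>Triangular slices again, now with legs of length 3 - z; the same symmetries leave
  \<theta> a function of the third coordinate.\<close>

lemma stable_B2: "relatively_strongly_K_stable polytope_B2"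
  unfolding polytope_B2_def
proof -
  let ?N = "{vector [0, -1, 0], vector [1, 1, 1], vector [0, 0, 1], vector [0, 0, -1],
       vector [-1, 0, 0]} :: (real^3) set"
  let ?V = "{vector [1, -1, 1], vector [3, -1, -1], vector [-1, -1, -1], vector [-1, -1, 1],
       vector [-1, 3, -1], vector [-1, 1, 1]} :: (real^3) set"
  let ?P = "piece_B2"
  have sub0: "piece_B2 \<subseteq> convex hull ?V"
    by (rule affine_piece_subset_convex) (simp_all add: hull_inc pt_321)
  have bdd0: "bounded piece_B2"
    by (rule bounded_subset[OF _ sub0]) (simp add: finite_imp_bounded_convex_hull)
  have wf0: "affine_piece_wf (-1) 1 (-1) 0 2 (-1) (-1) 0 0 1 (-1) (-1)"
    by (auto simp: affine_piece_wf_def)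
  note quad0 = affine_piece_quadrature[OF distinct_321 bdd0 wf0]
  show "relatively_strongly_K_stable (convex hull ?V)"
  proof (rule stable_by_moments[where N = ?N and P = ?P
        and \<alpha> = "vector [0, 0, -70]" and \<gamma> = "-15" and \<delta> = 97])
    show "?P \<subseteq> convex hull ?V" using sub0 by blast
    show "\<forall>l\<in>?N. primitive_vec l"
      using primitive_vector[of "0" "-1" "0"]
        primitive_vector[of "1" "1" "1"]
        primitive_vector[of "0" "0" "1"]
        primitive_vector[of "0" "0" "-1"]
        primitive_vector[of "-1" "0" "0"] by simp
    show "(LINT v:?P|lborel.
        (vector [0, 0, -70] \<bullet> v + (-15)) * (vector [0, 0, 0] \<bullet> v + 1)) = 0"
      unfolding quad0
      unfolding pt_321 inner_vector_3 vector_3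
      by (simp add: boole_def simpson_def cong: boole_weak_cong simpson_weak_cong)
    show "(LINT v:?P|lborel.
        (vector [0, 0, -70] \<bullet> v + (-15 - 97)) * (vector [1, 0, 0] \<bullet> v + 0)) = 0"
      unfolding quad0
      unfolding pt_321 inner_vector_3 vector_3
      by (simp add: boole_def simpson_def cong: boole_weak_cong simpson_weak_cong)
    show "(LINT v:?P|lborel.
        (vector [0, 0, -70] \<bullet> v + (-15 - 97)) * (vector [0, 1, 0] \<bullet> v + 0)) = 0"
      unfolding quad0
      unfolding pt_321 inner_vector_3 vector_3
      by (simp add: boole_def simpson_def cong: boole_weak_cong simpson_weak_cong)
    show "(LINT v:?P|lborel.
        (vector [0, 0, -70] \<bullet> v + (-15 - 97)) * (vector [0, 0, 1] \<bullet> v + 0)) = 0"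
      unfolding quad0
      unfolding pt_321 inner_vector_3 vector_3
      by (simp add: boole_def simpson_def cong: boole_weak_cong simpson_weak_cong)
    show "x \<in> ?P" if "\<forall>l\<in>?N. l \<bullet> x \<le> 1" for x
      using that by (simp add: affine_piece_iff inner_vector_3)
  qed (simp_all add: inner_vector_3)
qed

abbreviation "piece_B3 \<equiv>
  affine_piece 1 2 3 (-1) 2 (-1) 0 1 (-1) (-1) 0 0 1 (-1) (-1)"

text \<open>Two symmetries, the exchange of x and y and the map sending z to -x - y - z, fix only
  multiples of x + y among linear forms. The base is a triangle in the first two coordinates, and
  the height 2 - x - y over it is at least 1.\<close>

lemma stable_B3: "relatively_strongly_K_stable polytope_B3"
  unfolding polytope_B3_def
proof -
  let ?N = "{vector [1, 1, 0], vector [0, -1, 0], vector [1, 1, 1], vector [0, 0, -1],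
       vector [-1, 0, 0]} :: (real^3) set"
  let ?V = "{vector [2, -1, 0], vector [2, -1, -1], vector [-1, 2, -1], vector [-1, -1, -1],
       vector [-1, 2, 0], vector [-1, -1, 3]} :: (real^3) set"
  let ?P = "piece_B3"
  have sub0: "piece_B3 \<subseteq> convex hull ?V"
    by (rule affine_piece_subset_convex) (simp_all add: hull_inc pt_123)
  have bdd0: "bounded piece_B3"
    by (rule bounded_subset[OF _ sub0]) (simp add: finite_imp_bounded_convex_hull)
  have wf0: "affine_piece_wf (-1) 2 (-1) 0 1 (-1) (-1) 0 0 1 (-1) (-1)"
    by (auto simp: affine_piece_wf_def)
  note quad0 = affine_piece_quadrature[OF distinct_123 bdd0 wf0]
  show "relatively_strongly_K_stable (convex hull ?V)"
  proof (rule stable_by_moments[where N = ?N and P = ?P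
        and \<alpha> = "vector [-20, -20, 0]" and \<gamma> = "-5" and \<delta> = 43])
    show "?P \<subseteq> convex hull ?V" using sub0 by blast
    show "\<forall>l\<in>?N. primitive_vec l"
      using primitive_vector[of "1" "1" "0"]
        primitive_vector[of "0" "-1" "0"]
        primitive_vector[of "1" "1" "1"]
        primitive_vector[of "0" "0" "-1"]
        primitive_vector[of "-1" "0" "0"] by simp
    show "(LINT v:?P|lborel.
        (vector [-20, -20, 0] \<bullet> v + (-5)) * (vector [0, 0, 0] \<bullet> v + 1)) = 0"
      unfolding quad0
      unfolding pt_123 inner_vector_3 vector_3
      by (simp add: boole_def simpson_def cong: boole_weak_cong simpson_weak_cong)
    show "(LINT v:?P|lborel.
        (vector [-20, -20, 0] \<bullet> v + (-5 - 43)) * (vector [1, 0, 0] \<bullet> v + 0)) = 0"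
      unfolding quad0
      unfolding pt_123 inner_vector_3 vector_3
      by (simp add: boole_def simpson_def cong: boole_weak_cong simpson_weak_cong)
    show "(LINT v:?P|lborel.
        (vector [-20, -20, 0] \<bullet> v + (-5 - 43)) * (vector [0, 1, 0] \<bullet> v + 0)) = 0"
      unfolding quad0
      unfolding pt_123 inner_vector_3 vector_3
      by (simp add: boole_def simpson_def cong: boole_weak_cong simpson_weak_cong)
    show "(LINT v:?P|lborel.
        (vector [-20, -20, 0] \<bullet> v + (-5 - 43)) * (vector [0, 0, 1] \<bullet> v + 0)) = 0"
      unfolding quad0
      unfolding pt_123 inner_vector_3 vector_3
      by (simp add: boole_def simpson_def cong: boole_weak_cong simpson_weak_cong)
    show "x \<in> ?P" if "\<forall>l\<in>?N. l \<bullet> x \<le> 1" for x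
      using that by (simp add: affine_piece_iff inner_vector_3)
  qed (simp_all add: inner_vector_3)
qed

abbreviation "piece_C1 \<equiv>
  affine_piece 3 2 1 (-1) 1 (-1) 0 1 (-1) (-1) 0 0 1 (-1) 0"

text \<open>Slices at height z are squares of side 2 - z. Reversing either side, x to -x - z or y to
  -y - z, is a symmetry, which leaves only the third coordinate in \<theta>.\<close>

lemma stable_C1: "relatively_strongly_K_stable polytope_C1"
  unfolding polytope_C1_def
proof -
  let ?N = "{vector [1, 0, 1], vector [0, -1, 0], vector [0, 0, 1], vector [0, 0, -1],
       vector [0, 1, 1], vector [-1, 0, 0]} :: (real^3) set"
  let ?V = "{vector [0, -1, 1], vector [2, -1, -1], vector [2, 2, -1], vector [0, 0, 1],
       vector [-1, 2, -1], vector [-1, 0, 1], vector [-1, -1, -1],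
       vector [-1, -1, 1]} :: (real^3) set"
  let ?P = "piece_C1"
  have sub0: "piece_C1 \<subseteq> convex hull ?V"
    by (rule affine_piece_subset_convex) (simp_all add: hull_inc pt_321)
  have bdd0: "bounded piece_C1"
    by (rule bounded_subset[OF _ sub0]) (simp add: finite_imp_bounded_convex_hull)
  have wf0: "affine_piece_wf (-1) 1 (-1) 0 1 (-1) (-1) 0 0 1 (-1) 0"
    by (auto simp: affine_piece_wf_def)
  note quad0 = affine_piece_quadrature[OF distinct_321 bdd0 wf0]
  show "relatively_strongly_K_stable (convex hull ?V)"
  proof (rule stable_by_moments[where N = ?N and P = ?P
        and \<alpha> = "vector [0, 0, -260]" and \<gamma> = "-80" and \<delta> = 219])
    show "?P \<subseteq> convex hull ?V" using sub0 by blast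
    show "\<forall>l\<in>?N. primitive_vec l"
      using primitive_vector[of "1" "0" "1"]
        primitive_vector[of "0" "-1" "0"]
        primitive_vector[of "0" "0" "1"]
        primitive_vector[of "0" "0" "-1"]
        primitive_vector[of "0" "1" "1"]
        primitive_vector[of "-1" "0" "0"] by simp
    show "(LINT v:?P|lborel.
        (vector [0, 0, -260] \<bullet> v + (-80)) * (vector [0, 0, 0] \<bullet> v + 1)) = 0"
      unfolding quad0
      unfolding pt_321 inner_vector_3 vector_3
      by (simp add: boole_def simpson_def cong: boole_weak_cong simpson_weak_cong)
    show "(LINT v:?P|lborel.
        (vector [0, 0, -260] \<bullet> v + (-80 - 219)) * (vector [1, 0, 0] \<bullet> v + 0)) = 0"
      unfolding quad0
      unfolding pt_321 inner_vector_3 vector_3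
      by (simp add: boole_def simpson_def cong: boole_weak_cong simpson_weak_cong)
    show "(LINT v:?P|lborel.
        (vector [0, 0, -260] \<bullet> v + (-80 - 219)) * (vector [0, 1, 0] \<bullet> v + 0)) = 0"
      unfolding quad0
      unfolding pt_321 inner_vector_3 vector_3
      by (simp add: boole_def simpson_def cong: boole_weak_cong simpson_weak_cong)
    show "(LINT v:?P|lborel.
        (vector [0, 0, -260] \<bullet> v + (-80 - 219)) * (vector [0, 0, 1] \<bullet> v + 0)) = 0"
      unfolding quad0
      unfolding pt_321 inner_vector_3 vector_3
      by (simp add: boole_def simpson_def cong: boole_weak_cong simpson_weak_cong)
    show "x \<in> ?P" if "\<forall>l\<in>?N. l \<bullet> x \<le> 1" for x
      using that by (simp add: affine_piece_iff inner_vector_3)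
  qed (simp_all add: inner_vector_3)
qed

abbreviation "piece_C4 \<equiv>
  affine_piece 3 2 1 (-1) 1 (-1) 0 1 0 (-1) 0 0 1 0 (-1)"

text \<open>A trapezium times a segment. Reflecting z and sending x to -x - y are symmetries, so
  \<theta> depends on y alone.\<close>

lemma stable_C4: "relatively_strongly_K_stable polytope_C4"
  unfolding polytope_C4_def
proof -
  let ?N = "{vector [1, 1, 0], vector [0, -1, 0], vector [0, 0, 1], vector [0, 0, -1],
       vector [0, 1, 0], vector [-1, 0, 0]} :: (real^3) set"
  let ?V = "{vector [2, -1, 1], vector [2, -1, -1], vector [0, 1, 1], vector [0, 1, -1],
       vector [-1, 1, 1], vector [-1, 1, -1], vector [-1, -1, 1],
       vector [-1, -1, -1]} :: (real^3) set"
  let ?P = "piece_C4"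
  have sub0: "piece_C4 \<subseteq> convex hull ?V"
    by (rule affine_piece_subset_convex) (simp_all add: hull_inc pt_321)
  have bdd0: "bounded piece_C4"
    by (rule bounded_subset[OF _ sub0]) (simp add: finite_imp_bounded_convex_hull)
  have wf0: "affine_piece_wf (-1) 1 (-1) 0 1 0 (-1) 0 0 1 0 (-1)"
    by (auto simp: affine_piece_wf_def)
  note quad0 = affine_piece_quadrature[OF distinct_321 bdd0 wf0]
  show "relatively_strongly_K_stable (convex hull ?V)"
  proof (rule stable_by_moments[where N = ?N and P = ?P
        and \<alpha> = "vector [0, -6, 0]" and \<gamma> = "-1" and \<delta> = 11])
    show "?P \<subseteq> convex hull ?V" using sub0 by blast
    show "\<forall>l\<in>?N. primitive_vec l"
      using primitive_vector[of "1" "1" "0"]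
        primitive_vector[of "0" "-1" "0"]
        primitive_vector[of "0" "0" "1"]
        primitive_vector[of "0" "0" "-1"]
        primitive_vector[of "0" "1" "0"]
        primitive_vector[of "-1" "0" "0"] by simp
    show "(LINT v:?P|lborel.
        (vector [0, -6, 0] \<bullet> v + (-1)) * (vector [0, 0, 0] \<bullet> v + 1)) = 0"
      unfolding quad0
      unfolding pt_321 inner_vector_3 vector_3
      by (simp add: boole_def simpson_def cong: boole_weak_cong simpson_weak_cong)
    show "(LINT v:?P|lborel.
        (vector [0, -6, 0] \<bullet> v + (-1 - 11)) * (vector [1, 0, 0] \<bullet> v + 0)) = 0"
      unfolding quad0
      unfolding pt_321 inner_vector_3 vector_3
      by (simp add: boole_def simpson_def cong: boole_weak_cong simpson_weak_cong)
    show "(LINT v:?P|lborel.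
        (vector [0, -6, 0] \<bullet> v + (-1 - 11)) * (vector [0, 1, 0] \<bullet> v + 0)) = 0"
      unfolding quad0
      unfolding pt_321 inner_vector_3 vector_3
      by (simp add: boole_def simpson_def cong: boole_weak_cong simpson_weak_cong)
    show "(LINT v:?P|lborel.
        (vector [0, -6, 0] \<bullet> v + (-1 - 11)) * (vector [0, 0, 1] \<bullet> v + 0)) = 0"
      unfolding quad0
      unfolding pt_321 inner_vector_3 vector_3
      by (simp add: boole_def simpson_def cong: boole_weak_cong simpson_weak_cong)
    show "x \<in> ?P" if "\<forall>l\<in>?N. l \<bullet> x \<le> 1" for x
      using that by (simp add: affine_piece_iff inner_vector_3)
  qed (simp_all add: inner_vector_3)
qed

abbreviation "piece_E3a \<equiv>
  affine_piece 1 2 3 (-1) 0 (-1) 0 1 0 (-1) 0 0 1 0 0"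
abbreviation "piece_E3b \<equiv>
  affine_piece 1 2 3 0 1 (-1) 0 1 (-1) (-1) 0 0 1 0 0"

text \<open>A pentagon times a segment. The upper bound of y is the smaller of 1 and 1 - x, hence
  the cut at x = 0. Exchanging x and y makes the first two coefficients of \<alpha> equal, and
  reflecting z removes the third.\<close>

lemma stable_E3: "relatively_strongly_K_stable polytope_E3"
  unfolding polytope_E3_def
proof -
  let ?N = "{vector [1, 0, 0], vector [0, -1, 0], vector [0, 0, 1], vector [0, 0, -1],
       vector [1, 1, 0], vector [0, 1, 0], vector [-1, 0, 0]} :: (real^3) set"
  let ?V = "{vector [1, -1, 1], vector [1, -1, -1], vector [1, 0, 1], vector [1, 0, -1],
       vector [0, 1, 1], vector [0, 1, -1], vector [-1, 1, 1], vector [-1, 1, -1],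
       vector [-1, -1, 1], vector [-1, -1, -1]} :: (real^3) set"
  let ?P = "piece_E3a \<union> piece_E3b"
  \<comment> \<open>The cut meets two parallel edges of the prism at their midpoints, which are
    corners of both regions without being vertices.\<close>
  have mid0: "vector [0, -1, 1] \<in> convex hull ?V"
    using convex_midpoint_vector_3[OF convex_convex_hull, of "-1" "-1" "1" ?V "1" "-1" "1"]
    by (simp add: hull_inc)
  have mid1: "vector [0, -1, -1] \<in> convex hull ?V"
    using convex_midpoint_vector_3[OF convex_convex_hull, of "-1" "-1" "-1" ?V "1" "-1" "-1"]
    by (simp add: hull_inc)
  have sub0: "piece_E3a \<subseteq> convex hull ?V"
    by (rule affine_piece_subset_convex) (simp_all add: hull_inc pt_123 mid0 mid1)
  have bdd0: "bounded piece_E3a"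
    by (rule bounded_subset[OF _ sub0]) (simp add: finite_imp_bounded_convex_hull)
  have sub1: "piece_E3b \<subseteq> convex hull ?V"
    by (rule affine_piece_subset_convex) (simp_all add: hull_inc pt_123 mid0 mid1)
  have bdd1: "bounded piece_E3b"
    by (rule bounded_subset[OF _ sub1]) (simp add: finite_imp_bounded_convex_hull)
  have wf0: "affine_piece_wf (-1) 0 (-1) 0 1 0 (-1) 0 0 1 0 0"
    by (auto simp: affine_piece_wf_def)
  have wf1: "affine_piece_wf 0 1 (-1) 0 1 (-1) (-1) 0 0 1 0 0"
    by (auto simp: affine_piece_wf_def)
  note quad0 = affine_piece_quadrature[OF distinct_123 bdd0 wf0]
  note quad1 = affine_piece_quadrature[OF distinct_123 bdd1 wf1]
  show "relatively_strongly_K_stable (convex hull ?V)"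
  proof (rule stable_by_moments[where N = ?N and P = ?P
        and \<alpha> = "vector [-168, -168, 0]" and \<gamma> = "-32" and \<delta> = 409])
    show "?P \<subseteq> convex hull ?V" using sub0 sub1 by blast
    show "\<forall>l\<in>?N. primitive_vec l"
      using primitive_vector[of "1" "0" "0"]
        primitive_vector[of "0" "-1" "0"]
        primitive_vector[of "0" "0" "1"]
        primitive_vector[of "0" "0" "-1"]
        primitive_vector[of "1" "1" "0"]
        primitive_vector[of "0" "1" "0"]
        primitive_vector[of "-1" "0" "0"] by simp
    show "(LINT v:?P|lborel.
        (vector [-168, -168, 0] \<bullet> v + (-32)) * (vector [0, 0, 0] \<bullet> v + 1)) = 0"
      unfolding set_integral_affine_piece_Un[OF bdd0 bdd1] quad0 quad1
      unfolding pt_123 inner_vector_3 vector_3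
      by (simp add: boole_def simpson_def cong: boole_weak_cong simpson_weak_cong)
    show "(LINT v:?P|lborel.
        (vector [-168, -168, 0] \<bullet> v + (-32 - 409)) * (vector [1, 0, 0] \<bullet> v + 0)) = 0"
      unfolding set_integral_affine_piece_Un[OF bdd0 bdd1] quad0 quad1
      unfolding pt_123 inner_vector_3 vector_3
      by (simp add: boole_def simpson_def cong: boole_weak_cong simpson_weak_cong)
    show "(LINT v:?P|lborel.
        (vector [-168, -168, 0] \<bullet> v + (-32 - 409)) * (vector [0, 1, 0] \<bullet> v + 0)) = 0"
      unfolding set_integral_affine_piece_Un[OF bdd0 bdd1] quad0 quad1
      unfolding pt_123 inner_vector_3 vector_3
      by (simp add: boole_def simpson_def cong: boole_weak_cong simpson_weak_cong)
    show "(LINT v:?P|lborel.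
        (vector [-168, -168, 0] \<bullet> v + (-32 - 409)) * (vector [0, 0, 1] \<bullet> v + 0)) = 0"
      unfolding set_integral_affine_piece_Un[OF bdd0 bdd1] quad0 quad1
      unfolding pt_123 inner_vector_3 vector_3
      by (simp add: boole_def simpson_def cong: boole_weak_cong simpson_weak_cong)
    show "x \<in> ?P" if "\<forall>l\<in>?N. l \<bullet> x \<le> 1" for x
      using that by (cases "x $ 1 \<le> 0") (simp_all add: affine_piece_iff inner_vector_3)
  qed (simp_all add: inner_vector_3)
qed

abbreviation "piece_E4a \<equiv>
  affine_piece 1 2 3 (-1) 0 (-1) 0 1 0 (-1) 0 0 1 0 1"
abbreviation "piece_E4b \<equiv>
  affine_piece 1 2 3 0 1 (-1) 0 1 (-1) (-1) 0 0 1 0 1"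

text \<open>The pentagon of \<open>polytope_E3\<close> as base, now with upper bound 1 + y for z.
  Sending z to y - z is a symmetry and removes the third coefficient, but the exchange of x and y is
  lost. Two independent coefficients remain to be solved for, hence the large integers.\<close>

lemma stable_E4: "relatively_strongly_K_stable polytope_E4"
  unfolding polytope_E4_def
proof -
  let ?N = "{vector [1, 0, 0], vector [0, -1, 0], vector [0, -1, 1], vector [0, 0, -1],
       vector [1, 1, 0], vector [0, 1, 0], vector [-1, 0, 0]} :: (real^3) set"
  let ?V = "{vector [1, -1, 0], vector [1, -1, -1], vector [0, 1, -1], vector [1, 0, -1],
       vector [1, 0, 1], vector [0, 1, 2], vector [-1, 1, -1], vector [-1, 1, 2],
       vector [-1, -1, -1], vector [-1, -1, 0]} :: (real^3) set"
  let ?P = "piece_E4a \<union> piece_E4b"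
  have mid0: "vector [0, -1, 0] \<in> convex hull ?V"
    using convex_midpoint_vector_3[OF convex_convex_hull, of "-1" "-1" "0" ?V "1" "-1" "0"]
    by (simp add: hull_inc)
  have mid1: "vector [0, -1, -1] \<in> convex hull ?V"
    using convex_midpoint_vector_3[OF convex_convex_hull, of "-1" "-1" "-1" ?V "1" "-1" "-1"]
    by (simp add: hull_inc)
  have sub0: "piece_E4a \<subseteq> convex hull ?V"
    by (rule affine_piece_subset_convex) (simp_all add: hull_inc pt_123 mid0 mid1)
  have bdd0: "bounded piece_E4a"
    by (rule bounded_subset[OF _ sub0]) (simp add: finite_imp_bounded_convex_hull)
  have sub1: "piece_E4b \<subseteq> convex hull ?V"
    by (rule affine_piece_subset_convex) (simp_all add: hull_inc pt_123 mid0 mid1)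
  have bdd1: "bounded piece_E4b"
    by (rule bounded_subset[OF _ sub1]) (simp add: finite_imp_bounded_convex_hull)
  have wf0: "affine_piece_wf (-1) 0 (-1) 0 1 0 (-1) 0 0 1 0 1"
    by (auto simp: affine_piece_wf_def)
  have wf1: "affine_piece_wf 0 1 (-1) 0 1 (-1) (-1) 0 0 1 0 1"
    by (auto simp: affine_piece_wf_def)
  note quad0 = affine_piece_quadrature[OF distinct_123 bdd0 wf0]
  note quad1 = affine_piece_quadrature[OF distinct_123 bdd1 wf1]
  show "relatively_strongly_K_stable (convex hull ?V)"
  proof (rule stable_by_moments[where N = ?N and P = ?P
        and \<alpha> = "vector [-171040, 39680, 0]" and \<gamma> = "-24929" and \<delta> = 394975])
    show "?P \<subseteq> convex hull ?V" using sub0 sub1 by blast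
    show "\<forall>l\<in>?N. primitive_vec l"
      using primitive_vector[of "1" "0" "0"]
        primitive_vector[of "0" "-1" "0"]
        primitive_vector[of "0" "-1" "1"]
        primitive_vector[of "0" "0" "-1"]
        primitive_vector[of "1" "1" "0"]
        primitive_vector[of "0" "1" "0"]
        primitive_vector[of "-1" "0" "0"] by simp
    show "(LINT v:?P|lborel.
        (vector [-171040, 39680, 0] \<bullet> v + (-24929)) * (vector [0, 0, 0] \<bullet> v + 1)) = 0"
      unfolding set_integral_affine_piece_Un[OF bdd0 bdd1] quad0 quad1
      unfolding pt_123 inner_vector_3 vector_3
      by (simp add: boole_def simpson_def cong: boole_weak_cong simpson_weak_cong)
    show "(LINT v:?P|lborel.
        (vector [-171040, 39680, 0] \<bullet> v + (-24929 - 394975)) * (vector [1, 0, 0] \<bullet> v + 0)) = 0"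
      unfolding set_integral_affine_piece_Un[OF bdd0 bdd1] quad0 quad1
      unfolding pt_123 inner_vector_3 vector_3
      by (simp add: boole_def simpson_def cong: boole_weak_cong simpson_weak_cong)
    show "(LINT v:?P|lborel.
        (vector [-171040, 39680, 0] \<bullet> v + (-24929 - 394975)) * (vector [0, 1, 0] \<bullet> v + 0)) = 0"
      unfolding set_integral_affine_piece_Un[OF bdd0 bdd1] quad0 quad1
      unfolding pt_123 inner_vector_3 vector_3
      by (simp add: boole_def simpson_def cong: boole_weak_cong simpson_weak_cong)
    show "(LINT v:?P|lborel.
        (vector [-171040, 39680, 0] \<bullet> v + (-24929 - 394975)) * (vector [0, 0, 1] \<bullet> v + 0)) = 0"
      unfolding set_integral_affine_piece_Un[OF bdd0 bdd1] quad0 quad1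
      unfolding pt_123 inner_vector_3 vector_3
      by (simp add: boole_def simpson_def cong: boole_weak_cong simpson_weak_cong)
    show "x \<in> ?P" if "\<forall>l\<in>?N. l \<bullet> x \<le> 1" for x
      using that by (cases "x $ 1 \<le> 0") (simp_all add: affine_piece_iff inner_vector_3)
  qed (simp_all add: inner_vector_3)
qed

abbreviation "piece_F2a \<equiv>
  affine_piece 1 2 3 (-1) 0 (-1) 0 1 1 (-1) 0 0 1 0 1"
abbreviation "piece_F2b \<equiv>
  affine_piece 1 2 3 0 1 (-1) 1 1 0 (-1) 0 0 1 0 1"

text \<open>A hexagonal base with z between -1 and 1 + y. The cut at x = 0 has all its corners at
  vertices of the polytope. The symmetries sending z to y - z and x to y - x leave \<theta> a
  function of y.\<close>

lemma stable_F2: "relatively_strongly_K_stable polytope_F2"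
  unfolding polytope_F2_def
proof -
  let ?N = "{vector [0, 1, 0], vector [-1, 1, 0], vector [0, -1, 1], vector [0, 0, -1],
       vector [1, 0, 0], vector [1, -1, 0], vector [0, -1, 0],
       vector [-1, 0, 0]} :: (real^3) set"
  let ?V = "{vector [0, 1, 2], vector [0, 1, -1], vector [1, 1, 2], vector [1, 0, 1],
       vector [1, 0, -1], vector [1, 1, -1], vector [0, -1, -1], vector [0, -1, 0],
       vector [-1, -1, 0], vector [-1, -1, -1], vector [-1, 0, -1],
       vector [-1, 0, 1]} :: (real^3) set"
  let ?P = "piece_F2a \<union> piece_F2b"
  have sub0: "piece_F2a \<subseteq> convex hull ?V"
    by (rule affine_piece_subset_convex) (simp_all add: hull_inc pt_123)
  have bdd0: "bounded piece_F2a"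
    by (rule bounded_subset[OF _ sub0]) (simp add: finite_imp_bounded_convex_hull)
  have sub1: "piece_F2b \<subseteq> convex hull ?V"
    by (rule affine_piece_subset_convex) (simp_all add: hull_inc pt_123)
  have bdd1: "bounded piece_F2b"
    by (rule bounded_subset[OF _ sub1]) (simp add: finite_imp_bounded_convex_hull)
  have wf0: "affine_piece_wf (-1) 0 (-1) 0 1 1 (-1) 0 0 1 0 1"
    by (auto simp: affine_piece_wf_def)
  have wf1: "affine_piece_wf 0 1 (-1) 1 1 0 (-1) 0 0 1 0 1"
    by (auto simp: affine_piece_wf_def)
  note quad0 = affine_piece_quadrature[OF distinct_123 bdd0 wf0]
  note quad1 = affine_piece_quadrature[OF distinct_123 bdd1 wf1]
  show "relatively_strongly_K_stable (convex hull ?V)"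
  proof (rule stable_by_moments[where N = ?N and P = ?P
        and \<alpha> = "vector [0, 36, 0]" and \<gamma> = "-5" and \<delta> = 67])
    show "?P \<subseteq> convex hull ?V" using sub0 sub1 by blast
    show "\<forall>l\<in>?N. primitive_vec l"
      using primitive_vector[of "0" "1" "0"]
        primitive_vector[of "-1" "1" "0"]
        primitive_vector[of "0" "-1" "1"]
        primitive_vector[of "0" "0" "-1"]
        primitive_vector[of "1" "0" "0"]
        primitive_vector[of "1" "-1" "0"]
        primitive_vector[of "0" "-1" "0"]
        primitive_vector[of "-1" "0" "0"] by simp
    show "(LINT v:?P|lborel.
        (vector [0, 36, 0] \<bullet> v + (-5)) * (vector [0, 0, 0] \<bullet> v + 1)) = 0"
      unfolding set_integral_affine_piece_Un[OF bdd0 bdd1] quad0 quad1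
      unfolding pt_123 inner_vector_3 vector_3
      by (simp add: boole_def simpson_def cong: boole_weak_cong simpson_weak_cong)
    show "(LINT v:?P|lborel.
        (vector [0, 36, 0] \<bullet> v + (-5 - 67)) * (vector [1, 0, 0] \<bullet> v + 0)) = 0"
      unfolding set_integral_affine_piece_Un[OF bdd0 bdd1] quad0 quad1
      unfolding pt_123 inner_vector_3 vector_3
      by (simp add: boole_def simpson_def cong: boole_weak_cong simpson_weak_cong)
    show "(LINT v:?P|lborel.
        (vector [0, 36, 0] \<bullet> v + (-5 - 67)) * (vector [0, 1, 0] \<bullet> v + 0)) = 0"
      unfolding set_integral_affine_piece_Un[OF bdd0 bdd1] quad0 quad1
      unfolding pt_123 inner_vector_3 vector_3
      by (simp add: boole_def simpson_def cong: boole_weak_cong simpson_weak_cong)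
    show "(LINT v:?P|lborel.
        (vector [0, 36, 0] \<bullet> v + (-5 - 67)) * (vector [0, 0, 1] \<bullet> v + 0)) = 0"
      unfolding set_integral_affine_piece_Un[OF bdd0 bdd1] quad0 quad1
      unfolding pt_123 inner_vector_3 vector_3
      by (simp add: boole_def simpson_def cong: boole_weak_cong simpson_weak_cong)
    show "x \<in> ?P" if "\<forall>l\<in>?N. l \<bullet> x \<le> 1" for x
      using that by (cases "x $ 1 \<le> 0") (simp_all add: affine_piece_iff inner_vector_3)
  qed (simp_all add: inner_vector_3)
qed

theorem theorem6p1:
  fixes \<Delta> :: "(real^3) set"
  assumes "smooth_fano_polytope \<Delta>"
    and "\<not> futaki_vanishes \<Delta>"
    and "\<Delta> \<in> {polytope_B1, polytope_B2, polytope_B3, polytope_C1,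
               polytope_C4, polytope_E3, polytope_E4, polytope_F2}"
  shows "relatively_strongly_K_stable \<Delta>"
  using assms(3) stable_B1 stable_B2 stable_B3 stable_C1 stable_C4 stable_E3 stable_E4 stable_F2
  by blast

end
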